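(* Let $(X,g)$ be a compact Hermitian manifold of complex dimension $2$ and $\omega$ its associated real $(1,1)$-form. For $\varphi',\varphi''\in\mathcal{P}_{\omega}$ and a smooth path $\{\varphi_t\}_{0\le t\le 1}$ in $\mathcal{P}_\omega$ from $\varphi_0=\varphi'$ to $\varphi_1=\varphi''$, put $$\mathcal{L}^{\mathrm{M}}_{\omega}(\varphi',\varphi''):=\frac{1}{V_{\omega}}\int_{0}^{1}\int_{X}\dot{\varphi}_{t}\,\omega_{\varphi_{t}}^{2}\,dt-\frac{1}{V_{\omega}}\int_{0}^{1}\int_{X}\sqrt{-1}\,\partial\omega\wedge(\overline{\partial}\dot{\varphi}_{t}\cdot\varphi_{t})\,dt+\frac{1}{V_{\omega}}\int_{0}^{1}\int_{X}\sqrt{-1}\,\overline{\partial}\omega\wedge(\partial\dot{\varphi}_{t}\cdot\varphi_{t})\,dt .$$ Then $\mathcal{L}^{\mathrm{M}}_{\omega}(\varphi',\varphi'')$ is independent of the choice of the smooth path $\{\varphi_t\}_{0\le t\le1}$, and $\mathcal{L}^{\mathrm{M}}_{\omega}:\mathcal{P}_\omega\times\mathcal{P}_\omega\to\mathbb{R}$ satisfies the $1$-cocycle condition. In particular, writing $\mathcal{L}^{\mathrm{M}}_{\omega}(\varphi):=\mathcal{L}^{\mathrm{M}}_{\omega}(0,\varphi)$, for every $\varphi\in\mathcal{P}_\omega$, $$\mathcal{L}^{\mathrm{M}}_{\omega}(\varphi)=\frac{1}{3V_{\omega}}\int_{X}\varphi\,(\omega^{2}+\omega\wedge\omega_{\varphi}+\omega_{\varphi}^{2})+\frac{1}{2V_{\omega}}\int_{X}\varphi\left[-\sqrt{-1}\,\partial\omega\wedge\overline{\partial}\varphi+\sqrt{-1}\,\overline{\partial}\omega\wedge\partial\varphi\right].$$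 Moreover, for any $\varphi\in\mathcal{P}_{\omega}$ and any constant $C\in\mathbb{R}$, $$\mathcal{L}^{\mathrm{M}}_{\omega}(\varphi,\varphi+C)=C\cdot\left(1-\frac{\mathrm{Err}_{\omega}(\varphi)}{V_{\omega}}\right),$$ and for any $\varphi_{1},\varphi_{2}\in\mathcal{P}_{\omega}$ and any constant $C\in\mathbb{R}$, $$\mathcal{L}^{\mathrm{M}}_{\omega}(\varphi_{1},\varphi_{2}+C)=\mathcal{L}^{\mathrm{M}}_{\omega}(\varphi_{1},\varphi_{2})+C\cdot\left(1-\frac{\mathrm{Err}_{\omega}(\varphi_{2})}{V_{\omega}}\right).$$
   Context: The associated real $(1,1)$-form of $g=(g_{i\overline j})$ is $\omega=\sqrt{-1}\,g_{i\overline{j}}\,dz^{i}\wedge d\overline{z^{j}}$ (not assumed closed). For a real-valued smooth function $\varphi$, $\omega_\varphi:=\omega+\sqrt{-1}\,\partial\overline{\partial}\varphi$, and $\mathcal{P}_{\omega}:=\{\varphi\in C^{\infty}(X)_{\mathbb{R}} : \omega_\varphi>0\}$, where $C^{\infty}(X)_{\mathbb{R}}$ is the space of real-valued smooth functions and $>0$ means positive definite on $X$. $V_\omega:=\int_X\omega^2$ and $\mathrm{Err}_\omega(\varphi):=\int_X\omega^2-\int_X\omega_\varphi^2$. $\dot\varphi_t$ is the derivative of $\varphi_t$ in $t$. A mapping $\mathcal{N}:S\times S\to A$, with $S$ a non-empty set and $A$ an additive group, satisfies the $1$-cocycle condition if for all $\sigma_1,\sigma_2,\sigma_3\in S$: (i)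 $\mathcal{N}(\sigma_1,\sigma_2)+\mathcal{N}(\sigma_2,\sigma_1)=0$; (ii) $\mathcal{N}(\sigma_1,\sigma_2)+\mathcal{N}(\sigma_2,\sigma_3)+\mathcal{N}(\sigma_3,\sigma_1)=0$. *)

theory Defs
  imports "HOL-Analysis.Analysis" "HOL-Library.Function_Algebras"
begin

section \<open>Smoothness\<close>

text \<open>The following predicate is meant for open \<open>S\<close>.\<close>

primrec Ck_on :: "nat \<Rightarrow> 'a::real_normed_vector set \<Rightarrow> ('a \<Rightarrow> 'b::real_normed_vector) \<Rightarrow> bool" where
  "Ck_on 0 S f \<longleftrightarrow> continuous_on S f"
| "Ck_on (Suc k) S f \<longleftrightarrow>
     (\<forall>x\<in>S. f differentiable (at x)) \<and> (\<forall>v. Ck_on k S (\<lambda>x. frechet_derivative f (at x) v))"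

text \<open>Smoothness on an arbitrary set \<open>S\<close> (needed for \<open>[0,1] \<times> U\<close>): near every point of \<open>S\<close> the
  function has a smooth extension to an open set. For open \<open>S\<close> this is ordinary smoothness.\<close>

definition smooth_on :: "'a::real_normed_vector set \<Rightarrow> ('a \<Rightarrow> 'b::real_normed_vector) \<Rightarrow> bool" where
  "smooth_on S f \<longleftrightarrow>
     (\<forall>x\<in>S. \<exists>W h. open W \<and> x \<in> W \<and> (\<forall>k. Ck_on k W h) \<and> (\<forall>y\<in>W \<inter> S. h y = f y))"

section \<open>Wirtinger derivatives\<close>

text \<open>\<open>pd i\<close> is \<open>\<partial>/\<partial>z\<^sup>i\<close> and \<open>pdbar i\<close> is the derivative with respect to the conjugate coordinate,
  applied componentwise to vector-valued functions. In the index type \<open>2\<close> the numeral \<open>2\<close> equals \<open>0\<close>,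
  so \<open>z $ 1\<close> and \<open>z $ 2\<close> are the two coordinates.\<close>

definition pd :: "2 \<Rightarrow> (complex^2 \<Rightarrow> complex^'n) \<Rightarrow> complex^2 \<Rightarrow> complex^'n" where
  "pd i f z = (1/2) *s (frechet_derivative f (at z) (axis i 1)
                          - \<i> *s frechet_derivative f (at z) (axis i \<i>))"

definition pdbar :: "2 \<Rightarrow> (complex^2 \<Rightarrow> complex^'n) \<Rightarrow> complex^2 \<Rightarrow> complex^'n" where
  "pdbar i f z = (1/2) *s (frechet_derivative f (at z) (axis i 1)
                             + \<i> *s frechet_derivative f (at z) (axis i \<i>))"

definition holomorphic_map_on :: "(complex^2) set \<Rightarrow> (complex^2 \<Rightarrow> complex^2) \<Rightarrow> bool" where
  "holomorphic_map_on S F \<longleftrightarrow> smooth_on S F \<and> (\<forall>z\<in>S. \<forall>i. pdbar i F z = 0)"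

section \<open>Compact complex surfaces\<close>

record 'a chart =
  cdom :: "'a set"
  cmap :: "'a \<Rightarrow> complex^2"

definition cimg :: "'a chart \<Rightarrow> (complex^2) set" where
  "cimg c = cmap c ` cdom c"

definition cinv :: "'a chart \<Rightarrow> complex^2 \<Rightarrow> 'a" where
  "cinv c = inv_into (cdom c) (cmap c)"

definition transition :: "'a chart \<Rightarrow> 'a chart \<Rightarrow> complex^2 \<Rightarrow> complex^2" where
  "transition c c' = (\<lambda>z. cmap c' (cinv c z))"

text \<open>The manifold is the whole type \<open>'a\<close>, so it is nonempty, and the class \<open>t2_space\<close> makes it
  Hausdorff. Second countability follows from compactness and the charts. Connectedness is not
  required.\<close>

definition compact_complex_surface :: "'a::t2_space chart set \<Rightarrow> bool" where
  "compact_complex_surface A \<longleftrightarrow>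
     compact (UNIV :: 'a set) \<and>
     (\<Union>c\<in>A. cdom c) = UNIV \<and>
     (\<forall>c\<in>A. open (cdom c) \<and> open (cimg c) \<and> homeomorphism (cdom c) (cimg c) (cmap c) (cinv c)) \<and>
     (\<forall>c\<in>A. \<forall>c'\<in>A. holomorphic_map_on (cmap c ` (cdom c \<inter> cdom c')) (transition c c'))"

definition smooth_fun :: "'a chart set \<Rightarrow> ('a \<Rightarrow> real) \<Rightarrow> bool" where
  "smooth_fun A f \<longleftrightarrow> (\<forall>c\<in>A. smooth_on (cimg c) (\<lambda>z. f (cinv c z)))"

section \<open>Hermitian metrics\<close>

definition posdef_hermitian :: "complex^2^2 \<Rightarrow> bool" where
  "posdef_hermitian h \<longleftrightarrow>
     (\<forall>i j. h $ j $ i = cnj (h $ i $ j)) \<and>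
     (\<forall>v :: complex^2. v \<noteq> 0 \<longrightarrow> 0 < Re (\<Sum>i\<in>UNIV. \<Sum>j\<in>UNIV. h $ i $ j * v $ i * cnj (v $ j)))"

text \<open>A Hermitian metric is given by its coefficient matrix \<open>g c z $ i $ j\<close> (second index barred) in
  every chart \<open>c\<close>; the last condition is the transformation law of a tensor of type \<open>(1,1)\<close>.\<close>

definition hermitian_metric :: "'a chart set \<Rightarrow> ('a chart \<Rightarrow> complex^2 \<Rightarrow> complex^2^2) \<Rightarrow> bool" where
  "hermitian_metric A g \<longleftrightarrow>
     (\<forall>c\<in>A. smooth_on (cimg c) (g c) \<and> (\<forall>z\<in>cimg c. posdef_hermitian (g c z))) \<and>
     (\<forall>c\<in>A. \<forall>c'\<in>A. \<forall>z \<in> cmap c ` (cdom c \<inter> cdom c'). \<forall>i j.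
        g c z $ i $ j =
          (\<Sum>k\<in>UNIV. \<Sum>l\<in>UNIV. pd i (transition c c') z $ k * cnj (pd j (transition c c') z $ l)
                              * g c' (transition c c' z) $ k $ l))"

section \<open>Differential forms\<close>

text \<open>The complexified exterior algebra of the cotangent space of \<open>\<complex>\<^sup>2\<close>: the coefficient at
  \<open>K\<close> belongs to the wedge product, in increasing order, of the generators indexed by \<open>K\<close>.
  The generators \<open>0 < 1 < 2 < 3\<close> of the index type \<open>4\<close> are \<open>dz\<^sup>1, dz\<^sup>2\<close> and then their
  conjugates.\<close>

type_synonym ext = "complex ^ (4 set)"

definition dz :: "2 \<Rightarrow> ext" where
  "dz i = axis {if i = 1 then 0 else 1} 1"

definition dzbar :: "2 \<Rightarrow> ext" where
  "dzbar i = axis {if i = 1 then 2 else 3} 1"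

definition shuffle_sign :: "4 set \<Rightarrow> 4 set \<Rightarrow> complex" where
  "shuffle_sign I J = (-1) ^ card {(i, j). i \<in> I \<and> j \<in> J \<and> j < i}"

definition ext_wedge :: "ext \<Rightarrow> ext \<Rightarrow> ext" where
  "ext_wedge \<alpha> \<beta> = (\<chi> K. \<Sum>I\<in>Pow K. shuffle_sign I (K - I) * \<alpha> $ I * \<beta> $ (K - I))"

definition herm_form :: "complex^2^2 \<Rightarrow> ext" where
  "herm_form h = \<i> *s (\<Sum>i\<in>UNIV. \<Sum>j\<in>UNIV. h $ i $ j *s ext_wedge (dz i) (dzbar j))"

definition ext_positive :: "ext \<Rightarrow> bool" where
  "ext_positive \<alpha> \<longleftrightarrow> (\<exists>h. posdef_hermitian h \<and> \<alpha> = herm_form h)"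

text \<open>A differential form on the surface is represented by its expressions in all charts. Addition
  and subtraction of forms are pointwise, by the instances for function types.\<close>

type_synonym 'a form = "'a chart \<Rightarrow> complex^2 \<Rightarrow> ext"

definition form_wedge :: "'a form \<Rightarrow> 'a form \<Rightarrow> 'a form" (infixr \<open>\<and>\<^sub>F\<close> 72) where
  "\<eta> \<and>\<^sub>F \<theta> = (\<lambda>c z. ext_wedge (\<eta> c z) (\<theta> c z))"

definition form_scale :: "complex \<Rightarrow> 'a form \<Rightarrow> 'a form" (infixr \<open>*\<^sub>F\<close> 74) where
  "a *\<^sub>F \<eta> = (\<lambda>c z. a *s \<eta> c z)"

definition form_mult :: "('a \<Rightarrow> real) \<Rightarrow> 'a form \<Rightarrow> 'a form" (infixr \<open>\<cdot>\<^sub>F\<close> 74) where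
  "f \<cdot>\<^sub>F \<eta> = (\<lambda>c z. complex_of_real (f (cinv c z)) *s \<eta> c z)"

definition fun_form :: "('a \<Rightarrow> real) \<Rightarrow> 'a form" where
  "fun_form f = (\<lambda>c z. axis {} (complex_of_real (f (cinv c z))))"

definition del :: "'a form \<Rightarrow> 'a form" where
  "del \<eta> = (\<lambda>c z. \<Sum>i\<in>UNIV. ext_wedge (dz i) (pd i (\<eta> c) z))"

definition delbar :: "'a form \<Rightarrow> 'a form" where
  "delbar \<eta> = (\<lambda>c z. \<Sum>i\<in>UNIV. ext_wedge (dzbar i) (pdbar i (\<eta> c) z))"

section \<open>Integration of forms of top degree\<close>

text \<open>With \<open>z\<^sup>k = x\<^sup>k + \<i> y\<^sup>k\<close> and the orientation \<open>dx\<^sup>1 \<and> dy\<^sup>1 \<and> dx\<^sup>2 \<and> dy\<^sup>2\<close> of the complex structure, the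
  ordered product of the four generators is \<open>-(-2\<i>)\<^sup>2 = 4\<close> times \<open>dx\<^sup>1 \<and> dy\<^sup>1 \<and> dx\<^sup>2 \<and> dy\<^sup>2\<close>.\<close>

definition top_density :: "ext \<Rightarrow> complex" where
  "top_density \<alpha> = 4 * \<alpha> $ UNIV"

definition partition_of_unity :: "'a::t2_space chart set \<Rightarrow> 'a chart set \<Rightarrow> ('a chart \<Rightarrow> 'a \<Rightarrow> real) \<Rightarrow> bool" where
  "partition_of_unity A F \<rho> \<longleftrightarrow>
     finite F \<and> F \<subseteq> A \<and>
     (\<forall>c\<in>F. smooth_fun A (\<rho> c) \<and> (\<forall>x. 0 \<le> \<rho> c x) \<and> closure {x. \<rho> c x \<noteq> 0} \<subseteq> cdom c) \<and>
     (\<forall>x. (\<Sum>c\<in>F. \<rho> c x) = 1)"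

text \<open>For forms whose chart expressions are related by pullback along the transitions (as those
  built from a metric and functions are) the value does not depend on the chosen partition.\<close>

definition form_integral :: "'a::t2_space chart set \<Rightarrow> 'a form \<Rightarrow> complex" where
  "form_integral A \<eta> =
     (let (F, \<rho>) = (SOME (F, \<rho>). partition_of_unity A F \<rho>)
      in \<Sum>c\<in>F. LINT z : cimg c | lborel. complex_of_real (\<rho> c (cinv c z)) * top_density (\<eta> c z))"

section \<open>The potentials and the Mabuchi functional\<close>

definition omega :: "('a chart \<Rightarrow> complex^2 \<Rightarrow> complex^2^2) \<Rightarrow> 'a form" where
  "omega g = (\<lambda>c z. herm_form (g c z))"

definition omega_phi :: "('a chart \<Rightarrow> complex^2 \<Rightarrow> complex^2^2) \<Rightarrow> ('a \<Rightarrow> real) \<Rightarrow> 'a form" where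
  "omega_phi g \<phi> = omega g + \<i> *\<^sub>F del (delbar (fun_form \<phi>))"

definition potentials ::
  "'a chart set \<Rightarrow> ('a chart \<Rightarrow> complex^2 \<Rightarrow> complex^2^2) \<Rightarrow> ('a \<Rightarrow> real) set" where
  "potentials A g = {\<phi>. smooth_fun A \<phi> \<and> (\<forall>c\<in>A. \<forall>z\<in>cimg c. ext_positive (omega_phi g \<phi> c z))}"

definition Vol :: "'a::t2_space chart set \<Rightarrow> ('a chart \<Rightarrow> complex^2 \<Rightarrow> complex^2^2) \<Rightarrow> complex" where
  "Vol A g = form_integral A (omega g \<and>\<^sub>F omega g)"

definition Err ::
  "'a::t2_space chart set \<Rightarrow> ('a chart \<Rightarrow> complex^2 \<Rightarrow> complex^2^2) \<Rightarrow> ('a \<Rightarrow> real) \<Rightarrow> complex" where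
  "Err A g \<phi> = form_integral A (omega g \<and>\<^sub>F omega g)
                - form_integral A (omega_phi g \<phi> \<and>\<^sub>F omega_phi g \<phi>)"

definition smooth_path ::
  "'a chart set \<Rightarrow> ('a chart \<Rightarrow> complex^2 \<Rightarrow> complex^2^2) \<Rightarrow> ('a \<Rightarrow> real) \<Rightarrow> ('a \<Rightarrow> real)
    \<Rightarrow> (real \<Rightarrow> 'a \<Rightarrow> real) \<Rightarrow> bool" where
  "smooth_path A g \<phi>' \<phi>'' \<gamma> \<longleftrightarrow>
     (\<forall>c\<in>A. smooth_on ({0..1} \<times> cimg c) (\<lambda>(t, z). \<gamma> t (cinv c z))) \<and>
     (\<forall>t\<in>{0..1}. \<gamma> t \<in> potentials A g) \<and> \<gamma> 0 = \<phi>' \<and> \<gamma> 1 = \<phi>''"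

definition path_deriv :: "(real \<Rightarrow> 'a \<Rightarrow> real) \<Rightarrow> real \<Rightarrow> 'a \<Rightarrow> real" where
  "path_deriv \<gamma> t x = vector_derivative (\<lambda>s. \<gamma> s x) (at t within {0..1})"

definition Mabuchi_path ::
  "'a::t2_space chart set \<Rightarrow> ('a chart \<Rightarrow> complex^2 \<Rightarrow> complex^2^2) \<Rightarrow> (real \<Rightarrow> 'a \<Rightarrow> real) \<Rightarrow> complex" where
  "Mabuchi_path A g \<gamma> =
     1 / Vol A g * integral {0..1} (\<lambda>t. form_integral A
        (path_deriv \<gamma> t \<cdot>\<^sub>F (omega_phi g (\<gamma> t) \<and>\<^sub>F omega_phi g (\<gamma> t))))
   - 1 / Vol A g * integral {0..1} (\<lambda>t. form_integral A
        (\<i> *\<^sub>F (del (omega g) \<and>\<^sub>F (\<gamma> t \<cdot>\<^sub>F delbar (fun_form (path_deriv \<gamma> t))))))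
   + 1 / Vol A g * integral {0..1} (\<lambda>t. form_integral A
        (\<i> *\<^sub>F (delbar (omega g) \<and>\<^sub>F (\<gamma> t \<cdot>\<^sub>F del (fun_form (path_deriv \<gamma> t))))))"

text \<open>The common value of \<^const>\<open>Mabuchi_path\<close> on the smooth paths from \<open>\<phi>'\<close> to \<open>\<phi>''\<close>. It is complex
  because integrals of complex forms are; that it is real has to be proved.\<close>

definition Mabuchi ::
  "'a::t2_space chart set \<Rightarrow> ('a chart \<Rightarrow> complex^2 \<Rightarrow> complex^2^2) \<Rightarrow> ('a \<Rightarrow> real) \<Rightarrow> ('a \<Rightarrow> real) \<Rightarrow> complex" where
  "Mabuchi A g \<phi>' \<phi>'' = (THE v. \<exists>\<gamma>. smooth_path A g \<phi>' \<phi>'' \<gamma> \<and> v = Mabuchi_path A g \<gamma>)"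

definition one_cocycle :: "'s set \<Rightarrow> ('s \<Rightarrow> 's \<Rightarrow> 'b::ab_group_add) \<Rightarrow> bool" where
  "one_cocycle S N \<longleftrightarrow>
     S \<noteq> {} \<and>
     (\<forall>\<sigma>\<^sub>1\<in>S. \<forall>\<sigma>\<^sub>2\<in>S. \<forall>\<sigma>\<^sub>3\<in>S. N \<sigma>\<^sub>1 \<sigma>\<^sub>2 + N \<sigma>\<^sub>2 \<sigma>\<^sub>1 = 0 \<and> N \<sigma>\<^sub>1 \<sigma>\<^sub>2 + N \<sigma>\<^sub>2 \<sigma>\<^sub>3 + N \<sigma>\<^sub>3 \<sigma>\<^sub>1 = 0)"

end

theory Submission
  imports Defs
begin

text \<open>
  Write \<open>\<delta>\<close> for the conjugate of the operator \<open>\<partial>\<close>. The functional integrates, along a path of potentials, the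
  one-form that assigns to a tangent vector \<open>\<psi>\<close> at \<open>\<phi>\<close> the number
  \<open>\<alpha>\<^sub>\<phi>(\<psi>) = \<integral> \<psi> \<omega>\<^sub>\<phi>\<^sup>2 - \<integral> \<i>\<partial>\<omega> \<and> \<delta>\<psi> \<cdot> \<phi> + \<integral> \<i>\<delta>\<omega> \<and> \<partial>\<psi> \<cdot> \<phi>\<close>.
  Everything follows once \<open>\<alpha>\<close> is known to be exact, with the primitive that the asserted formula suggests,
  \<open>E(\<phi>) = 1/3 \<integral> \<phi> (\<omega>\<^sup>2 + \<omega> \<and> \<omega>\<^sub>\<phi> + \<omega>\<^sub>\<phi>\<^sup>2) + 1/2 \<integral> \<phi> (- \<i>\<partial>\<omega> \<and> \<delta>\<phi> + \<i>\<delta>\<omega> \<and> \<partial>\<phi>)\<close>.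
  Indeed, the functional then equals \<open>(E(\<phi>'') - E(\<phi>')) / V\<close> on every path (\<open>Mabuchi_path_eq\<close>), which makes it
  independent of the path and a cocycle; since \<open>E(0) = 0\<close>, the explicit formula is \<open>E(\<phi>) / V\<close>. The space of
  potentials is convex, so segments are admissible paths (\<open>straight_path\<close>). The formulas for translation by a
  constant come from the segment \<open>\<phi> + t C\<close>, on which only the first integral contributes
  (\<open>Mabuchi_path_constant\<close>). The values are real because the density of \<open>E\<close> is invariant under conjugation
  (\<open>energy_density_real\<close>), and \<open>V\<close> is nonzero because \<open>\<omega>\<^sup>2\<close> is positive (\<open>Vol_nonzero\<close>).

  That \<open>E\<close> is a primitive is a pointwise computation followed by Stokes' theorem. Put \<open>\<Omega> = \<omega> + 2 \<omega>\<^sub>\<phi>\<close> and let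
  \<open>T(a, b) = \<i>\<partial>(a \<Omega> \<and> \<delta>b) - \<i>\<delta>(a \<Omega> \<and> \<partial>b)\<close>, an exact form. Since \<open>\<partial>\<Omega> = 3 \<partial>\<omega>\<close>, the Leibniz rule gives
  \<open>T(a, b) = 3\<i> a \<partial>\<omega> \<and> \<delta>b - 3\<i> a \<delta>\<omega> \<and> \<partial>b + 2 a \<Omega> \<and> \<i>\<partial>\<delta>b\<close> plus a term that is symmetric in \<open>a\<close> and \<open>b\<close>
  (\<open>divergence_flux\<close>). Comparing coefficients, the integrand of \<open>dE\<^sub>\<phi>(\<psi>) - \<alpha>\<^sub>\<phi>(\<psi>)\<close> is
  \<open>(T(\<phi>, \<psi>) - T(\<psi>, \<phi>)) / 6\<close> (\<open>energy_variation_eq\<close>), hence its integral vanishes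
  (\<open>total_energy_has_derivative\<close>).

  Stokes' theorem is proved directly from the definition of the integral by a partition of unity (\<open>stokes\<close>).
  After an integration by parts in each chart, only the contraction of the vector density with the
  differentials of the partition functions has to be compared between charts. It is expressed by the
  polarised determinant of \<open>\<Omega>\<close> and a product of gradients, which transforms by the squared modulus of the
  complex Jacobian determinant (\<open>gradient_pairing_transition\<close>), the factor of the change of variables formula
  (\<open>integral_holomorphic_change_of_variables\<close>). The existence of a smooth partition of unity
  (\<open>partition_of_unity_exists\<close>) is needed because the integral is defined through a chosen one.

  Forms are handled through their coefficients in a chart: the exterior algebra is evaluated once on its
  generators, and then \<open>\<omega>\<^sub>\<phi>\<close> is the matrix of the metric plus the complex Hessian of \<open>\<phi>\<close>, products of two forms of
  type \<open>(1,1)\<close> are polarised determinants, and \<open>\<partial>\<omega> \<and> \<delta>b\<close> is a pairing with the torsion of the metric.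
\<close>

section \<open>Calculus of continuously differentiable maps\<close>

lemma Ck_on_cong:
  assumes "open S" "\<And>x. x \<in> S \<Longrightarrow> f x = g x" "Ck_on k S f"
  shows "Ck_on k S g"
  using assms(2,3)
proof (induction k arbitrary: f g)
  case 0
  then show ?case by (simp cong: continuous_on_cong)
next
  case (Suc k)
  have D: "(g has_derivative frechet_derivative f (at x)) (at x)" if "x \<in> S" for x
    using Suc.prems that assms(1)
    by (metis Ck_on.simps(2) frechet_derivative_works has_derivative_transform_within_open)
  have e: "frechet_derivative f (at x) = frechet_derivative g (at x)" if "x \<in> S" for x
    using D[OF that] by (simp add: frechet_derivative_at)
  show ?case
  proof (simp, intro conjI ballI allI)
    show "g differentiable at x" if "x \<in> S" for x
      using D[OF that] by (auto simp: differentiable_def)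
    show "Ck_on k S (\<lambda>x. frechet_derivative g (at x) v)" for v
      by (rule Suc.IH[of "\<lambda>x. frechet_derivative f (at x) v"]) (use Suc.prems e in auto)
  qed
qed

lemma frechet_derivative_eqI: "(f has_derivative D) (at z) \<Longrightarrow> frechet_derivative f (at z) v = D v"
  by (simp add: frechet_derivative_at[symmetric])

lemma Ck_on_has_derivative:
  "Ck_on (Suc k) S f \<Longrightarrow> x \<in> S \<Longrightarrow> (f has_derivative frechet_derivative f (at x)) (at x)"
  by (simp flip: frechet_derivative_works)

text \<open>Every closure property below is proved by induction on \<open>k\<close>: the chain or product rule exhibits the
  derivative in a direction \<open>v\<close> as an expression to which the induction hypothesis applies. This rule
  transfers that expression to \<^const>\<open>frechet_derivative\<close>.\<close>

lemma Ck_on_SucI: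
  assumes "open S" "\<And>x. x \<in> S \<Longrightarrow> (f has_derivative f' x) (at x)" "\<And>v. Ck_on k S (\<lambda>x. f' x v)"
  shows "Ck_on (Suc k) S f"
proof (simp, intro conjI ballI allI)
  show "f differentiable at x" if "x \<in> S" for x
    using assms(2)[OF that] by (auto simp: differentiable_def)
  show "Ck_on k S (\<lambda>x. frechet_derivative f (at x) v)" for v
    by (rule Ck_on_cong[OF assms(1) _ assms(3)[of v]]) (simp add: frechet_derivative_eqI[OF assms(2)])
qed

lemma Ck_on_subset: "Ck_on k S f \<Longrightarrow> T \<subseteq> S \<Longrightarrow> Ck_on k T f"
  by (induction k arbitrary: f) (auto intro: continuous_on_subset)

lemma Ck_on_SucD: "Ck_on (Suc k) S f \<Longrightarrow> Ck_on k S f"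
proof (induction k arbitrary: f)
  case 0
  then show ?case
    by (auto intro!: continuous_at_imp_continuous_on dest: differentiable_imp_continuous_within)
qed auto

lemma Ck_on_local:
  assumes "\<And>x. x \<in> S \<Longrightarrow> \<exists>W. open W \<and> x \<in> W \<and> Ck_on k W f"
  shows "Ck_on k S f"
  using assms
proof (induction k arbitrary: f)
  case 0
  have "continuous (at x) f" if "x \<in> S" for x
    using 0[OF that] by (auto simp: continuous_on_eq_continuous_at)
  then show ?case by (simp add: continuous_at_imp_continuous_on)
next
  case (Suc k)
  show ?case
  proof (simp, intro conjI ballI allI)
    show "f differentiable at x" if "x \<in> S" for x
      using Suc.prems[OF that] by auto
    show "Ck_on k S (\<lambda>x. frechet_derivative f (at x) v)" for v
      using Suc.prems by (intro Suc.IH) (metis Ck_on.simps(2))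
  qed
qed

lemma Ck_on_const [simp]: "Ck_on k S (\<lambda>x. c)"
  by (induction k arbitrary: c) auto

lemma Ck_on_compose_linear:
  assumes "bounded_linear L" "Ck_on k S f" "open S"
  shows "Ck_on k S (\<lambda>x. L (f x))"
  using assms(2)
proof (induction k arbitrary: f)
  case 0
  then show ?case
    by (simp add: bounded_linear.continuous_on[OF assms(1)])
next
  case (Suc k)
  show ?case
    by (rule Ck_on_SucI[OF assms(3) bounded_linear.has_derivative[OF assms(1) Ck_on_has_derivative[OF Suc.prems]]])
      (use Suc in auto)
qed

lemma Ck_on_id: "Ck_on k S (\<lambda>x. x)"
  by (cases k) (auto simp: frechet_derivative_ident)

lemma Ck_on_linear: "bounded_linear L \<Longrightarrow> Ck_on k S L"
  using Ck_on_compose_linear[of L k UNIV "\<lambda>x. x"] Ck_on_id Ck_on_subset by blast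

lemma Ck_on_add:
  assumes "open S" "Ck_on k S f" "Ck_on k S g"
  shows "Ck_on k S (\<lambda>x. f x + g x)"
  using assms(2,3)
proof (induction k arbitrary: f g)
  case 0
  then show ?case by (auto intro: continuous_intros)
next
  case (Suc k)
  show ?case
    by (rule Ck_on_SucI[OF assms(1) has_derivative_add[OF Ck_on_has_derivative[OF Suc.prems(1)]
            Ck_on_has_derivative[OF Suc.prems(2)]]]) (use Suc in auto)
qed

lemma Ck_on_sum:
  assumes "open S" "\<And>i. i \<in> I \<Longrightarrow> Ck_on k S (f i)"
  shows "Ck_on k S (\<lambda>x. \<Sum>i\<in>I. f i x)"
  using assms(2)
  by (induction I rule: infinite_finite_induct) (auto intro!: Ck_on_add assms(1))

lemma Ck_on_bilinear:
  assumes "bounded_bilinear B" "open S" "Ck_on k S f" "Ck_on k S g"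
  shows "Ck_on k S (\<lambda>x. B (f x) (g x))"
  using assms(3,4)
proof (induction k arbitrary: f g)
  case 0
  then show ?case by (auto intro: bounded_bilinear.continuous_on[OF assms(1)])
next
  case (Suc k)
  show ?case
  proof (rule Ck_on_SucI[OF assms(2) bounded_bilinear.FDERIV[OF assms(1) Ck_on_has_derivative[OF Suc.prems(1)]
          Ck_on_has_derivative[OF Suc.prems(2)]]])
    show "Ck_on k S (\<lambda>x. B (f x) (frechet_derivative g (at x) v) + B (frechet_derivative f (at x) v) (g x))" for v
      by (rule Ck_on_add[OF assms(2) Suc.IH Suc.IH]) (use Suc.prems Ck_on_SucD in auto)
  qed
qed

text \<open>The domain of the outer map is Euclidean because its derivative in the varying direction
  \<open>g'(x) v\<close> has to be expanded in a fixed basis before the induction hypothesis can be used.\<close>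

lemma Ck_on_compose:
  fixes f :: "'b::euclidean_space \<Rightarrow> 'c::real_normed_vector" and g :: "'a::real_normed_vector \<Rightarrow> 'b"
  assumes "open S" "open T" "g ` S \<subseteq> T" "Ck_on k S g" "Ck_on k T f"
  shows "Ck_on k S (\<lambda>x. f (g x))"
  using assms(4,5)
proof (induction k arbitrary: f)
  case 0
  then show ?case
    using assms(3) continuous_on_compose2[of T f S g] by simp
next
  case (Suc k)
  let ?f = "\<lambda>x. frechet_derivative f (at (g x))" and ?g = "\<lambda>x. frechet_derivative g (at x)"
  have "((\<lambda>x. f (g x)) has_derivative (\<lambda>v. \<Sum>b\<in>Basis. (?g x v \<bullet> b) *\<^sub>R ?f x b)) (at x)" if "x \<in> S" for x
  proof -
    have gT: "g x \<in> T" using that assms(3) by auto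
    have "linear (?f x)" by (rule has_derivative_linear[OF Ck_on_has_derivative[OF Suc.prems(2) gT]])
    then have "?f x w = (\<Sum>b\<in>Basis. (w \<bullet> b) *\<^sub>R ?f x b)" for w
      by (subst euclidean_representation[of w, symmetric])
         (simp add: linear_sum linear_scale del: euclidean_representation)
    then have "(\<lambda>v. ?f x (?g x v)) = (\<lambda>v. \<Sum>b\<in>Basis. (?g x v \<bullet> b) *\<^sub>R ?f x b)" by (rule ext)
    moreover have "((\<lambda>x. f (g x)) has_derivative (\<lambda>v. ?f x (?g x v))) (at x)"
      by (rule has_derivative_compose[of g _ _ _ f, OF Ck_on_has_derivative[OF Suc.prems(1) that]
            Ck_on_has_derivative[OF Suc.prems(2) gT]])
    ultimately show ?thesis by simp
  qed
  then show ?case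
  proof (rule Ck_on_SucI[OF assms(1)])
    show "Ck_on k S (\<lambda>x. \<Sum>b\<in>Basis. (?g x v \<bullet> b) *\<^sub>R ?f x b)" for v
    proof (intro Ck_on_sum Ck_on_bilinear[OF bounded_bilinear_scaleR] assms(1))
      show "Ck_on k S (\<lambda>x. ?g x v \<bullet> b)" for b
        using Suc.prems by (intro Ck_on_compose_linear[OF bounded_linear_inner_left _ assms(1)]) auto
      show "Ck_on k S (\<lambda>x. ?f x b)" for b
        using Suc.prems Ck_on_SucD by (intro Suc.IH) auto
    qed
  qed
qed

lemma Ck_on_inverse:
  fixes f :: "'a::real_normed_vector \<Rightarrow> real"
  assumes "open S" "Ck_on k S f" "\<And>x. x \<in> S \<Longrightarrow> f x \<noteq> 0"
  shows "Ck_on k S (\<lambda>x. inverse (f x))"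
  using assms(2)
proof (induction k)
  case 0
  then show ?case using assms(3) by (auto intro: continuous_intros)
next
  case (Suc k)
  have D: "((\<lambda>x. inverse (f x)) has_derivative
      (\<lambda>v. (-1) * ((inverse (f x) * frechet_derivative f (at x) v) * inverse (f x)))) (at x)" if "x \<in> S" for x
    using Deriv.has_derivative_inverse[OF assms(3)[OF that] Ck_on_has_derivative[OF Suc.prems that]] by simp
  show ?case
    by (rule Ck_on_SucI[OF assms(1) D], assumption,
        intro Ck_on_bilinear[OF bounded_bilinear_mult assms(1)] Ck_on_const Suc.IH Ck_on_SucD[OF Suc.prems])
       (use Suc.prems in auto)
qed

section \<open>A smooth function that is flat at the origin\<close>

text \<open>The derivatives of \<open>exp (-1/t)\<close> are combinations of the functions \<open>exp (-1/t) / t\<^sup>n\<close>. Following this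
  whole family, all of whose members vanish for \<open>t \<le> 0\<close>, replaces a formula for the higher derivatives.\<close>

definition flat_exp :: "nat \<Rightarrow> real \<Rightarrow> real" where
  "flat_exp n t = (if t \<le> 0 then 0 else exp (- inverse t) * inverse t ^ n)"

text \<open>An exponential beats a power at infinity; substitute \<open>1/t\<close>.\<close>

lemma flat_exp_tendsto_0: "((\<lambda>t. flat_exp n t) \<longlongrightarrow> 0) (at_right 0)"
proof -
  have "((\<lambda>x::real. x ^ n / exp x) \<longlongrightarrow> 0) at_top"
    by (rule tendsto_power_div_exp_0)
  then have "((\<lambda>t::real. inverse t ^ n / exp (inverse t)) \<longlongrightarrow> 0) (at_right 0)"
    using filterlim_compose filterlim_inverse_at_top_right by blast
  moreover have "eventually (\<lambda>t. inverse t ^ n / exp (inverse t) = flat_exp n t) (at_right 0)"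
    by (auto simp: flat_exp_def eventually_at_filter exp_minus field_simps)
  ultimately show ?thesis
    by (rule Lim_transform_eventually)
qed

lemma flat_exp_derivative:
  "(flat_exp n has_real_derivative (flat_exp (n + 2) t - n * flat_exp (n + 1) t)) (at t)"
proof (cases t "0::real" rule: linorder_cases)
  case less
  have "((\<lambda>_. 0) has_real_derivative 0) (at t)" by simp
  then have "(flat_exp n has_real_derivative 0) (at t)"
    by (rule has_field_derivative_transform_within_open[of _ _ _ "{..<0}"]) (use less in \<open>auto simp: flat_exp_def\<close>)
  then show ?thesis using less by (simp add: flat_exp_def)
next
  case greater
  have "((\<lambda>t. exp (- inverse t) * inverse t ^ n) has_real_derivative
      (flat_exp (n + 2) t - n * flat_exp (n + 1) t)) (at t)"
    using greater
    by (cases n, auto intro!: derivative_eq_intros simp: flat_exp_def power2_eq_square)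
       (auto simp: field_simps power2_eq_square gr0_conv_Suc power_eq_if)
  then show ?thesis
    by (rule has_field_derivative_transform_within_open[of _ _ _ "{0<..}"]) (use greater in \<open>auto simp: flat_exp_def\<close>)
next
  case equal
  have "((\<lambda>h. (flat_exp n (0 + h) - flat_exp n 0) / h) \<longlongrightarrow> 0) (at 0)"
  proof (rule filterlim_split_at)
    show "((\<lambda>h. (flat_exp n (0 + h) - flat_exp n 0) / h) \<longlongrightarrow> 0) (at_left 0)"
      by (rule Lim_transform_eventually[OF tendsto_const]) (auto simp: flat_exp_def eventually_at_filter)
    show "((\<lambda>h. (flat_exp n (0 + h) - flat_exp n 0) / h) \<longlongrightarrow> 0) (at_right 0)"
      by (rule Lim_transform_eventually[OF flat_exp_tendsto_0[of "Suc n"]])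
         (auto simp: flat_exp_def eventually_at_filter field_simps)
  qed
  then show ?thesis using equal by (simp add: DERIV_def flat_exp_def)
qed

lemma Ck_on_flat_exp: "Ck_on k UNIV (flat_exp n)"
proof (induction k arbitrary: n)
  case 0
  then show ?case
    using flat_exp_derivative DERIV_isCont continuous_at_imp_continuous_on by (metis Ck_on.simps(1))
next
  case (Suc k)
  have D: "(flat_exp n has_derivative (\<lambda>v. (flat_exp (n + 2) t + (- real n) * flat_exp (n + 1) t) * v)) (at t)" for t
    using flat_exp_derivative[of n t] by (simp add: has_field_derivative_def)
  show ?case
    by (rule Ck_on_SucI[OF open_UNIV D])
       (intro Ck_on_bilinear[OF bounded_bilinear_mult] Ck_on_add Suc Ck_on_const open_UNIV)
qed

section \<open>Symmetry of second derivatives\<close>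

text \<open>The second difference of \<open>f\<close> in the directions \<open>v\<close> and \<open>w\<close> is \<open>h\<^sup>2\<close> times one value of the iterated
  derivative near \<open>x\<close>: apply the mean value theorem first along \<open>v\<close>, then along \<open>w\<close>.\<close>

lemma real_mixed_mean_value:
  fixes f :: "'a::real_normed_vector \<Rightarrow> real"
  assumes "ball x r \<subseteq> S" "open S" "Ck_on 2 S f" "0 < h" "h * (norm v + norm w) < r"
  shows "\<exists>y \<in> cball x (h * (norm v + norm w)). f (x + h *\<^sub>R v + h *\<^sub>R w) - f (x + h *\<^sub>R v) - f (x + h *\<^sub>R w) + f x
     = h * h * frechet_derivative (\<lambda>z. frechet_derivative f (at z) v) (at y) w"
proof -
  have C2: "\<And>z. z \<in> S \<Longrightarrow> f differentiable at z"
    "\<And>z v. z \<in> S \<Longrightarrow> (\<lambda>z. frechet_derivative f (at z) v) differentiable at z"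
    using assms(3) by (auto simp: numeral_2_eq_2)
  have nb: "norm (s *\<^sub>R v + t *\<^sub>R w) \<le> h * (norm v + norm w)" if "0 \<le> s" "s \<le> h" "0 \<le> t" "t \<le> h" for s t
  proof -
    have "norm (s *\<^sub>R v + t *\<^sub>R w) \<le> s * norm v + t * norm w"
      using norm_triangle_ineq[of "s *\<^sub>R v" "t *\<^sub>R w"] that by simp
    also have "\<dots> \<le> h * norm v + h * norm w"
      using that by (intro add_mono mult_right_mono) auto
    finally show ?thesis by (simp add: algebra_simps)
  qed
  have inS: "x + s *\<^sub>R v + t *\<^sub>R w \<in> S" if "0 \<le> s" "s \<le> h" "0 \<le> t" "t \<le> h" for s t
    using nb[OF that] assms(1,5)
    by (auto simp: dist_norm add.assoc subset_iff norm_minus_commute)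
  define F where "F = (\<lambda>s. f (x + s *\<^sub>R v + h *\<^sub>R w) - f (x + s *\<^sub>R v))"
  have dir: "((\<lambda>s. g (p + s *\<^sub>R u)) has_real_derivative frechet_derivative g (at (p + s *\<^sub>R u)) u) (at s)"
    if "g differentiable at (p + s *\<^sub>R u)" for g :: "'a \<Rightarrow> real" and p u s
  proof -
    have "((\<lambda>s. g (p + s *\<^sub>R u)) has_derivative (\<lambda>k. frechet_derivative g (at (p + s *\<^sub>R u)) (k *\<^sub>R u))) (at s)"
      by (rule has_derivative_compose[of "\<lambda>s. p + s *\<^sub>R u" "\<lambda>k. k *\<^sub>R u" _ _ g])
         (use that in \<open>auto intro!: derivative_eq_intros simp: frechet_derivative_works\<close>)
    moreover have "frechet_derivative g (at (p + s *\<^sub>R u)) (k *\<^sub>R u) = frechet_derivative g (at (p + s *\<^sub>R u)) u * k" for k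
      using linear_scale[OF linear_frechet_derivative[OF that]] by simp
    ultimately show ?thesis
      by (simp add: has_field_derivative_def)
  qed
  have "\<exists>s. 0 < s \<and> s < h \<and> F h - F 0 = (h - 0) *
      (frechet_derivative f (at (x + s *\<^sub>R v + h *\<^sub>R w)) v - frechet_derivative f (at (x + s *\<^sub>R v)) v)"
  proof (rule MVT2[OF assms(4)])
    fix s assume s: "0 \<le> s" "s \<le> h"
    have "((\<lambda>s. f ((x + h *\<^sub>R w) + s *\<^sub>R v)) has_real_derivative
        frechet_derivative f (at ((x + h *\<^sub>R w) + s *\<^sub>R v)) v) (at s)"
      using s inS[of s h] assms(4) by (intro dir C2) (auto simp: algebra_simps)
    moreover have "((\<lambda>s. f (x + s *\<^sub>R v)) has_real_derivative frechet_derivative f (at (x + s *\<^sub>R v)) v) (at s)"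
      using s inS[of s 0] assms(4) by (intro dir C2) (auto simp: algebra_simps)
    ultimately show "(F has_real_derivative
        frechet_derivative f (at (x + s *\<^sub>R v + h *\<^sub>R w)) v - frechet_derivative f (at (x + s *\<^sub>R v)) v) (at s)"
      unfolding F_def by (auto intro!: derivative_eq_intros simp: algebra_simps)
  qed
  then obtain s where s: "0 < s" "s < h" "F h - F 0 = h *
      (frechet_derivative f (at (x + s *\<^sub>R v + h *\<^sub>R w)) v - frechet_derivative f (at (x + s *\<^sub>R v)) v)"
    by auto
  have "\<exists>t. 0 < t \<and> t < h \<and> frechet_derivative f (at ((x + s *\<^sub>R v) + h *\<^sub>R w)) v
       - frechet_derivative f (at ((x + s *\<^sub>R v) + 0 *\<^sub>R w)) v
     = (h - 0) * frechet_derivative (\<lambda>z. frechet_derivative f (at z) v) (at ((x + s *\<^sub>R v) + t *\<^sub>R w)) w"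
    by (rule MVT2[OF assms(4)]) (use s inS in \<open>auto intro!: dir[of "\<lambda>z. frechet_derivative f (at z) v"] C2\<close>)
  then obtain t where t: "0 < t" "t < h" "frechet_derivative f (at ((x + s *\<^sub>R v) + h *\<^sub>R w)) v
       - frechet_derivative f (at (x + s *\<^sub>R v)) v
     = h * frechet_derivative (\<lambda>z. frechet_derivative f (at z) v) (at ((x + s *\<^sub>R v) + t *\<^sub>R w)) w"
    by auto
  show ?thesis
  proof (rule bexI[of _ "x + s *\<^sub>R v + t *\<^sub>R w"])
    show "x + s *\<^sub>R v + t *\<^sub>R w \<in> cball x (h * (norm v + norm w))"
      using nb[of s t] s t dist_add_cancel[of x 0 "s *\<^sub>R v + t *\<^sub>R w"] by (simp add: add.assoc)
  qed (use s t in \<open>simp add: F_def algebra_simps\<close>)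
qed

text \<open>The second difference does not change when \<open>v\<close> and \<open>w\<close> are exchanged. Dividing by \<open>h\<^sup>2\<close> and letting
  \<open>h\<close> tend to zero identifies both iterated derivatives, because they are continuous.\<close>

lemma second_derivative_symmetric_real:
  fixes f :: "'a::real_normed_vector \<Rightarrow> real"
  assumes "open S" "Ck_on 2 S f" "x \<in> S"
  shows "frechet_derivative (\<lambda>z. frechet_derivative f (at z) v) (at x) w =
         frechet_derivative (\<lambda>z. frechet_derivative f (at z) w) (at x) v"
proof -
  obtain r where r: "r > 0" "ball x r \<subseteq> S"
    using assms openE by blast
  define N where "N = norm v + norm w"
  have N: "N \<ge> 0" by (simp add: N_def)
  \<comment> \<open>Step sizes that tend to zero and keep all four corners of the parallelogram in the ball of radius \<open>r\<close>.\<close>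
  define h where "h = (\<lambda>n::nat. r / (N + 1) / (Suc n + 1))"
  have h0: "h n > 0" for n using r N by (simp add: h_def)
  have hN: "h n * N < r" for n
  proof -
    have "h n * N = r * (N / (N + 1)) / (Suc n + 1)" by (simp add: h_def)
    also have "\<dots> < r" 
    proof -
      have "r * (N / (N + 1)) \<le> r * 1" using r N by (intro mult_left_mono) auto
      then have "r * (N / (N + 1)) / (Suc n + 1) \<le> r * 1 / (Suc n + 1)"
        by (intro divide_right_mono) simp_all
      then have "r * (N / (N + 1)) / (Suc n + 1) \<le> r / (Suc n + 1)" by (simp only: mult_1_right)
      also have "\<dots> < r" using r by (simp add: field_simps add_pos_nonneg)
      finally show ?thesis .
    qed
    finally show ?thesis .
  qed
  have hlim: "h \<longlonglongrightarrow> 0"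
  proof -
    have "(\<lambda>n. r / (N + 1) * (1 / real (Suc (Suc n)))) \<longlonglongrightarrow> r / (N + 1) * 0"
      by (intro tendsto_mult tendsto_const LIMSEQ_Suc[OF LIMSEQ_Suc[OF lim_1_over_n]])
    then show ?thesis by (simp add: h_def add_ac)
  qed
  let ?D = "\<lambda>a b y. frechet_derivative (\<lambda>z. frechet_derivative f (at z) a) (at y) b"
  have "\<forall>n. \<exists>y \<in> cball x (h n * N). f (x + h n *\<^sub>R v + h n *\<^sub>R w) - f (x + h n *\<^sub>R v) - f (x + h n *\<^sub>R w) + f x
     = h n * h n * ?D v w y"
    using real_mixed_mean_value[OF r(2) assms(1,2) h0] hN unfolding N_def by blast
  then obtain y where y: "\<And>n. y n \<in> cball x (h n * N)"
    "\<And>n. f (x + h n *\<^sub>R v + h n *\<^sub>R w) - f (x + h n *\<^sub>R v) - f (x + h n *\<^sub>R w) + f x = h n * h n * ?D v w (y n)"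
    by metis
  have "\<forall>n. \<exists>y \<in> cball x (h n * N). f (x + h n *\<^sub>R w + h n *\<^sub>R v) - f (x + h n *\<^sub>R w) - f (x + h n *\<^sub>R v) + f x
     = h n * h n * ?D w v y"
    using real_mixed_mean_value[OF r(2) assms(1,2) h0, of _ w v] hN unfolding N_def by (metis add.commute)
  then obtain y' where y': "\<And>n. y' n \<in> cball x (h n * N)"
    "\<And>n. f (x + h n *\<^sub>R w + h n *\<^sub>R v) - f (x + h n *\<^sub>R w) - f (x + h n *\<^sub>R v) + f x = h n * h n * ?D w v (y' n)"
    by metis
  have eq: "?D v w (y n) = ?D w v (y' n)" for n
  proof -
    have "h n * h n * ?D v w (y n) = h n * h n * ?D w v (y' n)"
    proof -
      have "x + h n *\<^sub>R v + h n *\<^sub>R w = x + h n *\<^sub>R w + h n *\<^sub>R v" by (simp add: add_ac)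
      then have "f (x + h n *\<^sub>R v + h n *\<^sub>R w) = f (x + h n *\<^sub>R w + h n *\<^sub>R v)" by (rule arg_cong)
      then show ?thesis using y(2)[of n] y'(2)[of n] by linarith
    qed
    then show ?thesis using h0[of n] by simp
  qed
  have lim: "y \<longlonglongrightarrow> x" if "\<And>n. y n \<in> cball x (h n * N)" for y
  proof -
    have "(\<lambda>n. dist (y n) x) \<longlonglongrightarrow> 0"
    proof (rule tendsto_sandwich[of "\<lambda>n. 0" _ sequentially "\<lambda>n. h n * N"])
      show "(\<lambda>n. h n * N) \<longlonglongrightarrow> 0" using tendsto_mult_right[OF hlim, of N] by simp
      show "(\<lambda>n. 0::real) \<longlonglongrightarrow> 0" by simp
    qed (use that in \<open>auto simp: dist_commute\<close>)
    then show ?thesis by (rule tendsto_dist_iff[THEN iffD2])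
  qed
  have cont: "isCont (?D a b) x" for a b
  proof -
    have "continuous_on S (?D a b)" using assms(2) by (simp add: numeral_2_eq_2)
    then show ?thesis using assms(1,3) continuous_on_eq_continuous_at by blast
  qed
  have "(\<lambda>n. ?D v w (y n)) \<longlonglongrightarrow> ?D v w x"
    using isCont_tendsto_compose[OF cont lim[OF y(1)]] .
  moreover have "(\<lambda>n. ?D w v (y' n)) \<longlonglongrightarrow> ?D w v x"
    using isCont_tendsto_compose[OF cont lim[OF y'(1)]] .
  ultimately show ?thesis
    using eq LIMSEQ_unique by auto
qed

section \<open>Smooth maps\<close>

lemma smooth_on_open_iff:
  assumes "open S"
  shows "smooth_on S f \<longleftrightarrow> (\<forall>k. Ck_on k S f)"
proof
  assume L: "smooth_on S f"
  show "\<forall>k. Ck_on k S f"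
  proof (intro allI Ck_on_local)
    fix k x assume "x \<in> S"
    then obtain W h where W: "open W" "x \<in> W" "\<And>k. Ck_on k W h" "\<And>y. y \<in> W \<inter> S \<Longrightarrow> h y = f y"
      using L unfolding smooth_on_def by metis
    have "Ck_on k (W \<inter> S) f"
      by (rule Ck_on_cong[OF open_Int[OF W(1) assms] W(4) Ck_on_subset[OF W(3)]]) auto
    then show "\<exists>W. open W \<and> x \<in> W \<and> Ck_on k W f"
      using W \<open>x \<in> S\<close> assms by blast
  qed
qed (use assms in \<open>auto simp: smooth_on_def\<close>)

lemma smooth_onD: "open S \<Longrightarrow> smooth_on S f \<Longrightarrow> Ck_on k S f"
  by (simp add: smooth_on_open_iff)

lemma smooth_on_subset: "smooth_on S f \<Longrightarrow> T \<subseteq> S \<Longrightarrow> smooth_on T f"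
  unfolding smooth_on_def by (intro ballI) (drule bspec, erule (1) subsetD, elim exE conjE, intro exI conjI, assumption+, auto)

lemma smooth_on_cong: "smooth_on S f \<Longrightarrow> (\<And>x. x \<in> S \<Longrightarrow> f x = g x) \<Longrightarrow> smooth_on S g"
  unfolding smooth_on_def by (intro ballI) (drule (1) bspec, elim exE conjE, intro exI conjI, assumption+, auto)

text \<open>Used to glue: a function that is smooth on one open set and zero on another is smooth on their union.\<close>

lemma smooth_on_local:
  assumes "\<And>x. x \<in> S \<Longrightarrow> \<exists>W. open W \<and> x \<in> W \<and> smooth_on (W \<inter> S) f"
  shows "smooth_on S f"
  unfolding smooth_on_def
proof
  fix x assume x: "x \<in> S"
  from assms[OF this] obtain W where W: "open W" "x \<in> W" "smooth_on (W \<inter> S) f" by blast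
  then obtain V h where "open V" "x \<in> V" "\<forall>k. Ck_on k V h" "\<forall>y \<in> V \<inter> (W \<inter> S). h y = f y"
    using x unfolding smooth_on_def by (metis IntI)
  then show "\<exists>W h. open W \<and> x \<in> W \<and> (\<forall>k. Ck_on k W h) \<and> (\<forall>y\<in>W \<inter> S. h y = f y)"
    using W by (intro exI[of _ "V \<inter> W"] exI[of _ h]) (auto intro: Ck_on_subset)
qed

lemma smooth_on_const [intro, simp]: "smooth_on S (\<lambda>x. c)"
  using smooth_on_subset[of UNIV "\<lambda>x. c" S] smooth_on_open_iff[of UNIV "\<lambda>x. c"] by auto

lemma smooth_on_linear: "bounded_linear L \<Longrightarrow> smooth_on S L"
  using smooth_on_subset[of UNIV L S] smooth_on_open_iff[of UNIV L] Ck_on_linear by blast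

lemma smooth_on_compose_linear:
  assumes L: "bounded_linear L" and f: "smooth_on S f"
  shows "smooth_on S (\<lambda>x. L (f x))"
  unfolding smooth_on_def
proof
  fix x assume "x \<in> S"
  then obtain W h where "open W" "x \<in> W" "\<forall>k. Ck_on k W h" "\<forall>y\<in>W \<inter> S. h y = f y"
    using f unfolding smooth_on_def by blast
  then show "\<exists>W h. open W \<and> x \<in> W \<and> (\<forall>k. Ck_on k W h) \<and> (\<forall>y\<in>W \<inter> S. h y = L (f y))"
    using L by (intro exI[of _ W] exI[of _ "\<lambda>x. L (h x)"]) (auto intro: Ck_on_compose_linear)
qed

text \<open>The common part of all pointwise operations with two arguments: intersect the neighbourhoods on which the
  two smooth extensions live.\<close>

lemma smooth_on_combine:
  assumes B: "\<And>k (W :: 'a::real_normed_vector set) f g. open W \<Longrightarrow> Ck_on k W f \<Longrightarrow> Ck_on k W g \<Longrightarrow> Ck_on k W (\<lambda>x. B (f x) (g x))"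
    and f: "smooth_on (S :: 'a set) f" and g: "smooth_on S g"
  shows "smooth_on S (\<lambda>x. B (f x) (g x))"
  unfolding smooth_on_def
proof
  fix x assume x: "x \<in> S"
  then obtain W h where W: "open W" "x \<in> W" "\<forall>k. Ck_on k W h" "\<forall>y\<in>W \<inter> S. h y = f y"
    using f unfolding smooth_on_def by blast
  from x obtain V k where V: "open V" "x \<in> V" "\<forall>n. Ck_on n V k" "\<forall>y\<in>V \<inter> S. k y = g y"
    using g unfolding smooth_on_def by blast
  have "Ck_on n (V \<inter> W) (\<lambda>x. B (h x) (k x))" for n
    using W V Ck_on_subset[of n W h "V \<inter> W"] Ck_on_subset[of n V k "V \<inter> W"] by (intro B) auto
  then show "\<exists>W h. open W \<and> x \<in> W \<and> (\<forall>k. Ck_on k W h) \<and> (\<forall>y\<in>W \<inter> S. h y = B (f y) (g y))"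
    using W V by (intro exI[of _ "V \<inter> W"] exI[of _ "\<lambda>x. B (h x) (k x)"]) auto
qed

lemma smooth_on_add [intro]: "smooth_on S f \<Longrightarrow> smooth_on S g \<Longrightarrow> smooth_on S (\<lambda>x. f x + g x)"
  by (rule smooth_on_combine[OF Ck_on_add])

lemma smooth_on_bilinear:
  "bounded_bilinear B \<Longrightarrow> smooth_on S f \<Longrightarrow> smooth_on S g \<Longrightarrow> smooth_on S (\<lambda>x. B (f x) (g x))"
  by (rule smooth_on_combine[OF Ck_on_bilinear])

lemmas smooth_on_mult [intro] = smooth_on_bilinear[OF bounded_bilinear_mult]

lemma smooth_on_uminus [intro]: "smooth_on S f \<Longrightarrow> smooth_on S (\<lambda>x. - f x)"
  by (rule smooth_on_compose_linear[OF bounded_linear_minus[OF bounded_linear_ident]])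

lemma smooth_on_diff [intro]: "smooth_on S f \<Longrightarrow> smooth_on S g \<Longrightarrow> smooth_on S (\<lambda>x. f x - g x)"
  using smooth_on_add[of S f "\<lambda>x. - g x"] by auto

lemma smooth_on_sum [intro]:
  "(\<And>i. i \<in> I \<Longrightarrow> smooth_on S (f i)) \<Longrightarrow> smooth_on S (\<lambda>x. \<Sum>i\<in>I. f i x)"
  by (induction I rule: infinite_finite_induct) auto

lemma smooth_on_imp_continuous_on: "smooth_on S f \<Longrightarrow> continuous_on S f"
proof (rule continuous_on_eq_continuous_within[THEN iffD2], intro ballI)
  fix x assume f: "smooth_on S f" and x: "x \<in> S"
  then obtain W h where W: "open W" "x \<in> W" "\<forall>k. Ck_on k W h" "\<forall>y\<in>W \<inter> S. h y = f y"
    unfolding smooth_on_def by blast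
  have "continuous_on W h" using W(3) Ck_on.simps(1) by blast
  then have "continuous (at x within S) h"
    using W continuous_on_eq_continuous_at continuous_at_imp_continuous_within by blast
  then have "(h \<longlongrightarrow> f x) (at x within S)"
    using W(2,4) x by (simp add: continuous_within)
  moreover have "\<forall>\<^sub>F y in at x within S. h y = f y"
    using W unfolding eventually_at_topological by blast
  ultimately show "continuous (at x within S) f"
    unfolding continuous_within by (rule Lim_transform_eventually)
qed

lemma smooth_on_compose:
  fixes f :: "'b::euclidean_space \<Rightarrow> 'c::real_normed_vector"
  assumes g: "smooth_on S g" and f: "smooth_on T f" and T: "open T" "g ` S \<subseteq> T"
  shows "smooth_on S (\<lambda>x. f (g x))"
  unfolding smooth_on_def
proof
  fix x assume x: "x \<in> S"
  then obtain W h where W: "open W" "x \<in> W" "\<forall>k. Ck_on k W h" "\<forall>y\<in>W \<inter> S. h y = g y"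
    using g unfolding smooth_on_def by blast
  have "continuous_on W h" using W(3) Ck_on.simps(1) by blast
  then have o: "open (W \<inter> h -` T)"
    using W(1) T(1) continuous_open_preimage by blast
  have "Ck_on k (W \<inter> h -` T) (\<lambda>x. f (h x))" for k
    by (rule Ck_on_compose[OF o T(1) _ _ smooth_onD[OF T(1) f]])
       (use W(3) Ck_on_subset[of k W h "W \<inter> h -` T"] in auto)
  then show "\<exists>W h. open W \<and> x \<in> W \<and> (\<forall>k. Ck_on k W h) \<and> (\<forall>y\<in>W \<inter> S. h y = f (g y))"
    using W o T x by (intro exI[of _ "W \<inter> h -` T"] exI[of _ "\<lambda>x. f (h x)"]) auto
qed

lemma smooth_on_inverse:
  fixes f :: "'a::real_normed_vector \<Rightarrow> real"
  assumes "open S" "smooth_on S f" "\<And>x. x \<in> S \<Longrightarrow> f x \<noteq> 0"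
  shows "smooth_on S (\<lambda>x. inverse (f x))"
  using assms by (simp add: smooth_on_open_iff Ck_on_inverse)

lemma smooth_on_imp_differentiable: "smooth_on S f \<Longrightarrow> open S \<Longrightarrow> x \<in> S \<Longrightarrow> f differentiable at x"
  using smooth_onD[of S f "Suc 0"] by simp

lemma smooth_on_has_derivative:
  "smooth_on S f \<Longrightarrow> open S \<Longrightarrow> x \<in> S \<Longrightarrow> (f has_derivative frechet_derivative f (at x)) (at x)"
  using smooth_on_imp_differentiable by (simp flip: frechet_derivative_works)

lemma smooth_on_frechet_derivative [intro]:
  assumes "smooth_on S f" "open S"
  shows "smooth_on S (\<lambda>x. frechet_derivative f (at x) v)"
  unfolding smooth_on_open_iff[OF assms(2)]
proof
  fix k show "Ck_on k S (\<lambda>x. frechet_derivative f (at x) v)"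
    using smooth_onD[OF assms(2,1), of "Suc k"] by simp
qed

lemma frechet_derivative_cong_open:
  assumes "open S" "x \<in> S" "\<And>y. y \<in> S \<Longrightarrow> f y = g y"
  shows "frechet_derivative f (at x) = frechet_derivative g (at x)"
proof -
  have "(f has_derivative D) (at x) \<longleftrightarrow> (g has_derivative D) (at x)" for D
  proof
    show "(g has_derivative D) (at x)" if "(f has_derivative D) (at x)"
      by (rule has_derivative_transform_within_open[OF that assms(1,2)]) (simp add: assms(3))
    show "(f has_derivative D) (at x)" if "(g has_derivative D) (at x)"
      by (rule has_derivative_transform_within_open[OF that assms(1,2)]) (simp add: assms(3))
  qed
  then show ?thesis by (simp add: frechet_derivative_def)
qed

lemma second_derivative_symmetric:
  fixes f :: "'a::real_normed_vector \<Rightarrow> 'b::euclidean_space"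
  assumes "open S" "Ck_on 2 S f" "x \<in> S"
  shows "frechet_derivative (\<lambda>z. frechet_derivative f (at z) v) (at x) w =
         frechet_derivative (\<lambda>z. frechet_derivative f (at z) w) (at x) v"
proof (rule euclidean_eqI)
  fix b :: 'b
  have C2: "\<And>z. z \<in> S \<Longrightarrow> f differentiable at z"
    "\<And>z v. z \<in> S \<Longrightarrow> (\<lambda>z. frechet_derivative f (at z) v) differentiable at z"
    using assms(2) by (auto simp: numeral_2_eq_2)
  have in_comm: "frechet_derivative (\<lambda>z. g z \<bullet> b) (at z) v = frechet_derivative g (at z) v \<bullet> b"
    if "g differentiable at z" for g :: "'a \<Rightarrow> 'b" and z v
  proof -
    have "((\<lambda>z. g z \<bullet> b) has_derivative (\<lambda>v. frechet_derivative g (at z) v \<bullet> b)) (at z)"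
      using that by (intro has_derivative_inner_left) (simp flip: frechet_derivative_works)
    from frechet_derivative_at[OF this] show ?thesis by metis
  qed
  have e: "frechet_derivative (\<lambda>z. frechet_derivative (\<lambda>z. f z \<bullet> b) (at z) v) (at x) w
      = frechet_derivative (\<lambda>z. frechet_derivative f (at z) v) (at x) w \<bullet> b" for v w
  proof -
    have "frechet_derivative (\<lambda>z. frechet_derivative (\<lambda>z. f z \<bullet> b) (at z) v) (at x)
      = frechet_derivative (\<lambda>z. frechet_derivative f (at z) v \<bullet> b) (at x)"
      using in_comm C2 by (intro frechet_derivative_cong_open[OF assms(1,3)]) auto
    then show ?thesis using in_comm C2 assms(3) by simp
  qed
  have "Ck_on 2 S (\<lambda>z. f z \<bullet> b)"
    by (rule Ck_on_compose_linear[OF bounded_linear_inner_left assms(2,1)])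
  from second_derivative_symmetric_real[OF assms(1) this assms(3), of v w]
  show "frechet_derivative (\<lambda>z. frechet_derivative f (at z) v) (at x) w \<bullet> b =
         frechet_derivative (\<lambda>z. frechet_derivative f (at z) w) (at x) v \<bullet> b"
    by (simp add: e)
qed

section \<open>Smooth families of functions over the unit interval\<close>

text \<open>Smoothness in time and space jointly, up to and including the end points of the time interval, where a
  one-sided extension across the boundary is what \<^const>\<open>smooth_on\<close> provides.\<close>

definition smooth_family :: "'a::real_normed_vector set \<Rightarrow> (real \<Rightarrow> 'a \<Rightarrow> 'b::real_normed_vector) \<Rightarrow> bool" where
  "smooth_family U u \<longleftrightarrow> smooth_on ({0..1} \<times> U) (\<lambda>(t, z). u t z)"

definition time_deriv :: "(real \<Rightarrow> 'a \<Rightarrow> 'b::real_normed_vector) \<Rightarrow> real \<Rightarrow> 'a \<Rightarrow> 'b" where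
  "time_deriv u t z = vector_derivative (\<lambda>s. u s z) (at t within {0..1})"

text \<open>As a rewrite rule this equation would loop, since its right-hand side is an instance of its left-hand side.\<close>

lemma linear_Pair_0:
  assumes "linear L" shows "L (k, 0) = k *\<^sub>R L (1::real, 0)"
proof -
  have "L (k *\<^sub>R (1, 0)) = k *\<^sub>R L (1, 0)" by (rule linear_scale[OF assms])
  moreover have "k *\<^sub>R (1::real, 0) = (k, 0)" by simp
  ultimately show ?thesis by metis
qed

text \<open>All partial derivatives of a family, at end points of the time interval too, are those of a smooth function
  on an open set of space-time. Statements about families reduce to the open case in this way.\<close>

lemma smooth_family_extension:
  assumes u: "smooth_family U u" and U: "open U" and t: "t \<in> {0..1}" and z: "z \<in> U"
  obtains W h where "open W" "(t, z) \<in> W" "\<And>k. Ck_on k W h"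
    "\<And>s y. (s, y) \<in> W \<Longrightarrow> s \<in> {0..1} \<Longrightarrow> y \<in> U \<Longrightarrow> u s y = h (s, y)"
    "\<And>s y. (s, y) \<in> W \<Longrightarrow> s \<in> {0..1} \<Longrightarrow> y \<in> U \<Longrightarrow>
        (u s has_derivative (\<lambda>v. frechet_derivative h (at (s, y)) (0, v))) (at y)"
    "\<And>s y. (s, y) \<in> W \<Longrightarrow> s \<in> {0..1} \<Longrightarrow> y \<in> U \<Longrightarrow>
        ((\<lambda>r. u r y) has_vector_derivative frechet_derivative h (at (s, y)) (1, 0)) (at s within {0..1})"
proof -
  obtain W h where W: "open W" "(t, z) \<in> W" "\<forall>k. Ck_on k W h"
      "\<forall>y\<in>W \<inter> ({0..1} \<times> U). h y = (case y of (t, z) \<Rightarrow> u t z)"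
    using u t z unfolding smooth_family_def smooth_on_def by (metis (no_types, lifting) mem_Sigma_iff)
  have hu: "u s y = h (s, y)" if "(s, y) \<in> W" "s \<in> {0..1}" "y \<in> U" for s y
    using W(4) that by auto
  have dh: "(h has_derivative frechet_derivative h (at p)) (at p)" if "p \<in> W" for p
    using W(3) that Ck_on.simps(2) frechet_derivative_works by blast
  show thesis
  proof (rule that[OF W(1,2)])
    fix s y assume a: "(s, y) \<in> W" "s \<in> {0..1}" "y \<in> U"
    have D: "((\<lambda>y. h (s, y)) has_derivative (\<lambda>v. frechet_derivative h (at (s, y)) (0, v))) (at y)"
      by (rule has_derivative_compose[of "\<lambda>y. (s, y)" "\<lambda>v. (0, v)"])
         (use dh[OF a(1)] in \<open>auto intro!: derivative_eq_intros\<close>)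
    have op: "open (Pair s -` W \<inter> U)"
      using W(1) U by (intro open_Int open_vimage) (auto intro!: continuous_intros)
    show "(u s has_derivative (\<lambda>v. frechet_derivative h (at (s, y)) (0, v))) (at y)"
      by (rule has_derivative_transform_within_open[OF D op]) (use a hu in auto)
    have A: "((\<lambda>r. h (r, y)) has_derivative (\<lambda>k. frechet_derivative h (at (s, y)) (k, 0))) (at s within {0..1})"
      by (rule has_derivative_compose[of "\<lambda>r. (r, y)" "\<lambda>k. (k, 0)"])
         (use dh[OF a(1)] in \<open>auto intro!: derivative_eq_intros\<close>)
    have L: "(\<lambda>k. frechet_derivative h (at (s, y)) (k, 0)) = (\<lambda>k. k *\<^sub>R frechet_derivative h (at (s, y)) (1, 0))"
      by (rule ext, rule linear_Pair_0[OF has_derivative_linear[OF dh[OF a(1)]]])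
    have V: "((\<lambda>r. h (r, y)) has_vector_derivative frechet_derivative h (at (s, y)) (1, 0)) (at s within {0..1})"
      using A unfolding L has_vector_derivative_def .
    have "open ((\<lambda>r. (r, y)) -` W)"
      using W(1) by (intro open_vimage) (auto intro!: continuous_intros)
    then obtain d where d: "d > 0" "ball s d \<subseteq> (\<lambda>r. (r, y)) -` W"
      using a(1) by (meson openE vimageI2)
    show "((\<lambda>r. u r y) has_vector_derivative frechet_derivative h (at (s, y)) (1, 0)) (at s within {0..1})"
      by (rule has_vector_derivative_transform_within[OF V d(1) a(2)])
         (use d(2) hu a in \<open>auto simp: subset_iff dist_commute\<close>)
  qed (use W(3) hu in auto)
qed

context
  fixes U :: "'a::euclidean_space set" and u :: "real \<Rightarrow> 'a \<Rightarrow> 'b::euclidean_space"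
  assumes u: "smooth_family U u" and U: "open U"
begin

lemma smooth_family_slice:
  assumes t: "t \<in> {0..1}" shows "smooth_on U (u t)"
  unfolding smooth_on_def
proof
  fix z assume z: "z \<in> U"
  obtain W h where W: "open W" "(t, z) \<in> W" "\<And>k. Ck_on k W h"
    "\<And>s y. (s, y) \<in> W \<Longrightarrow> s \<in> {0..1} \<Longrightarrow> y \<in> U \<Longrightarrow> u s y = h (s, y)"
    using smooth_family_extension[OF u U t z] by metis
  have op: "open (Pair t -` W)"
    using W(1) by (intro open_vimage) (auto intro!: continuous_intros)
  have P: "smooth_on (Pair t -` W) (\<lambda>z. (t, z))"
  proof -
    have "smooth_on (Pair t -` W) (\<lambda>z. (t, 0) + (0, z))"
      by (intro smooth_on_add smooth_on_const smooth_on_linear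
          bounded_linear_Pair bounded_linear_zero bounded_linear_ident)
    then show ?thesis by simp
  qed
  have "Ck_on k (Pair t -` W) (\<lambda>z. h (t, z))" for k
    by (rule Ck_on_compose[OF op W(1)]) (use W P op in \<open>auto simp: smooth_on_open_iff\<close>)
  then show "\<exists>W h. open W \<and> z \<in> W \<and> (\<forall>k. Ck_on k W h) \<and> (\<forall>y\<in>W \<inter> U. h y = u t y)"
    using W op t by (intro exI[of _ "Pair t -` W"] exI[of _ "\<lambda>z. h (t, z)"]) auto
qed

lemma smooth_family_has_time_deriv:
  assumes t: "t \<in> {0..1}" and z: "z \<in> U"
  shows "((\<lambda>s. u s z) has_vector_derivative time_deriv u t z) (at t within {0..1})"
proof -
  obtain D where D: "((\<lambda>s. u s z) has_vector_derivative D) (at t within {0..1})"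
    using smooth_family_extension[OF u U t z] t z by metis
  then have "time_deriv u t z = D"
    unfolding time_deriv_def using t by (intro vector_derivative_within_closed_interval) auto
  then show ?thesis using D by simp
qed

lemma smooth_family_extension_derivs:
  assumes t: "t \<in> {0..1}" and z: "z \<in> U"
  obtains W h where "open W" "(t, z) \<in> W" "\<And>k. Ck_on k W h"
    "\<And>s y. (s, y) \<in> W \<Longrightarrow> s \<in> {0..1} \<Longrightarrow> y \<in> U \<Longrightarrow> time_deriv u s y = frechet_derivative h (at (s, y)) (1, 0)"
    "\<And>s y v. (s, y) \<in> W \<Longrightarrow> s \<in> {0..1} \<Longrightarrow> y \<in> U \<Longrightarrow>
        frechet_derivative (u s) (at y) v = frechet_derivative h (at (s, y)) (0, v)"
proof -
  obtain W h where W: "open W" "(t, z) \<in> W" "\<And>k. Ck_on k W h"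
    "\<And>s y. (s, y) \<in> W \<Longrightarrow> s \<in> {0..1} \<Longrightarrow> y \<in> U \<Longrightarrow>
        (u s has_derivative (\<lambda>v. frechet_derivative h (at (s, y)) (0, v))) (at y)"
    "\<And>s y. (s, y) \<in> W \<Longrightarrow> s \<in> {0..1} \<Longrightarrow> y \<in> U \<Longrightarrow>
        ((\<lambda>r. u r y) has_vector_derivative frechet_derivative h (at (s, y)) (1, 0)) (at s within {0..1})"
    using smooth_family_extension[OF u U t z] by metis
  show thesis
  proof (rule that[OF W(1-3)])
    fix s y assume a: "(s, y) \<in> W" "s \<in> {0..1}" "y \<in> U"
    show "time_deriv u s y = frechet_derivative h (at (s, y)) (1, 0)"
      unfolding time_deriv_def using a W(5)[OF a] by (intro vector_derivative_within_closed_interval) auto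
    show "frechet_derivative (u s) (at y) v = frechet_derivative h (at (s, y)) (0, v)" for v
      using frechet_derivative_at[OF W(4)[OF a]] by metis
  qed
qed

lemma smooth_family_time_deriv: "smooth_family U (time_deriv u)"
  unfolding smooth_family_def smooth_on_def
proof (clarify)
  fix t z assume t: "t \<in> {0..1::real}" and z: "z \<in> U"
  obtain W h where W: "open W" "(t, z) \<in> W" "\<And>k. Ck_on k W h"
    "\<And>s y. (s, y) \<in> W \<Longrightarrow> s \<in> {0..1} \<Longrightarrow> y \<in> U \<Longrightarrow> time_deriv u s y = frechet_derivative h (at (s, y)) (1, 0)"
    using smooth_family_extension_derivs[OF t z] by metis
  show "\<exists>W h. open W \<and> (t, z) \<in> W \<and> (\<forall>k. Ck_on k W h) \<and>
      (\<forall>y\<in>W \<inter> {0..1} \<times> U. h y = (case y of (t, z) \<Rightarrow> time_deriv u t z))"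
    by (rule exI[of _ W], rule exI[of _ "\<lambda>p. frechet_derivative h (at p) (1, 0)"])
       (use W in \<open>auto intro: Ck_on.simps(2)[THEN iffD1, THEN conjunct2, THEN spec]\<close>)
qed

lemma smooth_family_frechet_derivative: "smooth_family U (\<lambda>t z. frechet_derivative (u t) (at z) v)"
  unfolding smooth_family_def smooth_on_def
proof (clarify)
  fix t z assume t: "t \<in> {0..1::real}" and z: "z \<in> U"
  obtain W h where W: "open W" "(t, z) \<in> W" "\<And>k. Ck_on k W h"
    "\<And>s y v. (s, y) \<in> W \<Longrightarrow> s \<in> {0..1} \<Longrightarrow> y \<in> U \<Longrightarrow>
        frechet_derivative (u s) (at y) v = frechet_derivative h (at (s, y)) (0, v)"
    using smooth_family_extension_derivs[OF t z] by metis
  show "\<exists>W h. open W \<and> (t, z) \<in> W \<and> (\<forall>k. Ck_on k W h) \<and>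
      (\<forall>y\<in>W \<inter> {0..1} \<times> U. h y = (case y of (t, z) \<Rightarrow> frechet_derivative (u t) (at z) v))"
    by (rule exI[of _ W], rule exI[of _ "\<lambda>p. frechet_derivative h (at p) (0, v)"])
       (use W in \<open>auto intro: Ck_on.simps(2)[THEN iffD1, THEN conjunct2, THEN spec]\<close>)
qed

text \<open>Time and space derivatives commute, by the symmetry of second derivatives of the local extension.\<close>

lemma smooth_family_mixed_deriv:
  assumes t: "t \<in> {0..1}" and z: "z \<in> U"
  shows "time_deriv (\<lambda>t z. frechet_derivative (u t) (at z) v) t z = frechet_derivative (time_deriv u t) (at z) v"
proof -
  obtain W h where W: "open W" "(t, z) \<in> W" "\<And>k. Ck_on k W h"
    "\<And>s y. (s, y) \<in> W \<Longrightarrow> s \<in> {0..1} \<Longrightarrow> y \<in> U \<Longrightarrow> time_deriv u s y = frechet_derivative h (at (s, y)) (1, 0)"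
    "\<And>s y v. (s, y) \<in> W \<Longrightarrow> s \<in> {0..1} \<Longrightarrow> y \<in> U \<Longrightarrow>
        frechet_derivative (u s) (at y) v = frechet_derivative h (at (s, y)) (0, v)"
    using smooth_family_extension_derivs[OF t z] by metis
  let ?hv = "\<lambda>p. frechet_derivative h (at p) (0, v)" and ?ht = "\<lambda>p. frechet_derivative h (at p) (1, 0)"
  have dif: "((\<lambda>p. frechet_derivative h (at p) w) has_derivative
      frechet_derivative (\<lambda>p. frechet_derivative h (at p) w) (at (t, z))) (at (t, z))" for w
    using W(2) W(3)[of "Suc (Suc 0)"] unfolding Ck_on.simps frechet_derivative_works[symmetric] by blast
  have A: "((\<lambda>r. ?hv (r, z)) has_derivative (\<lambda>k. frechet_derivative ?hv (at (t, z)) (k, 0))) (at t within {0..1})"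
    by (rule has_derivative_compose[of "\<lambda>r. (r, z)" "\<lambda>k. (k, 0)" _ _ ?hv])
       (use dif in \<open>auto intro!: derivative_eq_intros\<close>)
  have L: "(\<lambda>k. frechet_derivative ?hv (at (t, z)) (k, 0)) = (\<lambda>k. k *\<^sub>R frechet_derivative ?hv (at (t, z)) (1, 0))"
    by (rule ext, rule linear_Pair_0[OF has_derivative_linear[OF dif]])
  have V: "((\<lambda>r. ?hv (r, z)) has_vector_derivative frechet_derivative ?hv (at (t, z)) (1, 0)) (at t within {0..1})"
    using A unfolding L has_vector_derivative_def .
  have "open ((\<lambda>r. (r, z)) -` W)"
    using W(1) by (intro open_vimage) (auto intro!: continuous_intros)
  then obtain d where d: "d > 0" "ball t d \<subseteq> (\<lambda>r. (r, z)) -` W"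
    using W(2) by (meson openE vimageI2)
  have "((\<lambda>r. frechet_derivative (u r) (at z) v) has_vector_derivative frechet_derivative ?hv (at (t, z)) (1, 0)) (at t within {0..1})"
    by (rule has_vector_derivative_transform_within[OF V d(1) t])
       (use d(2) W(5) z in \<open>auto simp: subset_iff dist_commute\<close>)
  then have 1: "time_deriv (\<lambda>t z. frechet_derivative (u t) (at z) v) t z = frechet_derivative ?hv (at (t, z)) (1, 0)"
    unfolding time_deriv_def using t by (intro vector_derivative_within_closed_interval) auto
  have D: "((\<lambda>y. ?ht (t, y)) has_derivative (\<lambda>v. frechet_derivative ?ht (at (t, z)) (0, v))) (at z)"
    by (rule has_derivative_compose[of "\<lambda>y. (t, y)" "\<lambda>v. (0, v)" _ _ ?ht])
       (use dif in \<open>auto intro!: derivative_eq_intros\<close>)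
  have op: "open (Pair t -` W \<inter> U)"
    using W(1) U by (intro open_Int open_vimage) (auto intro!: continuous_intros)
  have "(time_deriv u t has_derivative (\<lambda>v. frechet_derivative ?ht (at (t, z)) (0, v))) (at z)"
    by (rule has_derivative_transform_within_open[OF D op]) (use W t z in auto)
  from frechet_derivative_at[OF this]
  have 2: "frechet_derivative (time_deriv u t) (at z) v = frechet_derivative ?ht (at (t, z)) (0, v)" by metis
  show ?thesis
    using 1 2 second_derivative_symmetric[OF W(1) W(3) W(2), where v = "(0, v)" and w = "(1, 0)"] by simp
qed

lemma smooth_family_continuous: "continuous_on ({0..1} \<times> U) (\<lambda>(t, z). u t z)"
  using u smooth_on_imp_continuous_on unfolding smooth_family_def by blast

end

lemma smooth_family_const:
  fixes f :: "'a::euclidean_space \<Rightarrow> 'b::real_normed_vector"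
  assumes "smooth_on U f" "open U"
  shows "smooth_family U (\<lambda>t. f)"
  unfolding smooth_family_def case_prod_unfold
  by (rule smooth_on_compose[where g = snd and T = U]) (use assms in \<open>auto intro: smooth_on_linear bounded_linear_snd\<close>)

section \<open>Wirtinger derivatives of complex-valued functions\<close>

text \<open>The parameter \<open>s\<close> treats \<open>\<partial>/\<partial>z\<^sup>i\<close> (\<open>s = -\<i>\<close>) and its conjugate (\<open>s = \<i>\<close>) at once, so that each rule of
  calculus and each commutation relation is proved only once.\<close>

definition wirtinger :: "complex \<Rightarrow> 2 \<Rightarrow> (complex^2 \<Rightarrow> complex) \<Rightarrow> complex^2 \<Rightarrow> complex" where
  "wirtinger s i f z = (1/2) * (frechet_derivative f (at z) (axis i 1) + s * frechet_derivative f (at z) (axis i \<i>))"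

abbreviation dw :: "2 \<Rightarrow> (complex^2 \<Rightarrow> complex) \<Rightarrow> complex^2 \<Rightarrow> complex" where
  "dw \<equiv> wirtinger (- \<i>)"

abbreviation dwb :: "2 \<Rightarrow> (complex^2 \<Rightarrow> complex) \<Rightarrow> complex^2 \<Rightarrow> complex" where
  "dwb \<equiv> wirtinger \<i>"

lemma wirtinger_cong:
  assumes "open S" "z \<in> S" "\<And>y. y \<in> S \<Longrightarrow> f y = g y"
  shows "wirtinger s i f z = wirtinger s i g z"
  by (simp add: wirtinger_def frechet_derivative_cong_open[OF assms])

lemma smooth_on_wirtinger [intro]: "smooth_on S f \<Longrightarrow> open S \<Longrightarrow> smooth_on S (wirtinger s i f)"
  unfolding wirtinger_def by (intro smooth_on_mult smooth_on_add smooth_on_const smooth_on_frechet_derivative)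

lemma wirtinger_eqI:
  assumes "(f has_derivative D) (at z)"
  shows "wirtinger s i f z = (1/2) * (D (axis i 1) + s * D (axis i \<i>))"
  by (simp add: wirtinger_def frechet_derivative_at[OF assms])

lemma wirtinger_const [simp]: "wirtinger s i (\<lambda>z. c) z = 0"
  by (simp add: wirtinger_eqI[of _ "\<lambda>_. 0"])

lemma wirtinger_add:
  assumes "f differentiable at z" "g differentiable at z"
  shows "wirtinger s i (\<lambda>z. f z + g z) z = wirtinger s i f z + wirtinger s i g z"
proof -
  have "((\<lambda>z. f z + g z) has_derivative (\<lambda>v. frechet_derivative f (at z) v + frechet_derivative g (at z) v)) (at z)"
    using assms by (intro has_derivative_add) (simp_all flip: frechet_derivative_works)
  from wirtinger_eqI[OF this] show ?thesis by (simp add: wirtinger_def algebra_simps)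
qed

lemma wirtinger_mult:
  assumes "f differentiable at z" "g differentiable at z"
  shows "wirtinger s i (\<lambda>z. f z * g z) z = f z * wirtinger s i g z + wirtinger s i f z * g z"
proof -
  have "((\<lambda>z. f z * g z) has_derivative
      (\<lambda>v. f z * frechet_derivative g (at z) v + frechet_derivative f (at z) v * g z)) (at z)"
    using assms by (intro has_derivative_mult) (simp_all flip: frechet_derivative_works)
  from wirtinger_eqI[OF this] show ?thesis by (simp add: wirtinger_def algebra_simps)
qed

lemma wirtinger_cmult:
  "f differentiable at z \<Longrightarrow> wirtinger s i (\<lambda>z. c * f z) z = c * wirtinger s i f z"
  by (simp add: wirtinger_mult)

lemma wirtinger_minus:
  "f differentiable at z \<Longrightarrow> wirtinger s i (\<lambda>z. - f z) z = - wirtinger s i f z"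
  using wirtinger_cmult[of f z s i "-1"] by simp

lemma wirtinger_diff:
  "f differentiable at z \<Longrightarrow> g differentiable at z \<Longrightarrow>
     wirtinger s i (\<lambda>z. f z - g z) z = wirtinger s i f z - wirtinger s i g z"
  using wirtinger_add[of f z "\<lambda>z. - g z" s i] by (simp add: wirtinger_minus)

lemma wirtinger_sum:
  assumes "finite I" "\<And>a. a \<in> I \<Longrightarrow> f a differentiable at z"
  shows "wirtinger s i (\<lambda>z. \<Sum>a\<in>I. f a z) z = (\<Sum>a\<in>I. wirtinger s i (f a) z)"
  using assms by (induction I rule: finite_induct) (simp_all add: wirtinger_add)

lemma wirtinger_commute:
  assumes "smooth_on S f" "open S" "z \<in> S"
  shows "wirtinger s i (wirtinger r j f) z = wirtinger r j (wirtinger s i f) z"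
proof -
  have d: "frechet_derivative (wirtinger r j f) (at z) w = (1/2) *
      (frechet_derivative (\<lambda>z. frechet_derivative f (at z) (axis j 1)) (at z) w
       + r * frechet_derivative (\<lambda>z. frechet_derivative f (at z) (axis j \<i>)) (at z) w)" for r j w
  proof -
    have D: "((\<lambda>z. frechet_derivative f (at z) v) has_derivative
       frechet_derivative (\<lambda>z. frechet_derivative f (at z) v) (at z)) (at z)" for v
      using assms by (intro smooth_on_has_derivative smooth_on_frechet_derivative)
    have "((\<lambda>z. (1/2) * (frechet_derivative f (at z) (axis j 1) + r * frechet_derivative f (at z) (axis j \<i>)))
      has_derivative (\<lambda>w. (1/2) * (frechet_derivative (\<lambda>z. frechet_derivative f (at z) (axis j 1)) (at z) w
       + r * frechet_derivative (\<lambda>z. frechet_derivative f (at z) (axis j \<i>)) (at z) w))) (at z)"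
      by (intro has_derivative_mult_right has_derivative_add D)
    from frechet_derivative_eqI[OF this] show ?thesis
      unfolding wirtinger_def[abs_def] .
  qed
  have sym: "frechet_derivative (\<lambda>z. frechet_derivative f (at z) v) (at z) w
     = frechet_derivative (\<lambda>z. frechet_derivative f (at z) w) (at z) v" for v w
    by (rule second_derivative_symmetric[OF assms(2) smooth_onD[OF assms(2,1)] assms(3)])
  show ?thesis
    unfolding wirtinger_def[of s i "wirtinger r j f"] wirtinger_def[of r j "wirtinger s i f"] d
    by (simp add: sym[of "axis j _" "axis i _"] algebra_simps)
qed

lemma wirtinger_cnj:
  assumes "f differentiable at z"
  shows "wirtinger s i (\<lambda>z. cnj (f z)) z = cnj (wirtinger (cnj s) i f z)"
proof -
  have "((\<lambda>z. cnj (f z)) has_derivative (\<lambda>v. cnj (frechet_derivative f (at z) v))) (at z)"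
    using assms by (intro has_derivative_cnj) (simp flip: frechet_derivative_works)
  from wirtinger_eqI[OF this] show ?thesis by (simp add: wirtinger_def)
qed

lemma smooth_on_cnj [intro]: "smooth_on S f \<Longrightarrow> smooth_on S (\<lambda>z. cnj (f z))"
  by (rule smooth_on_compose_linear[OF bounded_linear_cnj])

lemma smooth_on_of_real [intro]: "smooth_on S f \<Longrightarrow> smooth_on S (\<lambda>z. complex_of_real (f z))"
  by (rule smooth_on_compose_linear[OF bounded_linear_of_real])

lemma smooth_on_nth [intro]: "smooth_on S f \<Longrightarrow> smooth_on S (\<lambda>z. f z $ i)"
  by (rule smooth_on_compose_linear[OF bounded_linear_vec_nth])

text \<open>The decomposition of a real-linear map into its complex-linear and its antilinear part.\<close>

lemma frechet_derivative_wirtinger: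
  assumes "f differentiable at z"
  shows "frechet_derivative f (at z) w = (\<Sum>k\<in>UNIV. w $ k * dw k f z + cnj (w $ k) * dwb k f z)"
proof -
  let ?L = "frechet_derivative f (at z)"
  have L: "linear ?L" by (rule linear_frechet_derivative[OF assms])
  have w: "w = (\<Sum>k\<in>UNIV. Re (w $ k) *\<^sub>R axis k 1 + Im (w $ k) *\<^sub>R axis k \<i>)"
    by (auto simp: vec_eq_iff axis_def complex_eq_iff if_distrib sum.distrib cong: if_cong)
  have "?L w = ?L (\<Sum>k\<in>UNIV. Re (w $ k) *\<^sub>R axis k 1 + Im (w $ k) *\<^sub>R axis k \<i>)"
    by (rule arg_cong[OF w])
  also have "\<dots> = (\<Sum>k\<in>UNIV. Re (w $ k) *\<^sub>R ?L (axis k 1) + Im (w $ k) *\<^sub>R ?L (axis k \<i>))"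
    by (simp add: linear_sum[OF L] linear_add[OF L] linear_scale[OF L])
  also have "\<dots> = (\<Sum>k\<in>UNIV. w $ k * dw k f z + cnj (w $ k) * dwb k f z)"
  proof (rule sum.cong[OF refl])
    fix k :: 2
    show "Re (w $ k) *\<^sub>R ?L (axis k 1) + Im (w $ k) *\<^sub>R ?L (axis k \<i>)
       = w $ k * dw k f z + cnj (w $ k) * dwb k f z"
      by (simp add: wirtinger_def complex_eq_iff field_simps)
  qed
  finally show ?thesis .
qed

lemma wirtinger_chain:
  assumes "F differentiable at z" "f differentiable at (F z)"
  shows "wirtinger s i (\<lambda>z. f (F z)) z =
    (\<Sum>k\<in>UNIV. dw k f (F z) * wirtinger s i (\<lambda>z. F z $ k) z + dwb k f (F z) * wirtinger s i (\<lambda>z. cnj (F z $ k)) z)"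
proof -
  let ?F = "frechet_derivative F (at z)"
  have F: "(F has_derivative ?F) (at z)" using assms(1) by (simp flip: frechet_derivative_works)
  have "((\<lambda>z. f (F z)) has_derivative (\<lambda>v. frechet_derivative f (at (F z)) (?F v))) (at z)"
    using assms by (intro has_derivative_compose[of F _ _ _ f]) (simp_all flip: frechet_derivative_works)
  note 1 = wirtinger_eqI[OF this]
  have n: "((\<lambda>z. F z $ k) has_derivative (\<lambda>v. ?F v $ k)) (at z)" for k
    by (rule bounded_linear.has_derivative[OF bounded_linear_vec_nth F])
  have c: "((\<lambda>z. cnj (F z $ k)) has_derivative (\<lambda>v. cnj (?F v $ k))) (at z)" for k
    by (rule has_derivative_cnj[OF n])
  show ?thesis
    unfolding 1 wirtinger_eqI[OF n] wirtinger_eqI[OF c] frechet_derivative_wirtinger[OF assms(2)]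
    by (simp add: sum_2 algebra_simps)
qed

text \<open>Every form below is a combination of constant forms with scalar coefficients, so this rule reduces the
  derivatives of forms to those of the coefficients.\<close>

lemma pd_lincomb:
  fixes w :: "'b \<Rightarrow> complex^'n"
  assumes "finite I" "\<And>a. a \<in> I \<Longrightarrow> f a differentiable at z"
  shows "pd i (\<lambda>z. \<Sum>a\<in>I. f a z *s w a) z = (\<Sum>a\<in>I. dw i (f a) z *s w a)"
    and "pdbar i (\<lambda>z. \<Sum>a\<in>I. f a z *s w a) z = (\<Sum>a\<in>I. dwb i (f a) z *s w a)"
proof -
  have "((\<lambda>z. f a z *s w a) has_derivative (\<lambda>v. frechet_derivative (f a) (at z) v *s w a)) (at z)" if "a \<in> I" for a
  proof -
    have "bounded_linear (\<lambda>c. c *s w a)"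
      by (intro linear_conv_bounded_linear[THEN iffD1] linearI)
         (auto simp: vec_eq_iff algebra_simps)
    then show ?thesis
      by (rule bounded_linear.has_derivative) (use assms(2)[OF that] in \<open>simp flip: frechet_derivative_works\<close>)
  qed
  then have "((\<lambda>z. \<Sum>a\<in>I. f a z *s w a) has_derivative (\<lambda>v. \<Sum>a\<in>I. frechet_derivative (f a) (at z) v *s w a)) (at z)"
    by (intro has_derivative_sum)
  note D = frechet_derivative_at[OF this, symmetric]
  show "pd i (\<lambda>z. \<Sum>a\<in>I. f a z *s w a) z = (\<Sum>a\<in>I. dw i (f a) z *s w a)"
    "pdbar i (\<lambda>z. \<Sum>a\<in>I. f a z *s w a) z = (\<Sum>a\<in>I. dwb i (f a) z *s w a)"
    unfolding pd_def pdbar_def D wirtinger_def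
    by (simp_all add: vec_eq_iff sum_distrib_left sum.distrib sum_subtractf algebra_simps)
qed

lemma pd_smult:
  fixes w :: "complex^'n"
  assumes "f differentiable at z"
  shows "pd i (\<lambda>z. f z *s w) z = dw i f z *s w" "pdbar i (\<lambda>z. f z *s w) z = dwb i f z *s w"
  using pd_lincomb[of "{()}" "\<lambda>_. f" z i "\<lambda>_. w"] assms by simp_all

lemma pd_cong:
  assumes "open S" "z \<in> S" "\<And>y. y \<in> S \<Longrightarrow> f y = g y"
  shows "pd i f z = pd i g z"
  by (simp add: pd_def frechet_derivative_cong_open[OF assms])

lemma pd_nth:
  assumes "F differentiable at z"
  shows "pd i F z $ k = dw i (\<lambda>z. F z $ k) z" "pdbar i F z $ k = dwb i (\<lambda>z. F z $ k) z"
proof -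
  have n: "((\<lambda>z. F z $ k) has_derivative (\<lambda>v. frechet_derivative F (at z) v $ k)) (at z)"
    using assms by (intro bounded_linear.has_derivative[OF bounded_linear_vec_nth]) (simp flip: frechet_derivative_works)
  show "pd i F z $ k = dw i (\<lambda>z. F z $ k) z" "pdbar i F z $ k = dwb i (\<lambda>z. F z $ k) z"
    by (simp_all add: pd_def pdbar_def wirtinger_eqI[OF n])
qed

section \<open>Wirtinger derivatives of families\<close>

lemma smooth_family_add:
  "smooth_family U u \<Longrightarrow> smooth_family U v \<Longrightarrow> smooth_family U (\<lambda>t z. u t z + v t z)"
  unfolding smooth_family_def case_prod_unfold by (rule smooth_on_add)

lemma smooth_family_mult:
  fixes u v :: "real \<Rightarrow> 'a::real_normed_vector \<Rightarrow> complex"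
  shows "smooth_family U u \<Longrightarrow> smooth_family U v \<Longrightarrow> smooth_family U (\<lambda>t z. u t z * v t z)"
  unfolding smooth_family_def case_prod_unfold by (rule smooth_on_mult)

lemma smooth_family_wirtinger:
  assumes "smooth_family U u" "open U"
  shows "smooth_family U (\<lambda>t. wirtinger s i (u t))"
proof -
  have "smooth_on ({0..1} \<times> U) (\<lambda>p. (1/2) * (frechet_derivative (u (fst p)) (at (snd p)) (axis i 1)
      + s * frechet_derivative (u (fst p)) (at (snd p)) (axis i \<i>)))"
    using smooth_family_frechet_derivative[OF assms]
    unfolding smooth_family_def case_prod_unfold by (intro smooth_on_mult smooth_on_add smooth_on_const)
  then show ?thesis unfolding smooth_family_def case_prod_unfold wirtinger_def .
qed

lemma smooth_family_wirtinger_time_deriv: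
  assumes u: "smooth_family U u" "open U" and t: "t \<in> {0..1}" "z \<in> U"
  shows "((\<lambda>t. wirtinger s i (u t) z) has_vector_derivative wirtinger s i (time_deriv u t) z) (at t within {0..1})"
proof -
  have "((\<lambda>r. frechet_derivative (u r) (at z) v) has_vector_derivative
      frechet_derivative (time_deriv u t) (at z) v) (at t within {0..1})" for v
    using smooth_family_has_time_deriv[OF smooth_family_frechet_derivative[OF u, of v] u(2) t]
    by (simp add: smooth_family_mixed_deriv[OF u t])
  then show ?thesis unfolding wirtinger_def
    by (intro has_vector_derivative_mult_right has_vector_derivative_add)
qed

section \<open>Exterior algebra\<close>

text \<open>A product over explicit finite sets can be evaluated by rewriting.\<close>

lemma shuffle_sign_prod: "shuffle_sign I J = (\<Prod>i\<in>I. \<Prod>j\<in>J. if j < i then -1 else 1)"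
proof -
  have "(\<Prod>i\<in>I. \<Prod>j\<in>J. if j < i then -1 else 1 :: complex) = (\<Prod>p\<in>I \<times> J. if snd p < fst p then -1 else 1)"
    by (simp add: prod.cartesian_product case_prod_unfold)
  also have "\<dots> = (-1) ^ card {p \<in> I \<times> J. snd p < fst p}"
    by (simp add: prod.If_cases Int_def)
  also have "{p \<in> I \<times> J. snd p < fst p} = {(i, j). i \<in> I \<and> j \<in> J \<and> j < i}" by auto
  finally show ?thesis by (simp add: shuffle_sign_def)
qed

lemma ext_wedge_add_left: "ext_wedge (a + b) c = ext_wedge a c + ext_wedge b c"
  by (simp add: ext_wedge_def vec_eq_iff algebra_simps sum.distrib)

lemma ext_wedge_add_right: "ext_wedge c (a + b) = ext_wedge c a + ext_wedge c b"
  by (simp add: ext_wedge_def vec_eq_iff algebra_simps sum.distrib)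

lemma ext_wedge_scale_right: "ext_wedge a (k *s c) = k *s ext_wedge a c"
  by (simp add: ext_wedge_def vec_eq_iff sum_distrib_left mult_ac)

lemma ext_wedge_0_right: "ext_wedge a 0 = 0"
  by (simp add: ext_wedge_def vec_eq_iff)

lemma ext_wedge_0_left: "ext_wedge 0 a = 0"
  by (simp add: ext_wedge_def vec_eq_iff)

lemma ext_wedge_sum_right: "ext_wedge c (\<Sum>i\<in>I. f i) = (\<Sum>i\<in>I. ext_wedge c (f i))"
  by (induction I rule: infinite_finite_induct) (auto simp: ext_wedge_add_right ext_wedge_0_right)

lemma ext_wedge_axis:
  "ext_wedge (axis I a) (axis J b) = (if I \<inter> J = {} then axis (I \<union> J) (shuffle_sign I J * a * b) else 0)"
proof -
  have "ext_wedge (axis I a) (axis J b) $ K =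
     (if I \<inter> J = {} then axis (I \<union> J) (shuffle_sign I J * a * b) else 0) $ K" for K
  proof -
    have "ext_wedge (axis I a) (axis J b) $ K =
        (\<Sum>L\<in>Pow K. if L = I then (if K - I = J then shuffle_sign I (K - I) * a * b else 0) else 0)"
      unfolding ext_wedge_def vec_lambda_beta by (rule sum.cong) (auto simp: axis_def)
    also have "\<dots> = (if I \<subseteq> K \<and> K - I = J then shuffle_sign I J * a * b else 0)"
      by auto
    also have "\<dots> = (if I \<inter> J = {} then axis (I \<union> J) (shuffle_sign I J * a * b) else 0) $ K"
      by (auto simp: axis_def)
    finally show ?thesis .
  qed
  then show ?thesis by (simp add: vec_eq_iff)
qed

lemma scale_axis: "(k::complex) *s axis I a = axis I (k * a)"
  by (simp add: vec_eq_iff axis_def)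

lemma four_less: "(0::4) < 1" "(0::4) < 2" "(0::4)<3" "(1::4) < 2" "(1::4) < 3" "(2::4) < 3"
  by (simp_all add: less_bit0_def bit0.Rep_0 bit0.Rep_1 bit0.Rep_numeral)

lemma UNIV_4_eq: "(UNIV :: 4 set) = {0, 1, 2, 3}"
proof -
  have "(4::4) = 0" by simp
  then show ?thesis unfolding UNIV_4 by (metis insert_commute)
qed

lemma axis_UNIV: "axis {0,1,2,3} a $ (UNIV :: 4 set) = a"
  by (simp add: UNIV_4_eq)

lemma axis_ext_add: "axis (I :: 4 set) a + axis I b = axis I ((a::complex) + b)"
  by (simp add: vec_eq_iff axis_def)

lemma four_not_less: "\<not> (1::4) < 0" "\<not> (2::4) < 0" "\<not> (3::4) < 0" "\<not> (2::4) < 1" "\<not> (3::4) < 1" "\<not> (3::4) < 2"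
  using four_less by (auto dest: order.asym)

lemma ext_wedge_axisI:
  "I \<inter> J = {} \<Longrightarrow> I \<union> J = K \<Longrightarrow> shuffle_sign I J = s \<Longrightarrow> ext_wedge (axis I a) (axis J b) = axis K (s * (a * b))"
  by (simp add: ext_wedge_axis mult.assoc)

lemma ext_wedge_axis_zeroI: "I \<inter> J \<noteq> {} \<Longrightarrow> ext_wedge (axis I a) (axis J b) = 0"
  by (simp add: ext_wedge_axis)

lemma wedge_dz_dzbar:
  "ext_wedge (axis {0} a) (axis {2} b) = axis {0,2} (1 * (a * b))"
  "ext_wedge (axis {0} a) (axis {3} b) = axis {0,3} (1 * (a * b))"
  "ext_wedge (axis {1} a) (axis {2} b) = axis {1,2} (1 * (a * b))"
  "ext_wedge (axis {1} a) (axis {3} b) = axis {1,3} (1 * (a * b))"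
  by (rule ext_wedge_axisI; auto simp: shuffle_sign_prod four_less four_not_less)+

lemma herm_form_expand: "herm_form h = axis {0,2} (\<i> * h $ 1 $ 1) + axis {0,3} (\<i> * h $ 1 $ 2)
    + axis {1,2} (\<i> * h $ 2 $ 1) + axis {1,3} (\<i> * h $ 2 $ 2)"
  unfolding herm_form_def sum_2 dz_def dzbar_def
  by (simp add: wedge_dz_dzbar scale_axis vector_add_ldistrib)

text \<open>The polarisation of the determinant: \<open>mixed_det h h = 2 det h\<close>.\<close>

definition mixed_det :: "complex^2^2 \<Rightarrow> complex^2^2 \<Rightarrow> complex" where
  "mixed_det h k = h$1$1 * k$2$2 + h$2$2 * k$1$1 - h$1$2 * k$2$1 - h$2$1 * k$1$2"

lemma wedge_two_two_zero:
  "ext_wedge (axis {0,2} a) (axis {0,2} b) = 0" "ext_wedge (axis {0,2} a) (axis {0,3} b) = 0"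
  "ext_wedge (axis {0,2} a) (axis {1,2} b) = 0"
  "ext_wedge (axis {0,3} a) (axis {0,2} b) = 0" "ext_wedge (axis {0,3} a) (axis {0,3} b) = 0"
  "ext_wedge (axis {0,3} a) (axis {1,3} b) = 0"
  "ext_wedge (axis {1,2} a) (axis {0,2} b) = 0"
  "ext_wedge (axis {1,2} a) (axis {1,2} b) = 0" "ext_wedge (axis {1,2} a) (axis {1,3} b) = 0"
  "ext_wedge (axis {1,3} a) (axis {0,3} b) = 0"
  "ext_wedge (axis {1,3} a) (axis {1,2} b) = 0" "ext_wedge (axis {1,3} a) (axis {1,3} b) = 0"
  by (rule ext_wedge_axis_zeroI; simp)+

lemma wedge_two_two:
  "ext_wedge (axis {0,2} a) (axis {1,3} b) = axis {0,1,2,3} (-1 * (a * b))"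
  "ext_wedge (axis {0,3} a) (axis {1,2} b) = axis {0,1,2,3} (1 * (a * b))"
  "ext_wedge (axis {1,2} a) (axis {0,3} b) = axis {0,1,2,3} (1 * (a * b))"
  "ext_wedge (axis {1,3} a) (axis {0,2} b) = axis {0,1,2,3} (-1 * (a * b))"
  by (rule ext_wedge_axisI; auto simp: shuffle_sign_prod four_less four_not_less)+

lemma wedge_one_two_zero:
  "ext_wedge (axis {0} a) (axis {0,2} b) = 0" "ext_wedge (axis {0} a) (axis {0,3} b) = 0"
  "ext_wedge (axis {1} a) (axis {1,2} b) = 0" "ext_wedge (axis {1} a) (axis {1,3} b) = 0"
  "ext_wedge (axis {2} a) (axis {0,2} b) = 0" "ext_wedge (axis {2} a) (axis {1,2} b) = 0"
  "ext_wedge (axis {3} a) (axis {0,3} b) = 0" "ext_wedge (axis {3} a) (axis {1,3} b) = 0"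
  by (rule ext_wedge_axis_zeroI; simp)+

lemma wedge_one_two:
  "ext_wedge (axis {0} a) (axis {1,2} b) = axis {0,1,2} (1 * (a * b))"
  "ext_wedge (axis {0} a) (axis {1,3} b) = axis {0,1,3} (1 * (a * b))"
  "ext_wedge (axis {1} a) (axis {0,2} b) = axis {0,1,2} (-1 * (a * b))"
  "ext_wedge (axis {1} a) (axis {0,3} b) = axis {0,1,3} (-1 * (a * b))"
  "ext_wedge (axis {2} a) (axis {0,3} b) = axis {0,2,3} (-1 * (a * b))"
  "ext_wedge (axis {2} a) (axis {1,3} b) = axis {1,2,3} (-1 * (a * b))"
  "ext_wedge (axis {3} a) (axis {0,2} b) = axis {0,2,3} (1 * (a * b))"
  "ext_wedge (axis {3} a) (axis {1,2} b) = axis {1,2,3} (1 * (a * b))"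
  by (rule ext_wedge_axisI; auto simp: shuffle_sign_prod four_less four_not_less)+

lemma wedge_three_one_zero:
  "ext_wedge (axis {0,1,2} a) (axis {2} b) = 0" "ext_wedge (axis {0,1,3} a) (axis {3} b) = 0"
  "ext_wedge (axis {0,2,3} a) (axis {0} b) = 0" "ext_wedge (axis {1,2,3} a) (axis {1} b) = 0"
  by (rule ext_wedge_axis_zeroI; simp)+

lemma wedge_three_one:
  "ext_wedge (axis {0,1,2} a) (axis {3} b) = axis {0,1,2,3} (1 * (a * b))"
  "ext_wedge (axis {0,1,3} a) (axis {2} b) = axis {0,1,2,3} (-1 * (a * b))"
  "ext_wedge (axis {0,2,3} a) (axis {1} b) = axis {0,1,2,3} (1 * (a * b))"
  "ext_wedge (axis {1,2,3} a) (axis {0} b) = axis {0,1,2,3} (-1 * (a * b))"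
  by (rule ext_wedge_axisI; auto simp: shuffle_sign_prod four_less four_not_less)+

lemmas wedge_simps = ext_wedge_add_left ext_wedge_add_right ext_wedge_0_left ext_wedge_0_right
  wedge_dz_dzbar wedge_two_two_zero wedge_two_two wedge_one_two_zero wedge_one_two
  wedge_three_one_zero wedge_three_one

text \<open>In the diagonal terms the factor \<open>\<i>\<^sup>2 = -1\<close> of the two forms cancels the sign that sorts \<open>dz\<^sup>1 d\<zeta>\<^sup>1 dz\<^sup>2 d\<zeta>\<^sup>2\<close>, where \<open>\<zeta>\<^sup>i\<close> stands for
  the conjugate of \<open>z\<^sup>i\<close>, into \<open>dz\<^sup>1 dz\<^sup>2 d\<zeta>\<^sup>1 d\<zeta>\<^sup>2\<close>.\<close>

lemma top_herm_wedge_herm: "ext_wedge (herm_form h) (herm_form k) $ UNIV = mixed_det h k"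
  by (simp add: herm_form_expand wedge_simps axis_UNIV mixed_det_def algebra_simps)

text \<open>For \<open>H k = \<partial>\<^sub>k G\<close> the differences \<open>H 1 $ 2 $ l - H 2 $ 1 $ l\<close> are, up to the factor \<open>\<i>\<close>, the coefficients of
  \<open>\<partial>\<omega>\<close>, the torsion of the metric \<open>G\<close>. They are paired here with a form of type \<open>(0,1)\<close>.\<close>

definition torsion_pairing :: "(2 \<Rightarrow> complex^2^2) \<Rightarrow> (2 \<Rightarrow> complex) \<Rightarrow> complex" where
  "torsion_pairing H b = \<i> * ((H 1 $ 2 $ 1 - H 2 $ 1 $ 1) * b 2 - (H 1 $ 2 $ 2 - H 2 $ 1 $ 2) * b 1)"

definition torsion_pairing_bar :: "(2 \<Rightarrow> complex^2^2) \<Rightarrow> (2 \<Rightarrow> complex) \<Rightarrow> complex" where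
  "torsion_pairing_bar H b = - \<i> * ((H 1 $ 1 $ 2 - H 2 $ 1 $ 1) * b 2 - (H 1 $ 2 $ 2 - H 2 $ 2 $ 1) * b 1)"

lemma top_torsion_pairing:
  "ext_wedge (\<Sum>k\<in>UNIV. ext_wedge (dz k) (herm_form (H k))) (\<Sum>j\<in>UNIV. b j *s dzbar j) $ UNIV = torsion_pairing H b"
  unfolding sum_2 dz_def dzbar_def
  by (simp add: herm_form_expand wedge_simps axis_UNIV torsion_pairing_def scale_axis algebra_simps)

lemma top_torsion_pairing_bar:
  "ext_wedge (\<Sum>k\<in>UNIV. ext_wedge (dzbar k) (herm_form (H k))) (\<Sum>j\<in>UNIV. b j *s dz j) $ UNIV = torsion_pairing_bar H b"
  unfolding sum_2 dz_def dzbar_def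
  by (simp add: herm_form_expand wedge_simps axis_UNIV torsion_pairing_bar_def scale_axis algebra_simps)

section \<open>The differential forms in a chart\<close>

definition chart_fun :: "'a chart \<Rightarrow> ('a \<Rightarrow> real) \<Rightarrow> complex^2 \<Rightarrow> complex" where
  "chart_fun c f z = complex_of_real (f (cinv c z))"

definition hess :: "(complex^2 \<Rightarrow> complex) \<Rightarrow> complex^2 \<Rightarrow> complex^2^2" where
  "hess u z = (\<chi> i j. dw i (dwb j u) z)"

definition matrix_wirtinger :: "complex \<Rightarrow> (complex^2 \<Rightarrow> complex^2^2) \<Rightarrow> complex^2 \<Rightarrow> 2 \<Rightarrow> complex^2^2" where
  "matrix_wirtinger s G z k = (\<chi> a b. wirtinger s k (\<lambda>z. G z $ a $ b) z)"

lemma herm_form_add: "herm_form (h + k) = herm_form h + herm_form k"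
  by (simp add: herm_form_expand distrib_left flip: axis_ext_add)

lemma herm_form_lincomb: "herm_form h = (\<Sum>p\<in>UNIV. h $ fst p $ snd p *s (\<i> *s ext_wedge (dz (fst p)) (dzbar (snd p))))"
  unfolding herm_form_def
  by (simp add: sum.cartesian_product case_prod_unfold vec_eq_iff sum_distrib_left mult_ac flip: UNIV_Times_UNIV)

lemma pd_herm_form:
  assumes "\<And>a b. (\<lambda>z. G z $ a $ b) differentiable at z"
  shows "pd k (\<lambda>z. herm_form (G z)) z = herm_form (matrix_wirtinger (- \<i>) G z k)"
    and "pdbar k (\<lambda>z. herm_form (G z)) z = herm_form (matrix_wirtinger \<i> G z k)"
  unfolding herm_form_lincomb using assms
  by (subst pd_lincomb; simp add: matrix_wirtinger_def)+

context
  fixes A :: "'a::t2_space chart set" and c :: "'a chart"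
  assumes op: "open (cimg c)"
begin

lemma fun_form_expand: "fun_form f c = (\<lambda>z. chart_fun c f z *s axis {} 1)"
  by (auto simp: fun_form_def chart_fun_def scale_axis)

lemma wedge_dz_one: "ext_wedge (dz i) (axis {} 1) = dz i" "ext_wedge (dzbar i) (axis {} 1) = dzbar i"
  by (simp_all add: dz_def dzbar_def ext_wedge_axis shuffle_sign_prod)

lemma del_fun_form:
  assumes "chart_fun c f differentiable at z"
  shows "del (fun_form f) c z = (\<Sum>j\<in>UNIV. dw j (chart_fun c f) z *s dz j)"
    and "delbar (fun_form f) c z = (\<Sum>j\<in>UNIV. dwb j (chart_fun c f) z *s dzbar j)"
  using assms
  by (simp_all add: del_def delbar_def fun_form_expand[of f] pd_smult ext_wedge_scale_right wedge_dz_one)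

text \<open>Applied to \<open>f\<close>, the operator \<open>\<i>\<partial>\<close> after its conjugate gives the form whose matrix is the complex Hessian.\<close>

lemma omega_phi_eq:
  assumes f: "smooth_on (cimg c) (chart_fun c f)" and z: "z \<in> cimg c"
  shows "omega_phi g f c z = herm_form (g c z + hess (chart_fun c f) z)"
proof -
  let ?u = "chart_fun c f"
  have e: "delbar (fun_form f) c y = (\<Sum>j\<in>UNIV. dwb j ?u y *s dzbar j)" if "y \<in> cimg c" for y
    using smooth_on_imp_differentiable[OF f op that] by (rule del_fun_form)
  have 1: "pd i (delbar (fun_form f) c) z = pd i (\<lambda>y. \<Sum>j\<in>UNIV. dwb j ?u y *s dzbar j) z" for i
    by (rule pd_cong[OF op z e])
  have 2: "pd i (\<lambda>y. \<Sum>j\<in>UNIV. dwb j ?u y *s dzbar j) z = (\<Sum>j\<in>UNIV. dw i (dwb j ?u) z *s dzbar j)" for i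
    using smooth_on_imp_differentiable[OF smooth_on_wirtinger[OF f op] op z] by (intro pd_lincomb) auto
  have "\<i> *s del (delbar (fun_form f)) c z = herm_form (hess ?u z)"
    unfolding del_def herm_form_def by (simp add: ext_wedge_sum_right ext_wedge_scale_right hess_def 1 2)
  then show ?thesis
    by (simp add: omega_phi_def omega_def form_scale_def herm_form_add)
qed

lemma del_omega:
  assumes "smooth_on (cimg c) (g c)" "z \<in> cimg c"
  shows "del (omega g) c z = (\<Sum>k\<in>UNIV. ext_wedge (dz k) (herm_form (matrix_wirtinger (- \<i>) (g c) z k)))"
    and "delbar (omega g) c z = (\<Sum>k\<in>UNIV. ext_wedge (dzbar k) (herm_form (matrix_wirtinger \<i> (g c) z k)))"
proof -
  have "(\<lambda>z. g c z $ a $ b) differentiable at z" for a b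
    using assms op by (intro smooth_on_imp_differentiable[of "cimg c"] smooth_on_nth)
  then show "del (omega g) c z = (\<Sum>k\<in>UNIV. ext_wedge (dz k) (herm_form (matrix_wirtinger (- \<i>) (g c) z k)))"
    "delbar (omega g) c z = (\<Sum>k\<in>UNIV. ext_wedge (dzbar k) (herm_form (matrix_wirtinger \<i> (g c) z k)))"
    by (simp_all add: del_def delbar_def omega_def pd_herm_form)
qed

lemma top_density_del_omega:
  assumes "smooth_on (cimg c) (g c)" "smooth_on (cimg c) (chart_fun c b)" "z \<in> cimg c"
  shows "ext_wedge (del (omega g) c z) (delbar (fun_form b) c z) $ UNIV
      = torsion_pairing (matrix_wirtinger (- \<i>) (g c) z) (\<lambda>j. dwb j (chart_fun c b) z)"
    and "ext_wedge (delbar (omega g) c z) (del (fun_form b) c z) $ UNIV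
      = torsion_pairing_bar (matrix_wirtinger \<i> (g c) z) (\<lambda>j. dw j (chart_fun c b) z)"
  using smooth_on_imp_differentiable[OF assms(2) op assms(3)]
  by (simp_all add: del_omega[where g = g, OF assms(1,3)] del_fun_form top_torsion_pairing top_torsion_pairing_bar)

end

section \<open>Integrals of compactly supported functions\<close>

lemma set_integrable_compact_support:
  fixes f :: "'a::euclidean_space \<Rightarrow> 'b::{banach, second_countable_topology}"
  assumes "continuous_on U f" "compact K" "K \<subseteq> U" "\<And>z. z \<in> U - K \<Longrightarrow> f z = 0"
  shows "set_integrable lborel U f"
proof -
  have "(\<lambda>z. indicator U z *\<^sub>R f z) = (\<lambda>z. indicator K z *\<^sub>R f z)"
    using assms(3,4) by (fastforce simp: indicator_def)
  then show ?thesis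
    unfolding set_integrable_def
    using borel_integrable_compact[OF assms(2) continuous_on_subset[OF assms(1,3)]] by simp
qed

lemma smooth_on_extend_zero:
  assumes "smooth_on U f" "open U" "compact K" "K \<subseteq> U" "\<And>z. z \<in> U - K \<Longrightarrow> f z = 0"
  shows "smooth_on UNIV (\<lambda>z. if z \<in> U then f z else 0)"
proof (rule smooth_on_local)
  fix z
  show "\<exists>W. open W \<and> z \<in> W \<and> smooth_on (W \<inter> UNIV) (\<lambda>z. if z \<in> U then f z else 0)"
  proof (cases "z \<in> U")
    case True
    then show ?thesis using assms(1,2)
      by (intro exI[of _ U]) (auto intro: smooth_on_cong[OF assms(1)])
  next
    case False
    then have "z \<in> - K" "open (- K)" using assms(3,4) compact_imp_closed by auto
    then show ?thesis using assms(5)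
      by (intro exI[of _ "- K"]) (auto intro: smooth_on_cong[OF smooth_on_const[of _ 0]])
  qed
qed

text \<open>Translation invariance: the difference quotients in the direction \<open>v\<close> have integral zero, they converge
  to the derivative, and by the mean value theorem they are bounded by a multiple of the indicator of a ball.\<close>

lemma integral_directional_derivative_zero:
  fixes f :: "'a::euclidean_space \<Rightarrow> 'b::euclidean_space"
  assumes f: "smooth_on UNIV f" and K: "compact K" "\<And>z. z \<notin> K \<Longrightarrow> f z = 0"
  shows "(LINT z|lborel. frechet_derivative f (at z) v) = 0"
proof -
  let ?D = "\<lambda>z. frechet_derivative f (at z) v"
  have df: "(f has_derivative frechet_derivative f (at z)) (at z)" for z
    using smooth_on_has_derivative[OF f] by auto
  have cf: "continuous_on UNIV f" by (rule smooth_on_imp_continuous_on[OF f])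
  have cD: "continuous_on UNIV ?D"
    by (rule smooth_on_imp_continuous_on[OF smooth_on_frechet_derivative[OF f open_UNIV]])
  have D0: "?D z = 0" if "z \<notin> K" for z
  proof -
    have "?D z = frechet_derivative (\<lambda>_. 0) (at z) v"
      by (rule arg_cong[where f = "\<lambda>L. L v"], rule frechet_derivative_cong_open[of "- K"])
         (use K that compact_imp_closed in auto)
    then show ?thesis by simp
  qed
  have bf: "f \<in> borel_measurable borel" using cf by (rule borel_measurable_continuous_onI)
  have bD: "?D \<in> borel_measurable borel" using cD by (rule borel_measurable_continuous_onI)
  have int_f: "integrable lborel f"
    using set_integrable_compact_support[OF cf K(1)] K(2) by (auto simp: set_integrable_def)
  obtain M where M: "\<And>z. norm (?D z) \<le> M"
  proof -
    have "bounded (?D ` K)"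
      using K(1) cD by (intro compact_imp_bounded compact_continuous_image) (auto intro: continuous_on_subset)
    then obtain M where M: "M > 0" "\<And>z. z \<in> K \<Longrightarrow> norm (?D z) \<le> M"
      unfolding bounded_pos by blast
    show thesis
      by (rule that[of M]) (metis D0 M less_imp_le norm_zero)
  qed
  obtain R where R: "\<And>z. z \<in> K \<Longrightarrow> norm z \<le> R"
    using compact_imp_bounded[OF K(1)] unfolding bounded_iff by blast
  define h where "h = (\<lambda>n z. (real (Suc n)) *\<^sub>R (f (z + (1 / real (Suc n)) *\<^sub>R v) - f z))"
  have line: "((\<lambda>s. f (z + s *\<^sub>R v)) has_vector_derivative ?D (z + s *\<^sub>R v)) (at s)" for z s
  proof -
    have "((\<lambda>s. f (z + s *\<^sub>R v)) has_derivative (\<lambda>k. frechet_derivative f (at (z + s *\<^sub>R v)) (k *\<^sub>R v))) (at s)"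
      by (rule has_derivative_compose[of "\<lambda>s. z + s *\<^sub>R v" "\<lambda>k. k *\<^sub>R v" _ _ f, OF _ df])
         (auto intro!: derivative_eq_intros)
    then show ?thesis
      by (simp add: has_vector_derivative_def linear_scale[OF has_derivative_linear[OF df]])
  qed
  have "(\<lambda>n. integral\<^sup>L lborel (h n)) \<longlonglongrightarrow> integral\<^sup>L lborel ?D"
  proof (rule integral_dominated_convergence)
    show "integrable lborel (\<lambda>z. indicator (cball 0 (R + norm v)) z *\<^sub>R M)"
      by (rule borel_integrable_compact) auto
    show "AE z in lborel. (\<lambda>n. h n z) \<longlonglongrightarrow> ?D z"
    proof (rule AE_I2)
      fix z
      have "((\<lambda>k. norm (f (z + k *\<^sub>R v) - f z - k *\<^sub>R ?D z) / norm k) \<longlongrightarrow> 0) (at 0)"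
        using line[of z 0] by (simp add: has_vector_derivative_def has_derivative_at)
      moreover have "filterlim (\<lambda>n. 1 / real (Suc n)) (at 0) sequentially"
        by (simp only: filterlim_at) (use LIMSEQ_Suc[OF lim_1_over_n] in auto)
      ultimately have "(\<lambda>n. norm (f (z + (1 / real (Suc n)) *\<^sub>R v) - f z - (1 / real (Suc n)) *\<^sub>R ?D z)
          / norm (1 / real (Suc n))) \<longlonglongrightarrow> 0"
        by (rule filterlim_compose)
      moreover have "norm (f (z + (1 / real (Suc n)) *\<^sub>R v) - f z - (1 / real (Suc n)) *\<^sub>R ?D z)
          / norm (1 / real (Suc n)) = norm (h n z - ?D z)" for n
      proof -
        have "h n z - ?D z = real (Suc n) *\<^sub>R (f (z + (1 / real (Suc n)) *\<^sub>R v) - f z - (1 / real (Suc n)) *\<^sub>R ?D z)"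
          by (simp add: h_def scaleR_diff_right)
        then show ?thesis by (simp only: norm_scaleR) simp
      qed
      ultimately have "(\<lambda>n. norm (h n z - ?D z)) \<longlonglongrightarrow> 0" by simp
      then show "(\<lambda>n. h n z) \<longlonglongrightarrow> ?D z"
        by (rule LIM_zero_cancel[OF tendsto_norm_zero_cancel])
    qed
    show "AE z in lborel. norm (h n z) \<le> indicator (cball 0 (R + norm v)) z *\<^sub>R M" for n
    proof (rule AE_I2)
      fix z
      have nv: "norm ((1 / real (Suc n)) *\<^sub>R v) \<le> norm v"
        by (simp add: divide_le_eq mult_le_cancel_left1)
      show "norm (h n z) \<le> indicator (cball 0 (R + norm v)) z *\<^sub>R M"
      proof (cases "norm z \<le> R + norm v")
        case True
        have "norm (f (z + (1 / real (Suc n)) *\<^sub>R v) - f (z + 0 *\<^sub>R v)) \<le> M * (1 / real (Suc n)) - M * 0"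
        proof (rule differentiable_bound_general[where f = "\<lambda>s. f (z + s *\<^sub>R v)" and \<phi> = "\<lambda>s. M * s"
              and f' = "\<lambda>s. ?D (z + s *\<^sub>R v)" and \<phi>' = "\<lambda>s. M"])
          show "continuous_on {0..1 / real (Suc n)} (\<lambda>s. f (z + s *\<^sub>R v))"
            by (intro continuous_on_compose2[OF cf]) (auto intro!: continuous_intros)
        qed (use line M in \<open>auto intro!: continuous_intros derivative_eq_intros
              simp: has_real_derivative_iff_has_vector_derivative[symmetric]\<close>)
        then have "real (Suc n) * norm (f (z + (1 / real (Suc n)) *\<^sub>R v) - f z) \<le> real (Suc n) * (M * (1 / real (Suc n)))"
          by (intro mult_left_mono) auto
        then have "norm (h n z) \<le> M"
          unfolding h_def norm_scaleR by simp
        then show ?thesis using True by simp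
      next
        case False
        then have "z \<notin> K" using R[of z] norm_ge_zero[of v] by linarith
        moreover have "z + (1 / real (Suc n)) *\<^sub>R v \<notin> K"
        proof
          assume "z + (1 / real (Suc n)) *\<^sub>R v \<in> K"
          from R[OF this] have "norm z \<le> R + norm ((1 / real (Suc n)) *\<^sub>R v)"
            using norm_triangle_ineq4[of "z + (1 / real (Suc n)) *\<^sub>R v" "(1 / real (Suc n)) *\<^sub>R v"] by simp
          then show False using False nv by linarith
        qed
        ultimately show ?thesis using K(2) False by (simp add: h_def)
      qed
    qed
    show "?D \<in> borel_measurable lborel" using bD by simp
    show "h n \<in> borel_measurable lborel" for n
      unfolding h_def using bf by simp
  qed
  moreover have "integral\<^sup>L lborel (h n) = 0" for n
  proof -
    let ?w = "(1 / real (Suc n)) *\<^sub>R v"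
    have shift: "lborel = distr lborel borel (\<lambda>z. z + ?w)"
    proof -
      have "(+) ?w = (\<lambda>z. z + ?w)" by (rule ext) (rule add.commute)
      then show ?thesis using lborel_distr_plus[of ?w] by metis
    qed
    have "integrable (distr lborel borel (\<lambda>z. z + ?w)) f"
      using int_f shift by simp
    then have i: "integrable lborel (\<lambda>z. f (z + ?w))"
      using bf by (subst (asm) integrable_distr_eq) auto
    have "(LINT z|lborel. f (z + ?w)) = (LINT z|distr lborel borel (\<lambda>z. z + ?w). f z)"
      using bf by (subst integral_distr) auto
    also have "\<dots> = (LINT z|lborel. f z)" using shift by simp
    finally show ?thesis
      unfolding h_def using i int_f by simp
  qed
  ultimately show ?thesis
    by (simp add: LIMSEQ_const_iff)
qed

lemma integral_wirtinger_zero: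
  assumes f: "smooth_on U f" and U: "open U" and K: "compact K" "K \<subseteq> U" "\<And>z. z \<in> U - K \<Longrightarrow> f z = 0"
  shows "(LINT z:U|lborel. wirtinger s i f z) = 0"
proof -
  let ?f = "\<lambda>z. if z \<in> U then f z else 0"
  have sm: "smooth_on UNIV ?f" by (rule smooth_on_extend_zero[OF f U K])
  have 0: "frechet_derivative ?f (at z) v = 0" if "z \<notin> K" for z v
  proof -
    have "frechet_derivative ?f (at z) = frechet_derivative (\<lambda>_. 0) (at z)"
      by (rule frechet_derivative_cong_open[of "- K"]) (use K that compact_imp_closed in auto)
    then show ?thesis by simp
  qed
  have e: "indicator U z *\<^sub>R wirtinger s i f z
     = (1/2) * (frechet_derivative ?f (at z) (axis i 1) + s * frechet_derivative ?f (at z) (axis i \<i>))" for z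
  proof (cases "z \<in> U")
    case True
    have "frechet_derivative ?f (at z) = frechet_derivative f (at z)"
      by (rule frechet_derivative_cong_open[OF U True]) auto
    then show ?thesis using True by (simp add: wirtinger_def)
  next
    case False
    then have "z \<notin> K" using K(2) by auto
    then show ?thesis using False by (simp add: 0)
  qed
  have int: "integrable lborel (\<lambda>z. frechet_derivative ?f (at z) v)" for v
    using set_integrable_compact_support[of UNIV "\<lambda>z. frechet_derivative ?f (at z) v" K] K(1) 0
      smooth_on_imp_continuous_on[OF smooth_on_frechet_derivative[OF sm open_UNIV, of v]]
    by (auto simp: set_integrable_def)
  have z: "(LINT z|lborel. frechet_derivative ?f (at z) v) = 0" for v
    by (rule integral_directional_derivative_zero[OF sm K(1)]) (use K in auto)
  show ?thesis
    unfolding set_lebesgue_integral_def e using int z by simp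
qed

section \<open>Holomorphic change of variables\<close>

text \<open>A permutation of the coordinates maps boxes to boxes of the same volume.\<close>

lemma lborel_eq_distr_coordinates:
  fixes T :: "'a::euclidean_space \<Rightarrow> 'b::euclidean_space" and \<sigma> :: "'b \<Rightarrow> 'a"
  assumes \<sigma>: "bij_betw \<sigma> Basis Basis" and T: "\<And>x b. b \<in> Basis \<Longrightarrow> T x \<bullet> b = x \<bullet> \<sigma> b"
    and meas: "T \<in> borel_measurable borel"
  shows "lborel = distr lborel borel T"
proof (rule lborel_eqI)
  fix l u :: 'b assume lu: "\<And>b. b \<in> Basis \<Longrightarrow> l \<bullet> b \<le> u \<bullet> b"
  define \<tau> where "\<tau> = inv_into Basis \<sigma>"
  have \<tau>: "\<And>a. a \<in> Basis \<Longrightarrow> \<tau> a \<in> Basis" "\<And>b. b \<in> Basis \<Longrightarrow> \<tau> (\<sigma> b) = b" "\<And>b. b \<in> Basis \<Longrightarrow> \<sigma> b \<in> Basis"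
    "\<And>a. a \<in> Basis \<Longrightarrow> \<sigma> (\<tau> a) = a"
    using \<sigma> unfolding \<tau>_def bij_betw_def
    by (auto simp: inv_into_into f_inv_into_f)
  define lift where "lift = (\<lambda>w::'b. \<Sum>a\<in>Basis. (w \<bullet> \<tau> a) *\<^sub>R (a::'a))"
  have lift: "lift w \<bullet> a = w \<bullet> \<tau> a" if "a \<in> Basis" for w a
    using that by (simp add: lift_def)
  have pre: "T -` box l u = box (lift l) (lift u)"
    using T \<tau> lift by (auto simp: box_def) (metis+)
  have "emeasure (distr lborel borel T) (box l u) = emeasure lborel (box (lift l) (lift u))"
    using meas by (simp add: emeasure_distr pre)
  also have "\<dots> = (\<Prod>a\<in>Basis. (lift u - lift l) \<bullet> a)"
    using lu \<tau> lift by (subst emeasure_lborel_box) auto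
  also have "(\<Prod>a\<in>Basis. (lift u - lift l) \<bullet> a) = (\<Prod>b\<in>Basis. (u - l) \<bullet> b)"
    by (rule prod.reindex_bij_betw[OF \<sigma>, symmetric, THEN trans])
       (use \<tau> lift in \<open>auto simp: inner_diff_left intro!: prod.cong\<close>)
  finally show "emeasure (distr lborel borel T) (box l u) = (\<Prod>b\<in>Basis. (u - l) \<bullet> b)" .
qed simp

text \<open>The coordinates in which the change of variables formula, which is stated for \<open>\<real>\<^sup>n\<close>, is applied.\<close>

definition to_real4 :: "complex^2 \<Rightarrow> real^4" where
  "to_real4 z = (\<chi> i. if i = 1 then Re (z$1) else if i = 2 then Im (z$1) else if i = 3 then Re (z$2) else Im (z$2))"

definition of_real4 :: "real^4 \<Rightarrow> complex^2" where
  "of_real4 x = (\<chi> k. if k = 1 then Complex (x$1) (x$2) else Complex (x$3) (x$4))"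

lemma to_of_real4 [simp]: "to_real4 (of_real4 x) = x" "of_real4 (to_real4 z) = z"
  by (simp_all add: to_real4_def of_real4_def vec_eq_iff forall_4 forall_2)

lemma bounded_linear_real4: "bounded_linear to_real4" "bounded_linear of_real4"
  by (auto intro!: linear_conv_bounded_linear[THEN iffD1] linearI
      simp: to_real4_def of_real4_def vec_eq_iff forall_4 forall_2 complex_eq_iff algebra_simps)

lemma lborel_eq_distr_of_real4: "lborel = distr lborel borel of_real4"
proof (rule lborel_eq_distr_coordinates[where \<sigma> = to_real4])
  have B: "(Basis :: (complex^2) set) = {axis 1 1, axis 1 \<i>, axis 2 1, axis 2 \<i>}"
    by (auto simp: Basis_vec_def Basis_complex_def UNIV_2)
  have B': "(Basis :: (real^4) set) = {axis 1 1, axis 2 1, axis 3 1, axis 4 1}"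
    by (auto simp: Basis_vec_def UNIV_4)
  have e: "to_real4 (axis 1 1) = axis 1 1" "to_real4 (axis 1 \<i>) = axis 2 1"
     "to_real4 (axis 2 1) = axis 3 1" "to_real4 (axis 2 \<i>) = axis 4 1"
    by (simp_all add: to_real4_def vec_eq_iff forall_4 axis_def)
  have "inj to_real4" by (metis injI to_of_real4(2))
  then show "bij_betw to_real4 Basis Basis"
    unfolding bij_betw_def
    by (intro conjI inj_on_subset[OF \<open>inj to_real4\<close> subset_UNIV])
       (simp only: B B' image_insert image_empty e)
  show "of_real4 x \<bullet> b = x \<bullet> to_real4 b" for x b
    by (simp add: inner_vec_def of_real4_def to_real4_def sum_4 sum_2 inner_complex_def)
  show "of_real4 \<in> borel_measurable borel"
    using bounded_linear_real4(2) by (intro borel_measurable_continuous_onI linear_continuous_on)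
qed

lemma det_4:
  "det (A::'a::comm_ring_1^4^4) =
    A$1$1 * (A$2$2 * (A$3$3 * A$4$4 - A$3$4 * A$4$3) - A$2$3 * (A$3$2 * A$4$4 - A$3$4 * A$4$2) + A$2$4 * (A$3$2 * A$4$3 - A$3$3 * A$4$2))
  - A$1$2 * (A$2$1 * (A$3$3 * A$4$4 - A$3$4 * A$4$3) - A$2$3 * (A$3$1 * A$4$4 - A$3$4 * A$4$1) + A$2$4 * (A$3$1 * A$4$3 - A$3$3 * A$4$1))
  + A$1$3 * (A$2$1 * (A$3$2 * A$4$4 - A$3$4 * A$4$2) - A$2$2 * (A$3$1 * A$4$4 - A$3$4 * A$4$1) + A$2$4 * (A$3$1 * A$4$2 - A$3$2 * A$4$1))
  - A$1$4 * (A$2$1 * (A$3$2 * A$4$3 - A$3$3 * A$4$2) - A$2$2 * (A$3$1 * A$4$3 - A$3$3 * A$4$1) + A$2$3 * (A$3$1 * A$4$2 - A$3$2 * A$4$1))"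
proof -
  have f1: "finite {2::4, 3, 4}" "1 \<notin> {2::4, 3, 4}" by auto
  have f2: "finite {3::4, 4}" "2 \<notin> {3::4, 4}" by auto
  have f3: "finite {4::4}" "3 \<notin> {4::4}" by auto
  show ?thesis
    unfolding det_def UNIV_4
    unfolding sum_over_permutations_insert[OF f1]
    unfolding sum_over_permutations_insert[OF f2]
    unfolding sum_over_permutations_insert[OF f3]
    unfolding permutes_sing
    by (simp add: sign_swap_id permutation_swap_id permutation_compose sign_compose sign_id swap_id_eq algebra_simps)
qed

definition complex_jacobian :: "(complex^2 \<Rightarrow> complex^2) \<Rightarrow> complex^2 \<Rightarrow> complex" where
  "complex_jacobian F z = pd 1 F z $ 1 * pd 2 F z $ 2 - pd 2 F z $ 1 * pd 1 F z $ 2"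

lemma holomorphic_frechet_derivative_axis:
  assumes "pdbar i F z = 0"
  shows "frechet_derivative F (at z) (axis i \<i>) = \<i> *s frechet_derivative F (at z) (axis i 1)"
    and "pd i F z = frechet_derivative F (at z) (axis i 1)"
proof -
  let ?a = "frechet_derivative F (at z) (axis i 1)" and ?b = "frechet_derivative F (at z) (axis i \<i>)"
  have "?a + \<i> *s ?b = 0"
    using assms by (auto simp: pdbar_def vec_eq_iff simp flip: add_divide_distrib)
  then have "?a $ k = - \<i> * ?b $ k" for k
    by (simp add: vec_eq_iff add_eq_0_iff2)
  then show *: "?b = \<i> *s ?a"
    by (simp add: vec_eq_iff)
  show "pd i F z = ?a"
    unfolding pd_def * by (simp add: vec_eq_iff)
qed

text \<open>The derivative is complex linear, so the real matrix is made of blocks with the columns of \<open>w\<close> and \<open>\<i>w\<close> for the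
  entries \<open>w\<close> of the complex one; expanding both determinants proves the claim.\<close>

lemma det_holomorphic_derivative:
  assumes "\<And>i. pdbar i F z = 0"
  shows "det (matrix (\<lambda>v. to_real4 (frechet_derivative F (at z) (of_real4 v)))) = (cmod (complex_jacobian F z))\<^sup>2"
proof -
  have e: "of_real4 (axis 1 1) = axis 1 1" "of_real4 (axis 2 1) = axis 1 \<i>"
     "of_real4 (axis 3 1) = axis 2 1" "of_real4 (axis 4 1) = axis 2 \<i>"
    by (simp_all add: of_real4_def vec_eq_iff forall_2 axis_def complex_eq_iff)
  show ?thesis
    unfolding det_4 complex_jacobian_def cmod_power2
    by (simp add: matrix_def e holomorphic_frechet_derivative_axis[OF assms] to_real4_def)
       (simp add: algebra_simps power2_eq_square)
qed

lemma set_integral_real4: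
  fixes f :: "complex^2 \<Rightarrow> complex"
  assumes "(\<lambda>z. indicator U z *\<^sub>R f z) \<in> borel_measurable borel"
  shows "(LINT z:U|lborel. f z) = (LINT x:of_real4 -` U|lborel. f (of_real4 x))"
proof -
  have "of_real4 \<in> borel_measurable borel"
    using bounded_linear_real4(2) by (intro borel_measurable_continuous_onI linear_continuous_on)
  then have "(LINT z|distr lborel borel of_real4. indicator U z *\<^sub>R f z)
      = (LINT x|lborel. indicator U (of_real4 x) *\<^sub>R f (of_real4 x))"
    using assms by (subst integral_distr) auto
  then show ?thesis
    unfolding set_lebesgue_integral_def lborel_eq_distr_of_real4[symmetric]
    by (simp add: indicator_def)
qed

lemma integral_holomorphic_change_of_variables:
  fixes f :: "complex^2 \<Rightarrow> complex"
  assumes U: "open U" and V: "open V" and hol: "holomorphic_map_on U \<tau>"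
    and inj: "inj_on \<tau> U" and im: "\<tau> ` U = V"
    and f: "continuous_on V f" and K: "compact K" "K \<subseteq> V" "\<And>w. w \<in> V - K \<Longrightarrow> f w = 0"
  shows "(LINT w:V|lborel. f w) = (LINT z:U|lborel. of_real ((cmod (complex_jacobian \<tau> z))\<^sup>2) * f (\<tau> z))"
proof -
  \<comment> \<open>Real coordinates on the values: the change of variables formula concerns vectors of real numbers.\<close>
  define m :: "complex \<Rightarrow> real^2" where "m = (\<lambda>c. \<chi> k. if k = 1 then Re c else Im c)"
  define m' :: "real^2 \<Rightarrow> complex" where "m' = (\<lambda>x. Complex (x$1) (x$2))"
  have m: "bounded_linear m" "bounded_linear m'"
    by (auto intro!: linear_conv_bounded_linear[THEN iffD1] linearI
        simp: m_def m'_def vec_eq_iff forall_2 complex_eq_iff)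
  have m'm: "m' (m c) = c" for c by (simp add: m_def m'_def)
  have lm: "m (r *\<^sub>R c) = r *\<^sub>R m c" for r c
    using m(1) by (simp add: linear_simps)
  have sm: "smooth_on U \<tau>" and pdb: "\<And>z i. z \<in> U \<Longrightarrow> pdbar i \<tau> z = 0"
    using hol by (auto simp: holomorphic_map_on_def)
  define J where "J = (\<lambda>z. (cmod (complex_jacobian \<tau> z))\<^sup>2)"
  let ?U = "of_real4 -` U" and ?V = "of_real4 -` V"
  let ?T = "\<lambda>x. to_real4 (\<tau> (of_real4 x))"
  let ?h = "\<lambda>x. J (of_real4 x) *\<^sub>R f (\<tau> (of_real4 x))"
  have cont4: "continuous_on S of_real4" "continuous_on S' to_real4" for S S'
    using bounded_linear_real4 by (auto intro: linear_continuous_on)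
  have oU: "open ?U"
    using U cont4(1) by (auto intro: open_vimage)
  have TU: "?T ` ?U = ?V"
  proof
    show "?T ` ?U \<subseteq> ?V" using im by auto
    show "?V \<subseteq> ?T ` ?U"
    proof
      fix x assume "x \<in> ?V"
      then obtain z where z: "z \<in> U" "of_real4 x = \<tau> z" using im by auto
      have "x = ?T (to_real4 z)" using z(2)[symmetric] by simp
      moreover have "to_real4 z \<in> ?U" using z by simp
      ultimately show "x \<in> ?T ` ?U" by (rule image_eqI)
    qed
  qed
  have injT: "inj_on ?T ?U"
    using inj by (auto simp: inj_on_def) (metis to_of_real4)
  have derT: "(?T has_derivative (\<lambda>v. to_real4 (frechet_derivative \<tau> (at (of_real4 x)) (of_real4 v)))) (at x within ?U)"
    if "x \<in> ?U" for x
    by (intro bounded_linear.has_derivative[OF bounded_linear_real4(1)]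
        has_derivative_compose[OF bounded_linear_imp_has_derivative[OF bounded_linear_real4(2)]]
        smooth_on_has_derivative[OF sm U]) (use that in auto)
  have iV: "set_integrable lborel ?V (\<lambda>x. f (of_real4 x))"
    by (rule set_integrable_compact_support[where K = "to_real4 ` K"])
       (use K in \<open>auto intro!: continuous_on_compose2[OF f cont4(1)] compact_continuous_image cont4(2) simp: image_iff\<close>,
        metis DiffI to_of_real4(1))
  then have aV: "(\<lambda>x. f (of_real4 x)) absolutely_integrable_on ?V"
    unfolding set_integrable_def by (subst integrable_completion) auto
  have aV': "(m \<circ> (\<lambda>x. f (of_real4 x))) absolutely_integrable_on ?V"
    by (rule absolutely_integrable_linear[OF aV m(1)])
  define P where "P = (\<lambda>x. \<bar>det (matrix (\<lambda>v. to_real4 (frechet_derivative \<tau> (at (of_real4 x)) (of_real4 v))))\<bar> *\<^sub>R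
       (m \<circ> (\<lambda>x. f (of_real4 x))) (?T x))"
  have PI: "P absolutely_integrable_on ?U \<and> integral ?U P = integral ?V (m \<circ> (\<lambda>x. f (of_real4 x)))"
    unfolding P_def
  proof (rule has_absolute_integral_change_of_variables[where f = "m \<circ> (\<lambda>x. f (of_real4 x))",
        OF _ derT injT, THEN iffD2])
    show "?U \<in> sets lebesgue" using oU by (simp add: borel_open sets_completionI_sets)
    show "(m \<circ> (\<lambda>x. f (of_real4 x))) absolutely_integrable_on ?T ` ?U \<and>
        integral (?T ` ?U) (m \<circ> (\<lambda>x. f (of_real4 x))) = integral ?V (m \<circ> (\<lambda>x. f (of_real4 x)))"
      unfolding TU using aV' by blast
  qed
  have PU: "P x = m (?h x)" if "x \<in> ?U" for x
    using that pdb by (simp add: P_def det_holomorphic_derivative lm J_def)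
  have PP: "set_integrable lebesgue ?U P = set_integrable lebesgue ?U (\<lambda>x. m (?h x))"
    by (rule set_integrable_cong[OF refl refl PU])
  have PP': "integral ?U P = integral ?U (\<lambda>x. m (?h x))"
    by (rule integral_cong[OF PU])
  have 1: "(\<lambda>x. m (?h x)) absolutely_integrable_on ?U"
     "integral ?U (\<lambda>x. m (?h x)) = integral ?V (m \<circ> (\<lambda>x. f (of_real4 x)))"
    using PI unfolding PP PP' by (rule conjunct1, rule conjunct2)
  have ah: "?h absolutely_integrable_on ?U"
    using absolutely_integrable_linear[OF 1(1) m(2)] by (simp add: o_def m'm)
  have "integral ?U ?h = m' (integral ?U (\<lambda>x. m (?h x)))"
    using integral_linear[OF set_lebesgue_integral_eq_integral(1)[OF 1(1)] m(2)] by (simp add: o_def m'm)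
  also have "\<dots> = m' (m (integral ?V (\<lambda>x. f (of_real4 x))))"
    unfolding 1(2) using integral_linear[OF set_lebesgue_integral_eq_integral(1)[OF aV] m(1)] by simp
  finally have 2: "integral ?U ?h = integral ?V (\<lambda>x. f (of_real4 x))" by (simp add: m'm)
  have c\<tau>: "continuous_on U \<tau>" by (rule smooth_on_imp_continuous_on[OF sm])
  have cpd: "continuous_on U (\<lambda>z. pd i \<tau> z $ k)" for i k
  proof -
    have "continuous_on U (\<lambda>z. frechet_derivative \<tau> (at z) (axis i 1) $ k)"
      by (intro smooth_on_imp_continuous_on smooth_on_nth smooth_on_frechet_derivative sm U)
    then show ?thesis using pdb by (simp add: holomorphic_frechet_derivative_axis(2) cong: continuous_on_cong)
  qed
  have cJ: "continuous_on U J"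
    unfolding J_def complex_jacobian_def by (intro continuous_intros cpd)
  have ch: "continuous_on U (\<lambda>z. J z *\<^sub>R f (\<tau> z))"
    by (intro continuous_intros cJ continuous_on_compose2[OF f c\<tau>]) (use im in auto)
  have mh: "(\<lambda>x. indicator ?U x *\<^sub>R ?h x) \<in> borel_measurable borel"
    using oU by (intro borel_measurable_continuous_on_indicator continuous_on_compose2[OF ch cont4(1)]) auto
  have "(LINT x:?U|lborel. ?h x) = integral ?U ?h"
    using set_lebesgue_integral_eq_integral(2)[OF ah] mh
    unfolding set_lebesgue_integral_def by (subst (asm) integral_completion) auto
  moreover have "(LINT x:?V|lborel. f (of_real4 x)) = integral ?V (\<lambda>x. f (of_real4 x))"
    by (rule set_borel_integral_eq_integral(2)[OF iV])
  moreover have "(LINT w:V|lborel. f w) = (LINT x:?V|lborel. f (of_real4 x))"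
    using V f by (intro set_integral_real4 borel_measurable_continuous_on_indicator) auto
  moreover have "(LINT z:U|lborel. J z *\<^sub>R f (\<tau> z)) = (LINT x:?U|lborel. ?h x)"
    using U ch by (intro set_integral_real4[where f = "\<lambda>z. J z *\<^sub>R f (\<tau> z)"] borel_measurable_continuous_on_indicator) auto
  ultimately show ?thesis
    using 2 by (simp add: J_def scaleR_conv_of_real)
qed

section \<open>Charts of a compact complex surface\<close>

definition overlap :: "'a chart \<Rightarrow> 'a chart \<Rightarrow> (complex^2) set" where
  "overlap c c' = cmap c ` (cdom c \<inter> cdom c')"

context
  fixes A :: "'a::t2_space chart set"
  assumes X: "compact_complex_surface A"
begin

lemma chart_props:
  assumes "c \<in> A"
  shows open_cdom: "open (cdom c)" and open_cimg: "open (cimg c)"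
    and chart_homeo: "homeomorphism (cdom c) (cimg c) (cmap c) (cinv c)"
  using X assms by (auto simp: compact_complex_surface_def)

lemma chart_exists: "\<exists>c\<in>A. x \<in> cdom c"
  using X by (auto simp: compact_complex_surface_def)

lemma cinv_cmap: "c \<in> A \<Longrightarrow> x \<in> cdom c \<Longrightarrow> cinv c (cmap c x) = x"
  using chart_homeo by (auto simp: homeomorphism_def)

lemma cmap_cinv: "c \<in> A \<Longrightarrow> z \<in> cimg c \<Longrightarrow> cmap c (cinv c z) = z"
  using chart_homeo by (auto simp: homeomorphism_def)

lemma cinv_in: "c \<in> A \<Longrightarrow> z \<in> cimg c \<Longrightarrow> cinv c z \<in> cdom c"
  using chart_homeo by (auto simp: homeomorphism_def)

lemma cmap_in: "x \<in> cdom c \<Longrightarrow> cmap c x \<in> cimg c"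
  by (auto simp: cimg_def)

lemma open_chart_image:
  assumes "c \<in> A" "open V"
  shows "open (cmap c ` (cdom c \<inter> V))"
proof -
  have "openin (top_of_set (cimg c)) (cmap c ` (cdom c \<inter> V))"
    using assms(2) by (intro homeomorphism_imp_open_map[OF chart_homeo[OF assms(1)]]) (auto simp: openin_open)
  then show ?thesis using open_cimg[OF assms(1)] openin_open_trans by blast
qed

lemma compact_chart_image:
  assumes "c \<in> A" "closed S" "S \<subseteq> cdom c"
  shows "compact (cmap c ` S)"
proof -
  have "compact S" using X assms(2) compact_Int_closed[of UNIV S] by (auto simp: compact_complex_surface_def)
  then show ?thesis
    using chart_homeo[OF assms(1)] assms(3)
    by (intro compact_continuous_image) (auto simp: homeomorphism_def intro: continuous_on_subset)
qed

lemma overlap_props: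
  assumes "c \<in> A" "c' \<in> A"
  shows open_overlap: "open (overlap c c')" and overlap_subset: "overlap c c' \<subseteq> cimg c"
    and overlap_transition: "transition c c' ` overlap c c' = overlap c' c"
    and overlap_inj: "inj_on (transition c c') (overlap c c')"
    and transition_holomorphic: "holomorphic_map_on (overlap c c') (transition c c')"
proof -
  show "open (overlap c c')"
    unfolding overlap_def by (rule open_chart_image[OF assms(1) open_cdom[OF assms(2)]])
  show "overlap c c' \<subseteq> cimg c" by (auto simp: overlap_def cimg_def)
  have t: "transition c c' (cmap c x) = cmap c' x" if "x \<in> cdom c" for x
    using that assms by (simp add: transition_def cinv_cmap)
  show "transition c c' ` overlap c c' = overlap c' c"
    unfolding overlap_def image_image using t by (auto simp: image_iff Bex_def Int_commute)
  show "inj_on (transition c c') (overlap c c')"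
  proof (rule inj_onI)
    fix z w assume "z \<in> overlap c c'" "w \<in> overlap c c'" "transition c c' z = transition c c' w"
    then obtain x y where xy: "z = cmap c x" "w = cmap c y" "x \<in> cdom c \<inter> cdom c'" "y \<in> cdom c \<inter> cdom c'"
        "cmap c' x = cmap c' y"
      using t by (auto simp: overlap_def)
    then have "x = y" using cinv_cmap[OF assms(2)] by (metis IntD2)
    then show "z = w" using xy by simp
  qed
  show "holomorphic_map_on (overlap c c') (transition c c')"
    using X assms by (auto simp: compact_complex_surface_def overlap_def)
qed

lemma overlap_cinv:
  assumes "c \<in> A" "c' \<in> A" "z \<in> overlap c c'"
  shows "cinv c' (transition c c' z) = cinv c z" "cinv c z \<in> cdom c \<inter> cdom c'"
proof -
  obtain x where x: "z = cmap c x" "x \<in> cdom c \<inter> cdom c'" using assms(3) by (auto simp: overlap_def)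
  then show "cinv c' (transition c c' z) = cinv c z" "cinv c z \<in> cdom c \<inter> cdom c'"
    using assms cinv_cmap by (auto simp: transition_def)
qed

lemma overlapI: "c \<in> A \<Longrightarrow> z \<in> cimg c \<Longrightarrow> cinv c z \<in> cdom c' \<Longrightarrow> z \<in> overlap c c'"
  unfolding overlap_def using cmap_cinv[of c z] cinv_in[of c z] by (metis IntI image_eqI)

lemma chart_fun_transition:
  "c \<in> A \<Longrightarrow> c' \<in> A \<Longrightarrow> z \<in> overlap c c' \<Longrightarrow> chart_fun c f z = chart_fun c' f (transition c c' z)"
  by (simp add: chart_fun_def overlap_cinv)

lemma smooth_chart_fun: "smooth_fun A f \<Longrightarrow> c \<in> A \<Longrightarrow> smooth_on (cimg c) (chart_fun c f)"
  unfolding chart_fun_def smooth_fun_def by (intro smooth_on_of_real) simp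

section \<open>Partitions of unity\<close>

lemma smooth_fun_add: "smooth_fun A f \<Longrightarrow> smooth_fun A h \<Longrightarrow> smooth_fun A (\<lambda>x. f x + h x)"
  unfolding smooth_fun_def by (auto intro: smooth_on_add)

lemma smooth_fun_mult: "smooth_fun A f \<Longrightarrow> smooth_fun A h \<Longrightarrow> smooth_fun A (\<lambda>x. f x * h x)"
  unfolding smooth_fun_def by (auto intro: smooth_on_mult)

lemma smooth_fun_const: "smooth_fun A (\<lambda>x. r)"
  unfolding smooth_fun_def by auto

lemma smooth_fun_sum: "(\<And>i. i \<in> I \<Longrightarrow> smooth_fun A (f i)) \<Longrightarrow> smooth_fun A (\<lambda>x. \<Sum>i\<in>I. f i x)"
  unfolding smooth_fun_def by (auto intro: smooth_on_sum)

lemma smooth_fun_inverse: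
  assumes "smooth_fun A f" "\<And>x. f x \<noteq> 0"
  shows "smooth_fun A (\<lambda>x. inverse (f x))"
  using assms open_cimg unfolding smooth_fun_def by (auto intro: smooth_on_inverse)

text \<open>In a chart around \<open>x\<close> take a flat function of \<open>r\<^sup>2 - \<parallel>z - p\<parallel>\<^sup>2\<close> and extend it by zero. The image \<open>K\<close> of the closed
  ball is compact, hence closed because the surface is a Hausdorff space, and this makes the extension smooth
  in every other chart.\<close>

lemma bump_function_exists:
  fixes x :: 'a
  obtains c b N where "c \<in> A" "smooth_fun A b" "\<And>y. 0 \<le> b y" "open N" "x \<in> N" "\<And>y. y \<in> N \<Longrightarrow> 0 < b y"
    "closure {y. b y \<noteq> 0} \<subseteq> cdom c"
proof -
  obtain c where c: "c \<in> A" "x \<in> cdom c" using chart_exists by blast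
  let ?p = "cmap c x"
  obtain r where r: "r > 0" "cball ?p r \<subseteq> cimg c"
    using open_cimg[OF c(1)] cmap_in[OF c(2)] open_contains_cball by blast
  define \<beta> where "\<beta> = (\<lambda>z. flat_exp 0 (r\<^sup>2 - (z - ?p) \<bullet> (z - ?p)))"
  define b where "b = (\<lambda>y. if y \<in> cdom c then \<beta> (cmap c y) else 0)"
  define K where "K = cinv c ` cball ?p r"
  define N where "N = cdom c \<inter> cmap c -` ball ?p r"
  have inner_eq: "(z - ?p) \<bullet> (z - ?p) = (dist ?p z)\<^sup>2" for z
    by (simp add: dist_norm norm_minus_commute power2_norm_eq_inner)
  have \<beta>_pos: "0 < \<beta> z" if "dist ?p z < r" for z
  proof -
    have "(dist ?p z)\<^sup>2 < r\<^sup>2" using that by (intro power_strict_mono) auto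
    then show ?thesis by (simp add: \<beta>_def inner_eq flat_exp_def)
  qed
  have \<beta>_0: "\<beta> z = 0" if "r \<le> dist ?p z" for z
  proof -
    have "r\<^sup>2 \<le> (dist ?p z)\<^sup>2" using that r by (intro power_mono) auto
    then show ?thesis by (simp add: \<beta>_def inner_eq flat_exp_def)
  qed
  have \<beta>_nonneg: "0 \<le> \<beta> z" for z by (simp add: \<beta>_def flat_exp_def)
  have \<beta>_smooth: "smooth_on UNIV \<beta>"
    unfolding \<beta>_def
  proof (rule smooth_on_compose[where f = "flat_exp 0" and T = UNIV])
    show "smooth_on UNIV (flat_exp 0)" using Ck_on_flat_exp by (simp add: smooth_on_open_iff)
    show "smooth_on UNIV (\<lambda>z. r\<^sup>2 - (z - ?p) \<bullet> (z - ?p))"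
      by (intro smooth_on_diff smooth_on_bilinear[OF bounded_bilinear_inner] smooth_on_const
          smooth_on_linear bounded_linear_ident)
  qed auto
  have K: "closed K" "K \<subseteq> cdom c"
  proof -
    have "compact K" unfolding K_def
      using chart_homeo[OF c(1)] r(2)
      by (intro compact_continuous_image) (auto simp: homeomorphism_def intro: continuous_on_subset)
    then show "closed K" by (rule compact_imp_closed)
    show "K \<subseteq> cdom c" using r(2) cinv_in[OF c(1)] by (auto simp: K_def)
  qed
  have b0: "b y = 0" if "y \<notin> K" for y
  proof (cases "y \<in> cdom c")
    case True
    then have "cmap c y \<notin> cball ?p r"
      using that cinv_cmap[OF c(1) True] by (metis K_def image_eqI)
    then show ?thesis using True \<beta>_0 by (simp add: b_def)
  qed (simp add: b_def)
  show thesis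
  proof (rule that[OF c(1)])
    show "smooth_fun A b" unfolding smooth_fun_def
    proof (intro ballI smooth_on_local)
      fix c' z assume c': "c' \<in> A" and z: "z \<in> cimg c'"
      show "\<exists>W. open W \<and> z \<in> W \<and> smooth_on (W \<inter> cimg c') (\<lambda>z. b (cinv c' z))"
      proof (cases "cinv c' z \<in> cdom c")
        case True
        have "smooth_on (overlap c' c) (\<lambda>z. \<beta> (transition c' c z))"
          using transition_holomorphic[OF c' c(1)] \<beta>_smooth
          by (rule_tac smooth_on_compose[where T = UNIV and f = \<beta>]) (auto simp: holomorphic_map_on_def)
        moreover have "\<beta> (transition c' c w) = b (cinv c' w)" if "w \<in> overlap c' c" for w
          using overlap_cinv[OF c' c(1) that] by (simp add: b_def transition_def)
        ultimately have "smooth_on (overlap c' c) (\<lambda>z. b (cinv c' z))"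
          by (rule smooth_on_cong)
        then have "smooth_on (overlap c' c \<inter> cimg c') (\<lambda>z. b (cinv c' z))"
          by (rule smooth_on_subset) auto
        then show ?thesis
          using open_overlap[OF c' c(1)] overlapI[OF c' z True] by blast
      next
        case False
        let ?W = "cmap c' ` (cdom c' \<inter> - K)"
        have "z \<in> ?W"
          using False K(2) cinv_in[OF c' z] cmap_cinv[OF c' z] by (intro image_eqI[of _ _ "cinv c' z"]) auto
        moreover have "open ?W" using open_chart_image[OF c'] K(1) by blast
        moreover have "b (cinv c' w) = 0" if "w \<in> ?W" for w
          using that b0 cinv_cmap[OF c'] by auto
        then have "smooth_on (?W \<inter> cimg c') (\<lambda>z. b (cinv c' z))"
          by (rule_tac smooth_on_cong[OF smooth_on_const[of _ 0]]) auto
        ultimately show ?thesis by blast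
      qed
    qed
    show "0 \<le> b y" for y by (simp add: b_def \<beta>_nonneg)
    show "open N"
      unfolding N_def using chart_homeo[OF c(1)] open_cdom[OF c(1)]
      by (intro continuous_open_preimage) (auto simp: homeomorphism_def)
    show "x \<in> N" using c r by (simp add: N_def)
    show "0 < b y" if "y \<in> N" for y using that \<beta>_pos by (auto simp: N_def b_def)
    have "{y. b y \<noteq> 0} \<subseteq> K" using b0 by auto
    then show "closure {y. b y \<noteq> 0} \<subseteq> cdom c" using K closure_minimal by blast
  qed
qed

text \<open>Finitely many of the sets on which bump functions are positive cover the surface. Divide the bump functions
  by their sum; those that come from the same chart are added up, since a partition is indexed by charts.\<close>

lemma partition_of_unity_exists: "\<exists>F \<rho>. partition_of_unity A F \<rho>"
proof -
  have "\<forall>x. \<exists>c b N. c \<in> A \<and> smooth_fun A b \<and> (\<forall>y. 0 \<le> b y) \<and> open N \<and> x \<in> N \<and> (\<forall>y\<in>N. 0 < b y) \<and>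
    closure {y. b y \<noteq> 0} \<subseteq> cdom c"
    using bump_function_exists by metis
  then obtain c b N where p: "\<And>x. c x \<in> A" "\<And>x. smooth_fun A (b x)" "\<And>x y. 0 \<le> b x y" "\<And>x. open (N x)" "\<And>x. x \<in> N x"
    "\<And>x y. y \<in> N x \<Longrightarrow> 0 < b x y" "\<And>x. closure {y. b x y \<noteq> 0} \<subseteq> cdom (c x)"
    by metis
  have "compact (UNIV :: 'a set)" using X by (simp add: compact_complex_surface_def)
  then obtain I where I: "finite I" "UNIV \<subseteq> (\<Union>x\<in>I. N x)"
    by (rule compactE_image[of UNIV UNIV N]) (use p(4,5) in auto)
  define S where "S = (\<lambda>y. \<Sum>x\<in>I. b x y)"
  have S: "0 < S y" for y
  proof -
    obtain x where "x \<in> I" "y \<in> N x" using I(2) by auto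
    then show ?thesis unfolding S_def using I(1) p by (intro sum_pos2[of I x]) auto
  qed
  define \<rho> where "\<rho> = (\<lambda>d y. (\<Sum>x\<in>{x\<in>I. c x = d}. b x y) * inverse (S y))"
  have "partition_of_unity A (c ` I) \<rho>"
    unfolding partition_of_unity_def
  proof (intro conjI ballI allI)
    show "finite (c ` I)" using I by simp
    show "c ` I \<subseteq> A" using p by auto
    fix d assume d: "d \<in> c ` I"
    show "smooth_fun A (\<rho> d)"
      unfolding \<rho>_def S_def
    proof (intro smooth_fun_mult smooth_fun_sum smooth_fun_inverse p(2))
      show "(\<Sum>x\<in>I. b x y) \<noteq> 0" for y using S[of y] by (simp add: S_def)
    qed
    show "0 \<le> \<rho> d y" for y
      unfolding \<rho>_def using S[of y] p(3) by (intro mult_nonneg_nonneg sum_nonneg) auto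
    have "{y. \<rho> d y \<noteq> 0} \<subseteq> (\<Union>x\<in>{x\<in>I. c x = d}. closure {y. b x y \<noteq> 0})"
    proof
      fix y assume "y \<in> {y. \<rho> d y \<noteq> 0}"
      then have "(\<Sum>x\<in>{x\<in>I. c x = d}. b x y) \<noteq> 0" by (auto simp: \<rho>_def)
      then obtain x where "x \<in> {x\<in>I. c x = d}" "b x y \<noteq> 0" by (meson sum.neutral)
      then show "y \<in> (\<Union>x\<in>{x\<in>I. c x = d}. closure {y. b x y \<noteq> 0})"
        using closure_subset[of "{y. b x y \<noteq> 0}"] by blast
    qed
    then have "closure {y. \<rho> d y \<noteq> 0} \<subseteq> (\<Union>x\<in>{x\<in>I. c x = d}. closure {y. b x y \<noteq> 0})"
      using I(1) by (intro closure_minimal closed_UN) auto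
    then show "closure {y. \<rho> d y \<noteq> 0} \<subseteq> cdom d" using p(7) by blast
  next
    fix y
    have "(\<Sum>d\<in>c ` I. \<rho> d y) = (\<Sum>d\<in>c ` I. \<Sum>x\<in>{x\<in>I. c x = d}. b x y) * inverse (S y)"
      by (simp add: \<rho>_def sum_distrib_right)
    also have "\<dots> = S y * inverse (S y)"
      using sum.image_gen[OF I(1), of "\<lambda>x. b x y" c] by (simp add: S_def)
    finally show "(\<Sum>d\<in>c ` I. \<rho> d y) = 1" using S[of y] by simp
  qed
  then show ?thesis by blast
qed

end

section \<open>Stokes' theorem\<close>

definition weight :: "('a chart \<Rightarrow> 'a \<Rightarrow> real) \<Rightarrow> 'a chart \<Rightarrow> complex^2 \<Rightarrow> complex" where
  "weight \<rho> c = chart_fun c (\<rho> c)"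

definition support_in_chart :: "('a::topological_space chart \<Rightarrow> 'a \<Rightarrow> real) \<Rightarrow> 'a chart \<Rightarrow> (complex^2) set" where
  "support_in_chart \<rho> c = cmap c ` closure {x. \<rho> c x \<noteq> 0}"

definition partition_integral ::
  "'a chart set \<Rightarrow> ('a chart \<Rightarrow> 'a \<Rightarrow> real) \<Rightarrow> ('a chart \<Rightarrow> complex^2 \<Rightarrow> complex) \<Rightarrow> complex" where
  "partition_integral F \<rho> d = (\<Sum>c\<in>F. LINT z:cimg c|lborel. weight \<rho> c z * d c z)"

context
  fixes A :: "'a::t2_space chart set" and F :: "'a chart set" and \<rho> :: "'a chart \<Rightarrow> 'a \<Rightarrow> real"
  assumes X: "compact_complex_surface A" and P: "partition_of_unity A F \<rho>"
begin

lemma partition_props: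
  assumes "c \<in> F"
  shows partition_chart: "c \<in> A" and partition_smooth: "smooth_fun A (\<rho> c)"
    and partition_nonneg: "0 \<le> \<rho> c x" and partition_support: "closure {x. \<rho> c x \<noteq> 0} \<subseteq> cdom c"
  using P assms by (auto simp: partition_of_unity_def)

lemma partition_finite: "finite F" and partition_sum: "(\<Sum>c\<in>F. \<rho> c x) = 1"
  using P by (auto simp: partition_of_unity_def)

lemma support_in_chart:
  assumes "c \<in> F"
  shows "compact (support_in_chart \<rho> c)" "support_in_chart \<rho> c \<subseteq> cimg c"
    "\<And>z. z \<in> cimg c - support_in_chart \<rho> c \<Longrightarrow> cinv c z \<notin> closure {x. \<rho> c x \<noteq> 0}"
proof -
  note p = partition_chart[OF assms] partition_support[OF assms]
  show "compact (support_in_chart \<rho> c)"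
    unfolding support_in_chart_def by (rule compact_chart_image[OF X p(1) closed_closure p(2)])
  show "support_in_chart \<rho> c \<subseteq> cimg c"
    unfolding support_in_chart_def using p(2) by (auto intro!: cmap_in[OF X])
  show "cinv c z \<notin> closure {x. \<rho> c x \<noteq> 0}" if "z \<in> cimg c - support_in_chart \<rho> c" for z
    using that cmap_cinv[OF X p(1), of z] unfolding support_in_chart_def by (metis DiffE image_eqI)
qed

text \<open>The complement of the closed support is open, so the function and its derivatives vanish there.\<close>

lemma chart_fun_off_support:
  assumes c: "c \<in> A" and z: "z \<in> cimg c" and off: "cinv c z \<notin> closure {x. f x \<noteq> 0}"
  shows "chart_fun c f z = 0" "wirtinger s i (chart_fun c f) z = 0"
proof -
  let ?W = "cmap c ` (cdom c \<inter> - closure {x. f x \<noteq> 0})"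
  have 0: "f x = 0" if "x \<notin> closure {x. f x \<noteq> 0}" for x
    using that closure_subset[of "{x. f x \<noteq> 0}"] by blast
  from 0[OF off] show "chart_fun c f z = 0" by (simp add: chart_fun_def)
  have "open ?W" by (rule open_chart_image[OF X c]) auto
  moreover have "z \<in> ?W"
    using off cinv_in[OF X c z] cmap_cinv[OF X c z] by (intro image_eqI[of _ _ "cinv c z"]) auto
  moreover have "chart_fun c f w = 0" if w: "w \<in> ?W" for w
  proof -
    obtain x where x: "w = cmap c x" "x \<in> cdom c \<inter> - closure {x. f x \<noteq> 0}" using w by (rule imageE)
    then have "x \<notin> closure {x. f x \<noteq> 0}" by simp
    then have fx: "f x = 0" by (rule 0)
    have "cinv c w = x" using x cinv_cmap[OF X c, of x] by simp
    then show ?thesis by (simp add: chart_fun_def fx)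
  qed
  ultimately have "wirtinger s i (chart_fun c f) z = wirtinger s i (\<lambda>_. 0) z"
    by (rule wirtinger_cong)
  then show "wirtinger s i (chart_fun c f) z = 0" by simp
qed

lemma weight_zero: "c \<in> F \<Longrightarrow> z \<in> cimg c - support_in_chart \<rho> c \<Longrightarrow> weight \<rho> c z = 0"
  unfolding weight_def using chart_fun_off_support(1)[OF partition_chart] support_in_chart(3) by blast

lemma smooth_weight: "c \<in> F \<Longrightarrow> smooth_on (cimg c) (weight \<rho> c)"
  unfolding weight_def by (intro smooth_chart_fun[OF X] partition_smooth partition_chart)

lemma set_integrable_weight:
  assumes "c \<in> F" "continuous_on (cimg c) d"
  shows "set_integrable lborel (cimg c) (\<lambda>z. weight \<rho> c z * d z)"
proof (rule set_integrable_compact_support[where K = "support_in_chart \<rho> c"])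
  show "continuous_on (cimg c) (\<lambda>z. weight \<rho> c z * d z)"
    by (intro continuous_on_mult assms(2) smooth_on_imp_continuous_on smooth_weight assms(1))
qed (use support_in_chart(1,2) assms(1) weight_zero in auto)

lemma set_integral_restrict_overlap:
  assumes "c \<in> A" "c' \<in> A" "\<And>z. z \<in> cimg c \<Longrightarrow> cinv c z \<notin> S \<Longrightarrow> q z = (0::complex)" "S \<subseteq> cdom c \<inter> cdom c'"
  shows "(LINT z:cimg c|lborel. q z) = (LINT z:overlap c c'|lborel. q z)"
proof -
  have e: "indicator (cimg c) z *\<^sub>R q z = indicator (overlap c c') z *\<^sub>R q z" for z
    using assms overlap_subset[OF X assms(1,2)] overlapI[OF X assms(1), of z c']
    by (cases "z \<in> overlap c c'"; cases "z \<in> cimg c") (auto simp: indicator_def)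
  show ?thesis by (simp only: set_lebesgue_integral_def e)
qed

text \<open>Both integrals can be restricted to the overlap of the charts, where the integrands have compact support, and
  there the transition map is a change of variables.\<close>

lemma integral_chart_exchange:
  assumes c: "c \<in> A" "c' \<in> A" and S: "closed S" "S \<subseteq> cdom c \<inter> cdom c'"
    and q': "continuous_on (cimg c') q'"
    and 0: "\<And>z. z \<in> cimg c \<Longrightarrow> cinv c z \<notin> S \<Longrightarrow> q z = (0::complex)" "\<And>z. z \<in> cimg c' \<Longrightarrow> cinv c' z \<notin> S \<Longrightarrow> q' z = (0::complex)"
    and tr: "\<And>z. z \<in> overlap c c' \<Longrightarrow> q z = of_real ((cmod (complex_jacobian (transition c c') z))\<^sup>2) * q' (transition c c' z)"
  shows "(LINT z:cimg c|lborel. q z) = (LINT z:cimg c'|lborel. q' z)"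
proof -
  have sub: "overlap c' c \<subseteq> cimg c'" by (rule overlap_subset[OF X c(2,1)])
  have "(LINT z:cimg c'|lborel. q' z) = (LINT z:overlap c' c|lborel. q' z)"
    by (rule set_integral_restrict_overlap[of c' c S q']) (use c 0 S(2) in auto)
  also have "\<dots> = (LINT z:overlap c c'|lborel. of_real ((cmod (complex_jacobian (transition c c') z))\<^sup>2) * q' (transition c c' z))"
  proof (rule integral_holomorphic_change_of_variables[where K = "cmap c' ` S"])
    show "open (overlap c c')" "open (overlap c' c)" by (auto intro: open_overlap[OF X] c)
    show "holomorphic_map_on (overlap c c') (transition c c')" by (rule transition_holomorphic[OF X c])
    show "inj_on (transition c c') (overlap c c')" by (rule overlap_inj[OF X c])
    show "transition c c' ` overlap c c' = overlap c' c" by (rule overlap_transition[OF X c])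
    show "continuous_on (overlap c' c) q'" by (rule continuous_on_subset[OF q' sub])
    show "compact (cmap c' ` S)" using S by (intro compact_chart_image[OF X c(2)]) auto
    show "cmap c' ` S \<subseteq> overlap c' c" using S(2) by (auto simp: overlap_def)
    fix w assume w: "w \<in> overlap c' c - cmap c' ` S"
    have "cinv c' w \<notin> S" using w sub cmap_cinv[OF X c(2), of w] by (metis DiffE image_eqI subsetD)
    then show "q' w = 0" using w sub 0(2) by blast
  qed
  also have "\<dots> = (LINT z:overlap c c'|lborel. q z)"
    using tr by (intro set_lebesgue_integral_cong) (simp_all add: borel_open open_overlap[OF X c])
  also have "\<dots> = (LINT z:cimg c|lborel. q z)"
    by (rule set_integral_restrict_overlap[of c c' S q, symmetric]) (use c 0 S(2) in auto)
  finally show ?thesis by simp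
qed

lemma sum_chart_fun_partition:
  assumes c: "c \<in> A" and z: "z \<in> cimg c"
  shows "(\<Sum>d\<in>F. chart_fun c (\<rho> d) z) = 1" "(\<Sum>d\<in>F. wirtinger s i (chart_fun c (\<rho> d)) z) = 0"
proof -
  have 1: "(\<Sum>d\<in>F. chart_fun c (\<rho> d) w) = 1" for w
    unfolding chart_fun_def using partition_sum[of "cinv c w"] by (metis of_real_1 of_real_sum)
  then show "(\<Sum>d\<in>F. chart_fun c (\<rho> d) z) = 1" .
  have "(\<Sum>d\<in>F. wirtinger s i (chart_fun c (\<rho> d)) z) = wirtinger s i (\<lambda>z. \<Sum>d\<in>F. chart_fun c (\<rho> d) z) z"
    by (rule wirtinger_sum[symmetric, OF partition_finite])
       (rule smooth_on_imp_differentiable[OF smooth_chart_fun[OF X partition_smooth c] open_cimg[OF X c] z])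
  then show "(\<Sum>d\<in>F. wirtinger s i (chart_fun c (\<rho> d)) z) = 0" by (simp add: 1)
qed

text \<open>Here \<open>V\<close> and \<open>W\<close> are the components of a vector density and \<open>q\<close> is its contraction with the differential
  of a function. In one chart, integration by parts moves the derivatives onto the weight: the weighted
  integral of the divergence is \<open>- \<integral> q(\<rho>\<^sub>c)\<close>. Inserting \<open>1 = \<Sum> \<rho>\<^sub>d\<close> and moving \<open>\<rho>\<^sub>d q(\<rho>\<^sub>c)\<close> from the chart \<open>c\<close> to the
  chart \<open>d\<close>, the sum over \<open>c\<close> produces \<open>q(\<Sum> \<rho>\<^sub>c) = q(1) = 0\<close>. The invariance to be checked in
  applications thus concerns an expression with first derivatives of the partition functions only.\<close>

lemma stokes:
  fixes V W :: "'a chart \<Rightarrow> 2 \<Rightarrow> complex^2 \<Rightarrow> complex"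
  defines "q \<equiv> \<lambda>c r z. \<Sum>k\<in>UNIV. V c k z * dw k r z + W c k z * dwb k r z"
  assumes V: "\<And>c k. c \<in> F \<Longrightarrow> smooth_on (cimg c) (V c k)" and W: "\<And>c k. c \<in> F \<Longrightarrow> smooth_on (cimg c) (W c k)"
    and tr: "\<And>c c' d z. c \<in> F \<Longrightarrow> c' \<in> F \<Longrightarrow> d \<in> F \<Longrightarrow> z \<in> overlap c c' \<Longrightarrow> q c (chart_fun c (\<rho> d)) z
       = of_real ((cmod (complex_jacobian (transition c c') z))\<^sup>2) * q c' (chart_fun c' (\<rho> d)) (transition c c' z)"
  shows "partition_integral F \<rho> (\<lambda>c z. \<Sum>k\<in>UNIV. dw k (V c k) z + dwb k (W c k) z) = 0"
proof -
  have sm: "smooth_on (cimg c) (chart_fun c (\<rho> d))" if "c \<in> F" "d \<in> F" for c d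
    using that by (intro smooth_chart_fun[OF X] partition_smooth partition_chart)
  have op: "open (cimg c)" if "c \<in> F" for c using open_cimg[OF X partition_chart[OF that]] .
  have cq: "continuous_on (cimg c) (q c (chart_fun c (\<rho> d)))" if "c \<in> F" "d \<in> F" for c d
    unfolding q_def using that
    by (intro smooth_on_imp_continuous_on smooth_on_sum smooth_on_add smooth_on_mult V W smooth_on_wirtinger sm op)
  have q0: "q c (chart_fun c (\<rho> d)) z = 0"
    if "c \<in> F" "d \<in> F" "z \<in> cimg c" "cinv c z \<notin> closure {x. \<rho> d x \<noteq> 0}" for c d z
    unfolding q_def using chart_fun_off_support(2)[OF partition_chart[OF that(1)] that(3,4)] by simp
  have iq: "set_integrable lborel (cimg c) (\<lambda>z. chart_fun c (\<rho> c') z * q c (weight \<rho> c) z)" if "c \<in> F" "c' \<in> F" for c c'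
  proof (rule set_integrable_compact_support[where K = "support_in_chart \<rho> c"])
    show "continuous_on (cimg c) (\<lambda>z. chart_fun c (\<rho> c') z * q c (weight \<rho> c) z)"
      unfolding weight_def by (intro continuous_on_mult smooth_on_imp_continuous_on sm that cq)
    show "chart_fun c (\<rho> c') z * q c (weight \<rho> c) z = 0" if "z \<in> cimg c - support_in_chart \<rho> c" for z
      using q0[OF \<open>c \<in> F\<close> \<open>c \<in> F\<close>] support_in_chart(3)[OF \<open>c \<in> F\<close> that] that by (simp add: weight_def)
  qed (use support_in_chart(1,2) that in auto)
  have parts: "(LINT z:cimg c|lborel. weight \<rho> c z * (\<Sum>k\<in>UNIV. dw k (V c k) z + dwb k (W c k) z))
      = - (LINT z:cimg c|lborel. q c (weight \<rho> c) z)" if c: "c \<in> F" for c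
  proof -
    have z: "(LINT z:cimg c|lborel. wirtinger s k (\<lambda>z. weight \<rho> c z * U z) z) = 0"
      and i: "set_integrable lborel (cimg c) (\<lambda>z. wirtinger s k (\<lambda>z. weight \<rho> c z * U z) z)"
      if U: "smooth_on (cimg c) U" for s k U
    proof -
      have s: "smooth_on (cimg c) (\<lambda>z. weight \<rho> c z * U z)"
        by (intro smooth_on_mult smooth_weight c U)
      show "(LINT z:cimg c|lborel. wirtinger s k (\<lambda>z. weight \<rho> c z * U z) z) = 0"
        by (rule integral_wirtinger_zero[OF s op[OF c] support_in_chart(1,2)[OF c]])
           (simp add: weight_zero[OF c])
      show "set_integrable lborel (cimg c) (\<lambda>z. wirtinger s k (\<lambda>z. weight \<rho> c z * U z) z)"
      proof (rule set_integrable_compact_support[OF smooth_on_imp_continuous_on support_in_chart(1,2)[OF c]])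
        show "smooth_on (cimg c) (wirtinger s k (\<lambda>z. weight \<rho> c z * U z))"
          by (intro smooth_on_wirtinger s op c)
        fix z assume z: "z \<in> cimg c - support_in_chart \<rho> c"
        have "wirtinger s k (\<lambda>z. weight \<rho> c z * U z) z = weight \<rho> c z * wirtinger s k U z + wirtinger s k (weight \<rho> c) z * U z"
          using z by (intro wirtinger_mult smooth_on_imp_differentiable[OF smooth_weight[OF c] op[OF c]]
              smooth_on_imp_differentiable[OF U op[OF c]]) auto
        then show "wirtinger s k (\<lambda>z. weight \<rho> c z * U z) z = 0"
          using z weight_zero[OF c] chart_fun_off_support(2)[OF partition_chart[OF c]] support_in_chart(3)[OF c z]
          by (simp add: weight_def)
      qed
    qed
    have e: "weight \<rho> c z * (\<Sum>k\<in>UNIV. dw k (V c k) z + dwb k (W c k) z)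
       = (\<Sum>k\<in>UNIV. dw k (\<lambda>z. weight \<rho> c z * V c k z) z + dwb k (\<lambda>z. weight \<rho> c z * W c k z) z) - q c (weight \<rho> c) z"
      if z: "z \<in> cimg c" for z
    proof -
      have d: "weight \<rho> c differentiable at z" "V c k differentiable at z" "W c k differentiable at z" for k
        by (rule smooth_on_imp_differentiable[OF smooth_weight[OF c] op[OF c] z]
            smooth_on_imp_differentiable[OF V[OF c] op[OF c] z] smooth_on_imp_differentiable[OF W[OF c] op[OF c] z])+
      show ?thesis
        unfolding q_def by (simp add: wirtinger_mult d sum_2 algebra_simps)
    qed
    have iqq: "set_integrable lborel (cimg c) (\<lambda>z. q c (weight \<rho> c) z)"
      by (rule set_integrable_compact_support[OF cq[OF c c, folded weight_def] support_in_chart(1,2)[OF c]])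
         (use q0[OF c c] support_in_chart(3)[OF c] in \<open>auto simp: weight_def\<close>)
    have "(LINT z:cimg c|lborel. weight \<rho> c z * (\<Sum>k\<in>UNIV. dw k (V c k) z + dwb k (W c k) z))
      = (LINT z:cimg c|lborel. (\<Sum>k\<in>UNIV. dw k (\<lambda>z. weight \<rho> c z * V c k z) z + dwb k (\<lambda>z. weight \<rho> c z * W c k z) z) - q c (weight \<rho> c) z)"
      using e op[OF c] by (intro set_lebesgue_integral_cong) auto
    also have "\<dots> = - (LINT z:cimg c|lborel. q c (weight \<rho> c) z)"
      unfolding sum_2 using i[OF V[OF c]] i[OF W[OF c]] z[OF V[OF c]] z[OF W[OF c]] iqq
      by (simp add: set_integral_add set_integral_diff)
    finally show ?thesis .
  qed
  have exch: "(LINT z:cimg c|lborel. chart_fun c (\<rho> c') z * q c (weight \<rho> c) z)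
     = (LINT z:cimg c'|lborel. weight \<rho> c' z * q c' (chart_fun c' (\<rho> c)) z)" if c: "c \<in> F" "c' \<in> F" for c c'
  proof (rule integral_chart_exchange[where S = "closure {x. \<rho> c x \<noteq> 0} \<inter> closure {x. \<rho> c' x \<noteq> 0}"])
    show "c \<in> A" "c' \<in> A" using c partition_chart by auto
    show "closed (closure {x. \<rho> c x \<noteq> 0} \<inter> closure {x. \<rho> c' x \<noteq> 0})" by auto
    show "closure {x. \<rho> c x \<noteq> 0} \<inter> closure {x. \<rho> c' x \<noteq> 0} \<subseteq> cdom c \<inter> cdom c'"
      using partition_support c by blast
    show "continuous_on (cimg c') (\<lambda>z. weight \<rho> c' z * q c' (chart_fun c' (\<rho> c)) z)"
      by (intro continuous_on_mult smooth_on_imp_continuous_on smooth_weight cq c)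
    show "chart_fun c (\<rho> c') z * q c (weight \<rho> c) z = 0"
      if "z \<in> cimg c" "cinv c z \<notin> closure {x. \<rho> c x \<noteq> 0} \<inter> closure {x. \<rho> c' x \<noteq> 0}" for z
      using that q0[OF c(1) c(1)] chart_fun_off_support(1)[OF partition_chart[OF c(1)]] by (auto simp: weight_def)
    show "weight \<rho> c' z * q c' (chart_fun c' (\<rho> c)) z = 0"
      if "z \<in> cimg c'" "cinv c' z \<notin> closure {x. \<rho> c x \<noteq> 0} \<inter> closure {x. \<rho> c' x \<noteq> 0}" for z
      using that q0[OF c(2) c(1)] chart_fun_off_support(1)[OF partition_chart[OF c(2)]] by (auto simp: weight_def)
    show "chart_fun c (\<rho> c') z * q c (weight \<rho> c) z
       = of_real ((cmod (complex_jacobian (transition c c') z))\<^sup>2)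
         * (weight \<rho> c' (transition c c' z) * q c' (chart_fun c' (\<rho> c)) (transition c c' z))" if "z \<in> overlap c c'" for z
      using tr[OF c c(1) that] chart_fun_transition[OF X partition_chart[OF c(1)] partition_chart[OF c(2)] that]
      by (simp add: weight_def)
  qed
  have "partition_integral F \<rho> (\<lambda>c z. \<Sum>k\<in>UNIV. dw k (V c k) z + dwb k (W c k) z)
     = - (\<Sum>c\<in>F. LINT z:cimg c|lborel. q c (weight \<rho> c) z)"
    unfolding partition_integral_def by (simp add: parts sum_negf)
  also have "(\<Sum>c\<in>F. LINT z:cimg c|lborel. q c (weight \<rho> c) z)
     = (\<Sum>c\<in>F. \<Sum>c'\<in>F. LINT z:cimg c|lborel. chart_fun c (\<rho> c') z * q c (weight \<rho> c) z)"
  proof (rule sum.cong[OF refl])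
    fix c assume c: "c \<in> F"
    have "(LINT z:cimg c|lborel. q c (weight \<rho> c) z) = (LINT z:cimg c|lborel. \<Sum>c'\<in>F. chart_fun c (\<rho> c') z * q c (weight \<rho> c) z)"
      using sum_chart_fun_partition(1)[OF partition_chart[OF c]] op[OF c]
      by (intro set_lebesgue_integral_cong) (auto simp flip: sum_distrib_right)
    also have "\<dots> = (\<Sum>c'\<in>F. LINT z:cimg c|lborel. chart_fun c (\<rho> c') z * q c (weight \<rho> c) z)"
      unfolding set_lebesgue_integral_def scaleR_sum_right
      by (rule Bochner_Integration.integral_sum) (use iq[OF c] in \<open>simp add: set_integrable_def\<close>)
    finally show "(LINT z:cimg c|lborel. q c (weight \<rho> c) z)
       = (\<Sum>c'\<in>F. LINT z:cimg c|lborel. chart_fun c (\<rho> c') z * q c (weight \<rho> c) z)" .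
  qed
  also have "\<dots> = (\<Sum>c'\<in>F. \<Sum>c\<in>F. LINT z:cimg c'|lborel. weight \<rho> c' z * q c' (chart_fun c' (\<rho> c)) z)"
    by (subst sum.swap) (simp add: exch)
  also have "\<dots> = (\<Sum>c'\<in>F. LINT z:cimg c'|lborel. \<Sum>c\<in>F. weight \<rho> c' z * q c' (chart_fun c' (\<rho> c)) z)"
    unfolding set_lebesgue_integral_def scaleR_sum_right
    using set_integrable_weight[OF _ cq] 
    by (intro sum.cong[OF refl] Bochner_Integration.integral_sum[symmetric]) (simp add: set_integrable_def)
  also have "\<dots> = (\<Sum>c'\<in>F. LINT z:cimg c'|lborel. 0)"
  proof (intro sum.cong[OF refl] set_lebesgue_integral_cong ballI allI impI)
    fix c z assume c: "c \<in> F" and z: "z \<in> cimg c"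
    have "(\<Sum>d\<in>F. q c (chart_fun c (\<rho> d)) z) = 
       (\<Sum>k\<in>UNIV. V c k z * (\<Sum>d\<in>F. dw k (chart_fun c (\<rho> d)) z) + W c k z * (\<Sum>d\<in>F. dwb k (chart_fun c (\<rho> d)) z))"
      unfolding q_def by (subst sum.swap) (simp add: sum.distrib sum_distrib_left)
    also have "\<dots> = 0" by (simp add: sum_chart_fun_partition(2)[OF partition_chart[OF c] z])
    finally show "(\<Sum>d\<in>F. weight \<rho> c z * q c (chart_fun c (\<rho> d)) z) = 0"
      by (simp flip: sum_distrib_left)
  qed (use op in auto)
  finally show ?thesis by simp
qed

section \<open>Differentiation under the integral\<close>

text \<open>The weight has compact support in the chart, so extension by zero turns the integrand into a smooth family
  on the whole space and the integral into one over a fixed box.\<close>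

lemma weighted_integral_has_vector_derivative:
  assumes c: "c \<in> F" and d: "smooth_family (cimg c) d" and t: "t \<in> {0..1}"
  shows "((\<lambda>t. LINT z:cimg c|lborel. weight \<rho> c z * d t z) has_vector_derivative
     (LINT z:cimg c|lborel. weight \<rho> c z * time_deriv d t z)) (at t within {0..1})"
proof -
  let ?U = "cimg c" and ?K = "support_in_chart \<rho> c"
  have U: "open ?U" by (rule open_cimg[OF X partition_chart[OF c]])
  note K = support_in_chart(1,2)[OF c]
  define e where "e = (\<lambda>t z. if z \<in> ?U then weight \<rho> c z * d t z else 0)"
  obtain a where a: "?K \<subseteq> cbox (-a) a"
    using bounded_subset_cbox_symmetric[OF compact_imp_bounded[OF K(1)]] by metis
  have se: "smooth_family UNIV e"
    unfolding smooth_family_def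
  proof (rule smooth_on_local)
    fix p :: "real \<times> (complex^2)" assume p: "p \<in> {0..1} \<times> UNIV"
    show "\<exists>W. open W \<and> p \<in> W \<and> smooth_on (W \<inter> {0..1} \<times> UNIV) (\<lambda>(t, z). e t z)"
    proof (cases "snd p \<in> ?U")
      case True
      have "smooth_on ({0..1} \<times> ?U) (\<lambda>(t, z). weight \<rho> c z * d t z)"
        using smooth_family_mult[OF smooth_family_const[OF smooth_weight[OF c] U] d] by (simp add: smooth_family_def)
      then have "smooth_on ((UNIV \<times> ?U) \<inter> {0..1} \<times> UNIV) (\<lambda>(t, z). weight \<rho> c z * d t z)"
        by (rule smooth_on_subset) auto
      then have "smooth_on ((UNIV \<times> ?U) \<inter> {0..1} \<times> UNIV) (\<lambda>(t, z). e t z)"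
        by (rule smooth_on_cong) (auto simp: e_def)
      moreover have "open (UNIV \<times> ?U :: (real \<times> (complex^2)) set)" using U by (intro open_Times) auto
      moreover have "p \<in> UNIV \<times> ?U" using True by (simp add: mem_Times_iff)
      ultimately show ?thesis by blast
    next
      case False
      have "smooth_on ((UNIV \<times> - ?K) \<inter> {0..1} \<times> UNIV) (\<lambda>(t, z). e t z)"
        by (rule smooth_on_cong[OF smooth_on_const[of _ 0]]) (auto simp: e_def weight_zero[OF c])
      moreover have "open (UNIV \<times> - ?K :: (real \<times> (complex^2)) set)"
        using K(1) compact_imp_closed by (intro open_Times) auto
      moreover have "p \<in> UNIV \<times> - ?K" using False K(2) by (auto simp: mem_Times_iff)
      ultimately show ?thesis by blast
    qed
  qed
  have te: "time_deriv e s z = (if z \<in> ?U then weight \<rho> c z * time_deriv d s z else 0)" if s: "s \<in> {0..1}" for s z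
  proof (cases "z \<in> ?U")
    case True
    have "((\<lambda>s. weight \<rho> c z * d s z) has_vector_derivative weight \<rho> c z * time_deriv d s z) (at s within {0..1})"
      by (intro has_vector_derivative_mult_right smooth_family_has_time_deriv[OF d U s True])
    then show ?thesis
      using True s unfolding time_deriv_def e_def
      by (auto intro!: vector_derivative_within_closed_interval)
  next
    case False
    then show ?thesis using s unfolding time_deriv_def e_def
      by (auto intro!: vector_derivative_within_closed_interval)
  qed
  have conv: "(LINT z:?U|lborel. weight \<rho> c z * k z) = integral (cbox (-a) a) (\<lambda>z. if z \<in> ?U then weight \<rho> c z * k z else 0)"
    if "continuous_on ?U k" for k
  proof -
    have "(LINT z:?U|lborel. weight \<rho> c z * k z) = integral ?U (\<lambda>z. weight \<rho> c z * k z)"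
      by (rule set_borel_integral_eq_integral(2)[OF set_integrable_weight[OF c that]])
    also have "\<dots> = integral UNIV (\<lambda>z. if z \<in> ?U then weight \<rho> c z * k z else 0)"
      by (rule integral_restrict_UNIV[symmetric])
    also have "(\<lambda>z. if z \<in> ?U then weight \<rho> c z * k z else 0)
       = (\<lambda>z. if z \<in> cbox (-a) a then if z \<in> ?U then weight \<rho> c z * k z else 0 else 0)"
      using a weight_zero[OF c] by (auto simp: fun_eq_iff)
    also have "integral UNIV \<dots> = integral (cbox (-a) a) (\<lambda>z. if z \<in> ?U then weight \<rho> c z * k z else 0)"
      by (rule integral_restrict_UNIV)
    finally show ?thesis .
  qed
  have "((\<lambda>t. integral (cbox (-a) a) (e t)) has_vector_derivative integral (cbox (-a) a) (time_deriv e t)) (at t within {0..1})"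
  proof (rule leibniz_rule_vector_derivative)
    show "((\<lambda>s. e s z) has_vector_derivative time_deriv e s z) (at s within {0..1})" if "s \<in> {0..1}" for s z
      by (rule smooth_family_has_time_deriv[OF se open_UNIV that]) simp
    show "e s integrable_on cbox (-a) a" if "s \<in> {0..1}" for s
      using smooth_on_imp_continuous_on[OF smooth_family_slice[OF se open_UNIV that]]
      by (intro integrable_continuous) (auto intro: continuous_on_subset)
    show "continuous_on ({0..1} \<times> cbox (-a) a) (\<lambda>(t, z). time_deriv e t z)"
      by (rule continuous_on_subset[OF smooth_family_continuous[OF smooth_family_time_deriv[OF se open_UNIV] open_UNIV]]) auto
  qed (use t in auto)
  then have "((\<lambda>t. LINT z:?U|lborel. weight \<rho> c z * d t z) has_vector_derivative integral (cbox (-a) a) (time_deriv e t)) (at t within {0..1})"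
    by (rule has_vector_derivative_transform[OF t, rotated])
       (simp add: e_def conv smooth_on_imp_continuous_on[OF smooth_family_slice[OF d U]])
  moreover have "integral (cbox (-a) a) (time_deriv e t) = (LINT z:?U|lborel. weight \<rho> c z * time_deriv d t z)"
    unfolding te[OF t, abs_def]
    by (rule conv[symmetric]) (intro smooth_on_imp_continuous_on smooth_family_slice[OF smooth_family_time_deriv[OF d U] U t])
  ultimately show ?thesis by simp
qed

end

section \<open>Transformation laws under change of chart\<close>

text \<open>The transformation law of the coefficient matrix of a form of type \<open>(1,1)\<close>.\<close>

definition covariant11 :: "'a chart set \<Rightarrow> ('a chart \<Rightarrow> complex^2 \<Rightarrow> complex^2^2) \<Rightarrow> bool" where
  "covariant11 A H \<longleftrightarrow> (\<forall>c\<in>A. \<forall>c'\<in>A. \<forall>z\<in>overlap c c'. \<forall>i j. H c z $ i $ j =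
      (\<Sum>k\<in>UNIV. \<Sum>l\<in>UNIV. pd i (transition c c') z $ k * cnj (pd j (transition c c') z $ l)
         * H c' (transition c c' z) $ k $ l))"

lemma covariant11_metric: "hermitian_metric A g \<Longrightarrow> covariant11 A g"
  unfolding hermitian_metric_def covariant11_def overlap_def by blast

text \<open>For \<open>h = k\<close> this is the multiplicativity of the determinant, and the general case is its polarisation. The factor
  is the one by which volume forms transform.\<close>

lemma mixed_det_congruence:
  fixes a h h' k k' 
  assumes "\<And>i j. h $ i $ j = (\<Sum>m\<in>UNIV. \<Sum>l\<in>UNIV. a i m * cnj (a j l) * h' $ m $ l)"
    and "\<And>i j. k $ i $ j = (\<Sum>m\<in>UNIV. \<Sum>l\<in>UNIV. a i m * cnj (a j l) * k' $ m $ l)"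
  shows "mixed_det h k = of_real ((cmod (a 1 1 * a 2 2 - a 2 1 * a 1 2))\<^sup>2) * mixed_det h' k'"
  unfolding complex_norm_square mixed_det_def assms sum_2 complex_cnj_diff complex_cnj_mult
  by algebra

definition outer :: "(2 \<Rightarrow> complex) \<Rightarrow> (2 \<Rightarrow> complex) \<Rightarrow> complex^2^2" where
  "outer a b = (\<chi> i j. a i * b j)"

text \<open>The top coefficient of \<open>\<Omega> \<and> \<i>(\<partial>r \<and> \<delta>b + \<partial>b \<and> \<delta>r)\<close>, where \<open>\<delta>\<close> is the conjugate of \<open>\<partial>\<close> and \<open>\<Omega>\<close> is the form with
  matrix \<open>H\<close>. It is symmetric in \<open>r\<close> and \<open>b\<close>.\<close>

definition gradient_pairing :: "complex^2^2 \<Rightarrow> (complex^2 \<Rightarrow> complex) \<Rightarrow> (complex^2 \<Rightarrow> complex) \<Rightarrow> complex^2 \<Rightarrow> complex" where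
  "gradient_pairing H r b z = mixed_det H (outer (\<lambda>i. dw i r z) (\<lambda>j. dwb j b z))
     + mixed_det H (outer (\<lambda>i. dw i b z) (\<lambda>j. dwb j r z))"

context
  fixes A :: "'a::t2_space chart set"
  assumes X: "compact_complex_surface A"
begin

lemma wirtinger_transition:
  assumes c: "c \<in> A" "c' \<in> A" and z: "z \<in> overlap c c'"
  shows "dw i (\<lambda>z. transition c c' z $ k) z = pd i (transition c c') z $ k"
    and "dwb i (\<lambda>z. transition c c' z $ k) z = 0"
    and "dw i (\<lambda>z. cnj (transition c c' z $ k)) z = 0"
    and "dwb i (\<lambda>z. cnj (transition c c' z $ k)) z = cnj (pd i (transition c c') z $ k)"
proof -
  let ?F = "transition c c'"
  have sm: "smooth_on (overlap c c') ?F" and hol: "pdbar i ?F z = 0" for i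
    using transition_holomorphic[OF X c] z by (auto simp: holomorphic_map_on_def)
  have d: "?F differentiable at z" "(\<lambda>z. ?F z $ k) differentiable at z" for k
    by (rule smooth_on_imp_differentiable[OF _ open_overlap[OF X c] z], intro smooth_on_nth sm)+
  show 1: "dw i (\<lambda>z. ?F z $ k) z = pd i ?F z $ k" for i k by (simp add: pd_nth d)
  show 2: "dwb i (\<lambda>z. ?F z $ k) z = 0" for i k using hol pd_nth(2)[OF d(1)] by (metis zero_index)
  show "dw i (\<lambda>z. cnj (?F z $ k)) z = 0" by (simp add: wirtinger_cnj d 2)
  show "dwb i (\<lambda>z. cnj (?F z $ k)) z = cnj (pd i ?F z $ k)" by (simp add: wirtinger_cnj d 1)
qed

lemma wirtinger_compose_transition:
  assumes c: "c \<in> A" "c' \<in> A" and z: "z \<in> overlap c c'" and f: "smooth_on (cimg c') f"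
  shows "dw i (\<lambda>z. f (transition c c' z)) z = (\<Sum>k\<in>UNIV. dw k f (transition c c' z) * pd i (transition c c') z $ k)"
    and "dwb i (\<lambda>z. f (transition c c' z)) z = (\<Sum>k\<in>UNIV. dwb k f (transition c c' z) * cnj (pd i (transition c c') z $ k))"
proof -
  have "smooth_on (overlap c c') (transition c c')"
    using transition_holomorphic[OF X c] by (auto simp: holomorphic_map_on_def)
  then have d: "transition c c' differentiable at z"
    by (rule smooth_on_imp_differentiable[OF _ open_overlap[OF X c] z])
  have "transition c c' z \<in> cimg c'"
    using overlap_transition[OF X c] overlap_subset[OF X c(2,1)] z by blast
  then have d': "f differentiable at (transition c c' z)"
    by (rule smooth_on_imp_differentiable[OF f open_cimg[OF X c(2)]])
  show "dw i (\<lambda>z. f (transition c c' z)) z = (\<Sum>k\<in>UNIV. dw k f (transition c c' z) * pd i (transition c c') z $ k)"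
    "dwb i (\<lambda>z. f (transition c c' z)) z = (\<Sum>k\<in>UNIV. dwb k f (transition c c' z) * cnj (pd i (transition c c') z $ k))"
    by (simp_all add: wirtinger_chain[OF d d'] wirtinger_transition[OF c z])
qed

lemma wirtinger_chart_fun_transition:
  assumes c: "c \<in> A" "c' \<in> A" and z: "z \<in> overlap c c'" and f: "smooth_fun A f"
  shows "dw i (chart_fun c f) z = (\<Sum>k\<in>UNIV. dw k (chart_fun c' f) (transition c c' z) * pd i (transition c c') z $ k)"
    and "dwb i (chart_fun c f) z = (\<Sum>k\<in>UNIV. dwb k (chart_fun c' f) (transition c c' z) * cnj (pd i (transition c c') z $ k))"
proof -
  have e: "wirtinger s i (chart_fun c f) z = wirtinger s i (\<lambda>z. chart_fun c' f (transition c c' z)) z" for s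
    by (rule wirtinger_cong[OF open_overlap[OF X c] z chart_fun_transition[OF X c]])
  show "dw i (chart_fun c f) z = (\<Sum>k\<in>UNIV. dw k (chart_fun c' f) (transition c c' z) * pd i (transition c c') z $ k)"
    unfolding e by (rule wirtinger_compose_transition(1)[OF c z smooth_chart_fun[OF X f c(2)]])
  show "dwb i (chart_fun c f) z = (\<Sum>k\<in>UNIV. dwb k (chart_fun c' f) (transition c c' z) * cnj (pd i (transition c c') z $ k))"
    unfolding e by (rule wirtinger_compose_transition(2)[OF c z smooth_chart_fun[OF X f c(2)]])
qed

text \<open>In the chain rule for the second derivative the term with second derivatives of the transition map vanishes,
  because the map is holomorphic.\<close>

lemma covariant11_hess:
  assumes f: "smooth_fun A f"
  shows "covariant11 A (\<lambda>c. hess (chart_fun c f))"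
  unfolding covariant11_def
proof (intro ballI allI)
  fix c c' z i j assume c: "c \<in> A" "c' \<in> A" and z: "z \<in> overlap c c'"
  let ?F = "transition c c'" and ?u = "chart_fun c' f"
  have op: "open (overlap c c')" by (rule open_overlap[OF X c])
  have su: "smooth_on (cimg c') ?u" by (rule smooth_chart_fun[OF X f c(2)])
  have sF: "smooth_on (overlap c c') ?F"
    using transition_holomorphic[OF X c] by (auto simp: holomorphic_map_on_def)
  have Fim: "?F ` overlap c c' \<subseteq> cimg c'"
    using overlap_transition[OF X c] overlap_subset[OF X c(2,1)] by simp
  have e: "dwb j (chart_fun c f) y = (\<Sum>l\<in>UNIV. dwb l ?u (?F y) * cnj (dw j (\<lambda>z. ?F z $ l) y))" if "y \<in> overlap c c'" for y
    using that by (simp add: wirtinger_chart_fun_transition[OF c that f] wirtinger_transition(1)[OF c that])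
  have sd: "smooth_on (cimg c') (dwb l ?u)" for l
    by (intro smooth_on_wirtinger su open_cimg[OF X c(2)])
  have s1: "smooth_on (overlap c c') (\<lambda>y. dwb l ?u (?F y))" for l
    by (rule smooth_on_compose[OF sF sd open_cimg[OF X c(2)] Fim])
  have s2: "smooth_on (overlap c c') (dw j (\<lambda>z. ?F z $ l))" for l j
    by (intro smooth_on_wirtinger smooth_on_nth sF op)
  have d: "(\<lambda>y. dwb l ?u (?F y)) differentiable at z" "dw j (\<lambda>z. ?F z $ l) differentiable at z"
     "(\<lambda>y. cnj (dw j (\<lambda>z. ?F z $ l) y)) differentiable at z" for l j
    by (rule smooth_on_imp_differentiable[OF _ op z], intro smooth_on_cnj s1 s2)+
  have 0: "dw i (\<lambda>y. cnj (dw j (\<lambda>z. ?F z $ l) y)) z = 0" for l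
  proof -
    have "dwb i (dw j (\<lambda>z. ?F z $ l)) z = dw j (dwb i (\<lambda>z. ?F z $ l)) z"
      by (rule wirtinger_commute[OF smooth_on_nth[OF sF] op z])
    also have "\<dots> = dw j (\<lambda>_. 0) z"
      by (rule wirtinger_cong[OF op z]) (rule wirtinger_transition(2)[OF c])
    finally show ?thesis by (simp add: wirtinger_cnj d)
  qed
  have "dw i (dwb j (chart_fun c f)) z = dw i (\<lambda>y. \<Sum>l\<in>UNIV. dwb l ?u (?F y) * cnj (dw j (\<lambda>z. ?F z $ l) y)) z"
    by (rule wirtinger_cong[OF op z e])
  also have "\<dots> = (\<Sum>l\<in>UNIV. dw i (\<lambda>y. dwb l ?u (?F y)) z * cnj (dw j (\<lambda>z. ?F z $ l) z))"
    by (simp add: wirtinger_sum wirtinger_mult d 0)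
  also have "\<dots> = (\<Sum>l\<in>UNIV. (\<Sum>k\<in>UNIV. dw k (dwb l ?u) (?F z) * pd i ?F z $ k) * cnj (pd j ?F z $ l))"
    by (simp add: wirtinger_compose_transition(1)[OF c z sd] wirtinger_transition(1)[OF c z])
  finally show "hess (chart_fun c f) z $ i $ j = (\<Sum>k\<in>UNIV. \<Sum>l\<in>UNIV. pd i ?F z $ k * cnj (pd j ?F z $ l) * hess ?u (?F z) $ k $ l)"
    by (simp add: hess_def sum_2 algebra_simps)
qed

lemma gradient_pairing_transition:
  assumes c: "c \<in> A" "c' \<in> A" and z: "z \<in> overlap c c'" and H: "covariant11 A H"
    and f: "smooth_fun A f" "smooth_fun A h"
  shows "gradient_pairing (H c z) (chart_fun c f) (chart_fun c h) z
    = of_real ((cmod (complex_jacobian (transition c c') z))\<^sup>2)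
      * gradient_pairing (H c' (transition c c' z)) (chart_fun c' f) (chart_fun c' h) (transition c c' z)"
proof -
  let ?F = "transition c c'" and ?a = "\<lambda>i k. pd i (transition c c') z $ k"
  have H': "H c z $ i $ j = (\<Sum>m\<in>UNIV. \<Sum>l\<in>UNIV. ?a i m * cnj (?a j l) * H c' (?F z) $ m $ l)" for i j
    using H c z unfolding covariant11_def by blast
  have O: "outer (\<lambda>i. dw i (chart_fun c f) z) (\<lambda>j. dwb j (chart_fun c h) z) $ i $ j
     = (\<Sum>m\<in>UNIV. \<Sum>l\<in>UNIV. ?a i m * cnj (?a j l) *
         outer (\<lambda>i. dw i (chart_fun c' f) (?F z)) (\<lambda>j. dwb j (chart_fun c' h) (?F z)) $ m $ l)"
    if "smooth_fun A f" "smooth_fun A h" for f h i j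
    by (simp add: outer_def wirtinger_chart_fun_transition[OF c z] that sum_2 algebra_simps)
  show ?thesis
    unfolding gradient_pairing_def mixed_det_congruence[OF H' O[OF f]] mixed_det_congruence[OF H' O[OF f(2,1)]]
      complex_jacobian_def by (simp add: algebra_simps)
qed

end

section \<open>The divergence identity\<close>

text \<open>The divergence of \<open>flux\<close> and \<open>flux_bar\<close> is the top coefficient of \<open>\<i>\<partial>(a \<Omega> \<and> \<delta>b) - \<i>\<delta>(a \<Omega> \<and> \<partial>b)\<close>, where \<open>\<delta>\<close> is the
  conjugate of \<open>\<partial>\<close> and \<open>\<Omega>\<close> is the form with matrix \<open>H\<close>.\<close>

definition flux :: "(complex^2 \<Rightarrow> complex) \<Rightarrow> (complex^2 \<Rightarrow> complex^2^2) \<Rightarrow> (complex^2 \<Rightarrow> complex) \<Rightarrow> 2 \<Rightarrow> complex^2 \<Rightarrow> complex" where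
  "flux a H b k = (if k = 1
     then (\<lambda>z. a z * (H z $ 2 $ 2 * dwb 1 b z - H z $ 2 $ 1 * dwb 2 b z))
     else (\<lambda>z. a z * (H z $ 1 $ 1 * dwb 2 b z - H z $ 1 $ 2 * dwb 1 b z)))"

definition flux_bar :: "(complex^2 \<Rightarrow> complex) \<Rightarrow> (complex^2 \<Rightarrow> complex^2^2) \<Rightarrow> (complex^2 \<Rightarrow> complex) \<Rightarrow> 2 \<Rightarrow> complex^2 \<Rightarrow> complex" where
  "flux_bar a H b k = (if k = 1
     then (\<lambda>z. a z * (H z $ 2 $ 2 * dw 1 b z - H z $ 1 $ 2 * dw 2 b z))
     else (\<lambda>z. a z * (H z $ 1 $ 1 * dw 2 b z - H z $ 2 $ 1 * dw 1 b z)))"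

lemma flux_gradient_pairing:
  "(\<Sum>k\<in>UNIV. flux a H b k z * dw k r z + flux_bar a H b k z * dwb k r z) = a z * gradient_pairing (H z) r b z"
  by (simp add: flux_def flux_bar_def gradient_pairing_def mixed_det_def outer_def sum_2 algebra_simps)

text \<open>The Leibniz rule for \<open>\<i>\<partial>(a \<Omega> \<and> \<delta>b) - \<i>\<delta>(a \<Omega> \<and> \<partial>b)\<close> with \<open>\<Omega> = 3\<omega> + 2\<i>\<partial>\<delta>u\<close>. Since \<open>\<partial>\<partial>\<delta>u = 0\<close>, the potential \<open>u\<close> does not
  contribute to the torsion term, which therefore contains \<open>3\<partial>\<omega>\<close> only. In coordinates this cancellation is the
  symmetry of third derivatives, facts \<open>cu\<close> and \<open>cu'\<close>.\<close>

lemma divergence_flux: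
  assumes U: "open U" and z: "z \<in> U"
    and a: "smooth_on U a" and b: "smooth_on U b" and u: "smooth_on U u"
    and G: "\<And>i j. smooth_on U (\<lambda>z. G z $ i $ j)"
  defines "H \<equiv> \<lambda>z. (\<chi> i j. 3 * G z $ i $ j + 2 * dw i (dwb j u) z)"
  shows "(\<Sum>k\<in>UNIV. dw k (flux a H b k) z + dwb k (flux_bar a H b k) z)
    = 3 * \<i> * a z * (torsion_pairing (matrix_wirtinger (-\<i>) G z) (\<lambda>j. dwb j b z)
        - torsion_pairing_bar (matrix_wirtinger \<i> G z) (\<lambda>j. dw j b z))
      + 2 * a z * mixed_det (H z) (hess b z) + gradient_pairing (H z) a b z"
proof -
  have sH: "smooth_on U (\<lambda>z. H z $ i $ j)" for i j
    unfolding H_def by (simp, intro smooth_on_add smooth_on_mult smooth_on_const G smooth_on_wirtinger u U)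
  note d = smooth_on_imp_differentiable[OF _ U z]
  have da: "a differentiable at z" by (rule d[OF a])
  have dH: "(\<lambda>z. H z $ i $ j) differentiable at z" for i j by (rule d[OF sH])
  have db: "wirtinger s k b differentiable at z" for s k by (rule d[OF smooth_on_wirtinger[OF b U]])
  have prod: "wirtinger s k (\<lambda>z. a z * (H z $ i $ j * wirtinger r l b z - H z $ i' $ j' * wirtinger r l' b z)) z
    = a z * (H z $ i $ j * wirtinger s k (wirtinger r l b) z + wirtinger s k (\<lambda>z. H z $ i $ j) z * wirtinger r l b z
         - (H z $ i' $ j' * wirtinger s k (wirtinger r l' b) z + wirtinger s k (\<lambda>z. H z $ i' $ j') z * wirtinger r l' b z))
      + wirtinger s k a z * (H z $ i $ j * wirtinger r l b z - H z $ i' $ j' * wirtinger r l' b z)"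
    for s r k l l' i j i' j'
  proof -
    have dm: "(\<lambda>z. H z $ i $ j * wirtinger r l b z) differentiable at z" for i j r l
      by (intro derivative_intros dH db)
    show ?thesis
      by (simp add: wirtinger_mult wirtinger_diff dm da dH db)
  qed
  have wH: "wirtinger s k (\<lambda>z. H z $ i $ j) z = 3 * wirtinger s k (\<lambda>z. G z $ i $ j) z + 2 * wirtinger s k (dw i (dwb j u)) z" for s k i j
  proof -
    have "(\<lambda>z. G z $ i $ j) differentiable at z" "dw i (dwb j u) differentiable at z"
      by (auto intro!: d G smooth_on_wirtinger u U)
    then show ?thesis unfolding H_def by (simp add: wirtinger_add wirtinger_cmult derivative_intros)
  qed
  have cu: "dw 2 (dw 1 (dwb j u)) z = dw 1 (dw 2 (dwb j u)) z" for j
    by (rule wirtinger_commute[OF smooth_on_wirtinger[OF u U] U z])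
  have cu': "dwb 2 (dw i (dwb 1 u)) z = dwb 1 (dw i (dwb 2 u)) z" for i
  proof -
    have "dwb k (dw i (dwb l u)) z = dw i (dwb k (dwb l u)) z" for k l
      by (rule wirtinger_commute[OF smooth_on_wirtinger[OF u U] U z])
    moreover have "dw i (dwb 2 (dwb 1 u)) z = dw i (dwb 1 (dwb 2 u)) z"
      by (rule wirtinger_cong[OF U z]) (rule wirtinger_commute[OF u U])
    ultimately show ?thesis by simp
  qed
  have cb: "dwb k (dw j b) z = dw j (dwb k b) z" for k j
    by (rule wirtinger_commute[OF b U z])
  show ?thesis
    unfolding sum_2 flux_def flux_bar_def
    by (simp add: prod wH cu cu' cb)
       (simp add: torsion_pairing_def torsion_pairing_bar_def matrix_wirtinger_def mixed_det_def hess_def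
          gradient_pairing_def outer_def algebra_simps)
qed

section \<open>The energy density and its variation\<close>

definition torsion_density :: "(complex^2 \<Rightarrow> complex^2^2) \<Rightarrow> (complex^2 \<Rightarrow> complex) \<Rightarrow> complex^2 \<Rightarrow> complex" where
  "torsion_density G b z = torsion_pairing (matrix_wirtinger (-\<i>) G z) (\<lambda>j. dwb j b z)"

definition torsion_density_bar :: "(complex^2 \<Rightarrow> complex^2^2) \<Rightarrow> (complex^2 \<Rightarrow> complex) \<Rightarrow> complex^2 \<Rightarrow> complex" where
  "torsion_density_bar G b z = torsion_pairing_bar (matrix_wirtinger \<i> G z) (\<lambda>j. dw j b z)"

definition perturbed :: "(complex^2 \<Rightarrow> complex^2^2) \<Rightarrow> (complex^2 \<Rightarrow> complex) \<Rightarrow> complex^2 \<Rightarrow> complex^2^2" where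
  "perturbed G u z = G z + hess u z"

definition volume_average :: "(complex^2 \<Rightarrow> complex^2^2) \<Rightarrow> (complex^2 \<Rightarrow> complex) \<Rightarrow> complex^2 \<Rightarrow> complex" where
  "volume_average G u z = mixed_det (G z) (G z) + mixed_det (G z) (perturbed G u z) + mixed_det (perturbed G u z) (perturbed G u z)"

text \<open>The density of the primitive: \<open>1/3\<close> of \<open>u (\<omega>\<^sup>2 + \<omega> \<and> \<omega>\<^sub>u + \<omega>\<^sub>u\<^sup>2)\<close> plus \<open>1/2\<close> of the torsion term. The factor \<open>4\<close> is
  that of \<^const>\<open>top_density\<close>.\<close>

definition energy_density :: "(complex^2 \<Rightarrow> complex^2^2) \<Rightarrow> (complex^2 \<Rightarrow> complex) \<Rightarrow> complex^2 \<Rightarrow> complex" where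
  "energy_density G u z = 4 * (1/3 * (u z * volume_average G u z)
     + 1/2 * (u z * (- \<i> * torsion_density G u z + \<i> * torsion_density_bar G u z)))"

definition energy_variation ::
  "(complex^2 \<Rightarrow> complex^2^2) \<Rightarrow> (complex^2 \<Rightarrow> complex) \<Rightarrow> (complex^2 \<Rightarrow> complex) \<Rightarrow> complex^2 \<Rightarrow> complex" where
  "energy_variation G u p z = 4 * (1/3 * (p z * volume_average G u z
        + u z * (mixed_det (G z) (hess p z) + 2 * mixed_det (perturbed G u z) (hess p z)))
     + 1/2 * (p z * (- \<i> * torsion_density G u z + \<i> * torsion_density_bar G u z)
        + u z * (- \<i> * torsion_density G p z + \<i> * torsion_density_bar G p z)))"

definition mabuchi_density ::
  "(complex^2 \<Rightarrow> complex^2^2) \<Rightarrow> (complex^2 \<Rightarrow> complex) \<Rightarrow> (complex^2 \<Rightarrow> complex) \<Rightarrow> complex^2 \<Rightarrow> complex" where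
  "mabuchi_density G u p z = 4 * (p z * mixed_det (perturbed G u z) (perturbed G u z))
     - 4 * (\<i> * (u z * torsion_density G p z)) + 4 * (\<i> * (u z * torsion_density_bar G p z))"

text \<open>The matrix of \<open>\<Omega> = \<omega> + 2\<omega>\<^sub>u\<close>, the form that appears when the \<open>u\<close>-derivative of \<open>\<omega>\<^sup>2 + \<omega> \<and> \<omega>\<^sub>u + \<omega>\<^sub>u\<^sup>2\<close> is taken.\<close>

definition stokes_matrix :: "(complex^2 \<Rightarrow> complex^2^2) \<Rightarrow> (complex^2 \<Rightarrow> complex) \<Rightarrow> complex^2 \<Rightarrow> complex^2^2" where
  "stokes_matrix G u z = (\<chi> i j. 3 * G z $ i $ j + 2 * dw i (dwb j u) z)"

definition stokes_divergence ::
  "(complex^2 \<Rightarrow> complex) \<Rightarrow> (complex^2 \<Rightarrow> complex^2^2) \<Rightarrow> (complex^2 \<Rightarrow> complex) \<Rightarrow> complex^2 \<Rightarrow> complex" where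
  "stokes_divergence a H b z = (\<Sum>k\<in>UNIV. dw k (flux a H b k) z + dwb k (flux_bar a H b k) z)"

text \<open>The reason why the three terms of the functional fit together: the variation of the energy density in the
  direction \<open>p\<close> differs from the density of the one-form of the functional by a divergence. By
  \<open>divergence_flux\<close> the difference contains \<open>u \<Omega> \<and> \<i>\<partial>\<delta>p - p \<Omega> \<and> \<i>\<partial>\<delta>u\<close>; as \<open>\<i>\<partial>\<delta>u = \<omega>\<^sub>u - \<omega>\<close>, the second
  product supplies \<open>3\<omega>\<^sub>u\<^sup>2 - (\<omega>\<^sup>2 + \<omega> \<and> \<omega>\<^sub>u + \<omega>\<^sub>u\<^sup>2)\<close>. The products of two gradients cancel because
  the gradient pairing is symmetric.\<close>

lemma energy_variation_eq:
  assumes U: "open U" "z \<in> U" and u: "smooth_on U u" and p: "smooth_on U p"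
    and G: "\<And>i j. smooth_on U (\<lambda>z. G z $ i $ j)"
  shows "energy_variation G u p z = mabuchi_density G u p z
    + 2/3 * (stokes_divergence u (stokes_matrix G u) p z - stokes_divergence p (stokes_matrix G u) u z)"
proof -
  have sym: "gradient_pairing (stokes_matrix G u z) p u z = gradient_pairing (stokes_matrix G u z) u p z"
    by (simp add: gradient_pairing_def)
  have 1: "mixed_det (stokes_matrix G u z) (hess p z) = mixed_det (G z) (hess p z) + 2 * mixed_det (perturbed G u z) (hess p z)"
    by (simp add: stokes_matrix_def perturbed_def hess_def mixed_det_def algebra_simps)
  have 2: "mixed_det (stokes_matrix G u z) (hess u z) = 3 * mixed_det (perturbed G u z) (perturbed G u z) - volume_average G u z"
    by (simp add: stokes_matrix_def perturbed_def volume_average_def hess_def mixed_det_def algebra_simps)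
  have d: "stokes_divergence a (stokes_matrix G u) b z
    = 3 * \<i> * a z * (torsion_density G b z - torsion_density_bar G b z)
      + 2 * a z * mixed_det (stokes_matrix G u z) (hess b z) + gradient_pairing (stokes_matrix G u z) a b z"
    if "smooth_on U a" "smooth_on U b" for a b
    unfolding stokes_divergence_def stokes_matrix_def torsion_density_def torsion_density_bar_def
    by (rule divergence_flux[OF U that u G])
  show ?thesis
    unfolding d[OF u p] d[OF p u] 1 2 sym energy_variation_def mabuchi_density_def
    by (simp add: algebra_simps)
qed

lemma smooth_family_diff:
  fixes u v :: "real \<Rightarrow> 'a::real_normed_vector \<Rightarrow> complex"
  shows "smooth_family U u \<Longrightarrow> smooth_family U v \<Longrightarrow> smooth_family U (\<lambda>t z. u t z - v t z)"
  unfolding smooth_family_def case_prod_unfold by (rule smooth_on_diff)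

lemma smooth_family_cmult:
  fixes u :: "real \<Rightarrow> 'a::real_normed_vector \<Rightarrow> complex"
  shows "smooth_family U u \<Longrightarrow> smooth_family U (\<lambda>t z. k * u t z)"
  unfolding smooth_family_def case_prod_unfold by (intro smooth_on_mult smooth_on_const)

lemma smooth_family_mixed_det:
  assumes "\<And>i j. smooth_family U (\<lambda>t z. h t z $ i $ j)" "\<And>i j. smooth_family U (\<lambda>t z. k t z $ i $ j)"
  shows "smooth_family U (\<lambda>t z. mixed_det (h t z) (k t z))"
  unfolding mixed_det_def by (intro smooth_family_diff smooth_family_add smooth_family_mult assms)

lemma has_vector_derivative_mixed_det:
  assumes "\<And>i j. ((\<lambda>t. h t $ i $ j) has_vector_derivative h' $ i $ j) (at t within S)"
    "\<And>i j. ((\<lambda>t. k t $ i $ j) has_vector_derivative k' $ i $ j) (at t within S)"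
  shows "((\<lambda>t. mixed_det (h t) (k t)) has_vector_derivative mixed_det h' (k t) + mixed_det (h t) k') (at t within S)"
  unfolding mixed_det_def
  by (rule has_vector_derivative_eq_rhs,
      (rule has_vector_derivative_diff has_vector_derivative_add has_vector_derivative_mult assms)+) simp

lemma has_vector_derivative_torsion:
  assumes "\<And>j. ((\<lambda>t. b t j) has_vector_derivative b' j) (at t within S)"
  shows "((\<lambda>t. torsion_pairing H (b t)) has_vector_derivative torsion_pairing H b') (at t within S)"
    "((\<lambda>t. torsion_pairing_bar H (b t)) has_vector_derivative torsion_pairing_bar H b') (at t within S)"
  unfolding torsion_pairing_def torsion_pairing_bar_def
  by (intro has_vector_derivative_mult_right has_vector_derivative_diff assms)+

context
  fixes U :: "(complex^2) set" and G :: "complex^2 \<Rightarrow> complex^2^2" and u :: "real \<Rightarrow> complex^2 \<Rightarrow> complex"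
  assumes U: "open U" and G: "\<And>i j. smooth_on U (\<lambda>z. G z $ i $ j)" and u: "smooth_family U u"
begin

lemma smooth_family_metric: "smooth_family U (\<lambda>t z. G z $ i $ j)"
  by (rule smooth_family_const[OF G U])

lemma smooth_family_hess: "smooth_family U v \<Longrightarrow> smooth_family U (\<lambda>t z. hess (v t) z $ i $ j)"
  unfolding hess_def by (simp, rule smooth_family_wirtinger[OF smooth_family_wirtinger[OF _ U] U])

lemma smooth_family_perturbed: "smooth_family U (\<lambda>t z. perturbed G (u t) z $ i $ j)"
  unfolding perturbed_def by (simp, intro smooth_family_add smooth_family_metric smooth_family_hess u)

lemma smooth_family_torsion_density:
  assumes v: "smooth_family U v"
  shows "smooth_family U (\<lambda>t. torsion_density G (v t))" "smooth_family U (\<lambda>t. torsion_density_bar G (v t))"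
proof -
  have m: "smooth_family U (\<lambda>t z. wirtinger s k (\<lambda>z. G z $ i $ j) z)" for s k i j
    by (rule smooth_family_const[OF smooth_on_wirtinger[OF G U] U])
  have "smooth_family U (\<lambda>t z. torsion_density G (v t) z)" "smooth_family U (\<lambda>t z. torsion_density_bar G (v t) z)"
    unfolding torsion_density_def torsion_density_bar_def torsion_pairing_def torsion_pairing_bar_def matrix_wirtinger_def vec_lambda_beta
    by (intro smooth_family_cmult smooth_family_diff smooth_family_mult m smooth_family_wirtinger[OF v U])+
  then show "smooth_family U (\<lambda>t. torsion_density G (v t))" "smooth_family U (\<lambda>t. torsion_density_bar G (v t))" .
qed

lemma smooth_family_energy_density: "smooth_family U (\<lambda>t z. energy_density G (u t) z)"
  unfolding energy_density_def volume_average_def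
  by (intro smooth_family_cmult smooth_family_add smooth_family_mult smooth_family_mixed_det
      smooth_family_metric smooth_family_perturbed smooth_family_torsion_density u)

lemma time_deriv_wirtinger:
  assumes "smooth_family U v" "t \<in> {0..1}" "z \<in> U"
  shows "time_deriv (\<lambda>t. wirtinger s i (v t)) t z = wirtinger s i (time_deriv v t) z"
  unfolding time_deriv_def[of "\<lambda>t. wirtinger s i (v t)"]
  by (rule vector_derivative_within_closed_interval) 
     (use assms in \<open>auto intro: smooth_family_wirtinger_time_deriv[OF assms(1) U]\<close>)

lemma hess_has_time_deriv:
  assumes t: "t \<in> {0..1}" and z: "z \<in> U"
  shows "((\<lambda>t. hess (u t) z $ i $ j) has_vector_derivative hess (time_deriv u t) z $ i $ j) (at t within {0..1})"
proof -
  have "((\<lambda>t. dw i (dwb j (u t)) z) has_vector_derivative dw i (time_deriv (\<lambda>t. dwb j (u t)) t) z) (at t within {0..1})"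
    by (rule smooth_family_wirtinger_time_deriv[OF smooth_family_wirtinger[OF u U] U t z])
  moreover have "dw i (time_deriv (\<lambda>t. dwb j (u t)) t) z = dw i (dwb j (time_deriv u t)) z"
    by (rule wirtinger_cong[OF U z]) (rule time_deriv_wirtinger[OF u t])
  ultimately show ?thesis by (simp add: hess_def)
qed

lemma energy_density_has_time_deriv:
  assumes t: "t \<in> {0..1}" and z: "z \<in> U"
  shows "((\<lambda>t. energy_density G (u t) z) has_vector_derivative energy_variation G (u t) (time_deriv u t) z) (at t within {0..1})"
proof -
  let ?p = "time_deriv u t"
  have ud: "((\<lambda>t. u t z) has_vector_derivative ?p z) (at t within {0..1})"
    by (rule smooth_family_has_time_deriv[OF u U t z])
  have G0: "((\<lambda>t. G z $ i $ j) has_vector_derivative (0::complex^2^2) $ i $ j) (at t within {0..1})" for i j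
    by simp
  have H: "((\<lambda>t. perturbed G (u t) z $ i $ j) has_vector_derivative hess ?p z $ i $ j) (at t within {0..1})" for i j
    unfolding perturbed_def using has_vector_derivative_add[OF G0 hess_has_time_deriv[OF t z]] by simp
  have W: "((\<lambda>t. wirtinger s k (u t) z) has_vector_derivative wirtinger s k ?p z) (at t within {0..1})" for s k
    by (rule smooth_family_wirtinger_time_deriv[OF u U t z])
  have T: "((\<lambda>t. torsion_density G (u t) z) has_vector_derivative torsion_density G ?p z) (at t within {0..1})"
    "((\<lambda>t. torsion_density_bar G (u t) z) has_vector_derivative torsion_density_bar G ?p z) (at t within {0..1})"
    unfolding torsion_density_def torsion_density_bar_def
    by (rule has_vector_derivative_torsion[where b = "\<lambda>t j. dwb j (u t) z"] has_vector_derivative_torsion[where b = "\<lambda>t j. dw j (u t) z"], rule W)+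
  have VA: "((\<lambda>t. volume_average G (u t) z) has_vector_derivative
      mixed_det (G z) (hess ?p z) + 2 * mixed_det (perturbed G (u t) z) (hess ?p z)) (at t within {0..1})"
    unfolding volume_average_def
    by (rule has_vector_derivative_eq_rhs,
        (rule has_vector_derivative_add has_vector_derivative_mixed_det[OF G0 G0]
          has_vector_derivative_mixed_det[OF G0 H] has_vector_derivative_mixed_det[OF H H])+)
       (simp add: mixed_det_def algebra_simps)
  show ?thesis
    unfolding energy_density_def energy_variation_def
    by (rule has_vector_derivative_eq_rhs,
        (rule ud VA T has_vector_derivative_mult_right has_vector_derivative_add has_vector_derivative_mult)+)
       (simp add: algebra_simps)
qed

lemma time_deriv_energy_density:
  assumes t: "t \<in> {0..1}" and z: "z \<in> U"
  shows "time_deriv (\<lambda>t. energy_density G (u t)) t z = energy_variation G (u t) (time_deriv u t) z"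
  unfolding time_deriv_def[of "\<lambda>t. energy_density G (u t)"]
  by (rule vector_derivative_within_closed_interval) (use t energy_density_has_time_deriv[OF t z] in auto)

end

section \<open>Properties of the integral of densities\<close>

context
  fixes A :: "'a::t2_space chart set" and F :: "'a chart set" and \<rho> :: "'a chart \<Rightarrow> 'a \<Rightarrow> real"
  assumes X: "compact_complex_surface A" and P: "partition_of_unity A F \<rho>"
begin

lemma partition_integral_cong:
  assumes "\<And>c z. c \<in> F \<Longrightarrow> z \<in> cimg c \<Longrightarrow> d c z = d' c z"
  shows "partition_integral F \<rho> d = partition_integral F \<rho> d'"
  unfolding partition_integral_def
  using assms open_cimg[OF X partition_chart[OF X P]]
  by (intro sum.cong refl set_lebesgue_integral_cong) (auto simp: borel_open)

lemma partition_integral_add: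
  assumes "\<And>c. c \<in> F \<Longrightarrow> continuous_on (cimg c) (d c)" "\<And>c. c \<in> F \<Longrightarrow> continuous_on (cimg c) (d' c)"
  shows "partition_integral F \<rho> (\<lambda>c z. d c z + d' c z) = partition_integral F \<rho> d + partition_integral F \<rho> d'"
  unfolding partition_integral_def distrib_left
  by (simp add: set_integral_add set_integrable_weight[OF X P] assms sum.distrib)

lemma partition_integral_cmult: "partition_integral F \<rho> (\<lambda>c z. k * d c z) = k * partition_integral F \<rho> d"
  unfolding partition_integral_def by (simp add: mult.left_commute sum_distrib_left)

lemma partition_integral_cnj:
  "partition_integral F \<rho> (\<lambda>c z. cnj (d c z)) = cnj (partition_integral F \<rho> d)"
proof -
  have "(LINT z:S|lborel. weight \<rho> c z * cnj (d c z)) = cnj (LINT z:S|lborel. weight \<rho> c z * d c z)" for c S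
  proof -
    have e: "(\<lambda>z. indicat_real S z *\<^sub>R (weight \<rho> c z * cnj (d c z))) = (\<lambda>z. cnj (indicat_real S z *\<^sub>R (weight \<rho> c z * d c z)))"
      by (rule ext) (simp add: weight_def chart_fun_def)
    show ?thesis unfolding set_lebesgue_integral_def e by (rule Bochner_Integration.integral_cnj)
  qed
  then show ?thesis unfolding partition_integral_def by simp
qed

lemma partition_integral_real:
  assumes "\<And>c z. c \<in> F \<Longrightarrow> z \<in> cimg c \<Longrightarrow> cnj (d c z) = d c z"
  shows "partition_integral F \<rho> d \<in> \<real>"
  using partition_integral_cnj[of d] partition_integral_cong[of "\<lambda>c z. cnj (d c z)" d] assms
  by (simp add: Reals_cnj_iff)

lemma partition_integral_has_vector_derivative:
  assumes "\<And>c. c \<in> F \<Longrightarrow> smooth_family (cimg c) (d c)" "t \<in> {0..1}"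
  shows "((\<lambda>t. partition_integral F \<rho> (\<lambda>c. d c t)) has_vector_derivative
      partition_integral F \<rho> (\<lambda>c. time_deriv (d c) t)) (at t within {0..1})"
  unfolding partition_integral_def
  by (intro has_vector_derivative_sum weighted_integral_has_vector_derivative[OF X P] assms)

lemma partition_integral_continuous:
  assumes "\<And>c. c \<in> F \<Longrightarrow> smooth_family (cimg c) (d c)"
  shows "continuous_on {0..1} (\<lambda>t. partition_integral F \<rho> (\<lambda>c. d c t))"
proof -
  have "continuous (at t within {0..1}) (\<lambda>t. partition_integral F \<rho> (\<lambda>c. d c t))" if "t \<in> {0..1}" for t
    using has_vector_derivative_continuous[OF partition_integral_has_vector_derivative[OF assms that]] .
  then show ?thesis by (simp add: continuous_on_eq_continuous_within)
qed

end

text \<open>The partition of unity that is chosen in the definition of the integral depends on the atlas only, so that all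
  integrals of forms are computed with the same one.\<close>

lemma form_integral_partition:
  assumes "compact_complex_surface A"
  obtains F \<rho> where "partition_of_unity A F \<rho>"
    "\<And>\<eta>. form_integral A \<eta> = partition_integral F \<rho> (\<lambda>c z. top_density (\<eta> c z))"
proof -
  define p where "p = (SOME p. case p of (F, \<rho>) \<Rightarrow> partition_of_unity A F \<rho>)"
  have "\<exists>p. case p of (F, \<rho>) \<Rightarrow> partition_of_unity A F \<rho>"
    using partition_of_unity_exists[OF assms] by auto
  from someI_ex[OF this] have 1: "partition_of_unity A (fst p) (snd p)"
    by (simp add: p_def case_prod_unfold)
  have 2: "form_integral A \<eta> = partition_integral (fst p) (snd p) (\<lambda>c z. top_density (\<eta> c z))" for \<eta>
    unfolding form_integral_def p_def[symmetric] partition_integral_def weight_def chart_fun_def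
    by (simp add: case_prod_unfold Let_def)
  show thesis by (rule that[OF 1 2])
qed

text \<open>Evaluate the Hermitian form at \<open>(1, 0)\<close> and at \<open>(- h\<^sub>2\<^sub>1, h\<^sub>1\<^sub>1)\<close>; the second value is \<open>h\<^sub>1\<^sub>1 det h\<close>.\<close>

lemma posdef_mixed_det_pos:
  assumes h: "posdef_hermitian h"
  obtains r where "r > 0" "mixed_det h h = complex_of_real r"
proof -
  have herm: "h $ j $ i = cnj (h $ i $ j)" for i j using h unfolding posdef_hermitian_def by blast
  have pos: "0 < Re (\<Sum>i\<in>UNIV. \<Sum>j\<in>UNIV. h $ i $ j * v $ i * cnj (v $ j))" if "v \<noteq> 0" for v :: "complex^2"
    using h that unfolding posdef_hermitian_def by blast
  have re: "Im (h $ 1 $ 1) = 0" "Im (h $ 2 $ 2) = 0" "h $ 1 $ 2 = cnj (h $ 2 $ 1)"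
    using herm[of 1 1] herm[of 2 2] herm[of 2 1] by (auto simp: complex_eq_iff)
  have h11: "0 < Re (h $ 1 $ 1)"
  proof -
    have "axis 1 1 \<noteq> (0 :: complex^2)" by (simp add: axis_eq_0_iff)
    from pos[OF this] show ?thesis by (simp add: sum_2 axis_def)
  qed
  define v :: "complex^2" where "v = (\<chi> i. if i = 1 then - h $ 2 $ 1 else h $ 1 $ 1)"
  have "v \<noteq> 0" using h11 by (auto simp: v_def vec_eq_iff forall_2)
  from pos[OF this] have "0 < Re (h $ 1 $ 1) * (Re (h $ 1 $ 1) * Re (h $ 2 $ 2) - ((Re (h $ 2 $ 1))\<^sup>2 + (Im (h $ 2 $ 1))\<^sup>2))"
    by (simp add: v_def sum_2 re algebra_simps power2_eq_square)
  with h11 have "0 < Re (h $ 1 $ 1) * Re (h $ 2 $ 2) - ((Re (h $ 2 $ 1))\<^sup>2 + (Im (h $ 2 $ 1))\<^sup>2)"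
    by (simp add: zero_less_mult_iff)
  then show thesis
    using that[of "2 * (Re (h $ 1 $ 1) * Re (h $ 2 $ 2) - ((Re (h $ 2 $ 1))\<^sup>2 + (Im (h $ 2 $ 1))\<^sup>2))"]
    by (simp add: mixed_det_def complex_eq_iff re power2_eq_square algebra_simps)
qed

section \<open>The energy along a smooth path\<close>

definition total_energy ::
  "'a chart set \<Rightarrow> ('a chart \<Rightarrow> 'a \<Rightarrow> real) \<Rightarrow> ('a chart \<Rightarrow> complex^2 \<Rightarrow> complex^2^2) \<Rightarrow> ('a \<Rightarrow> real) \<Rightarrow> complex" where
  "total_energy F \<rho> g \<phi> = partition_integral F \<rho> (\<lambda>c. energy_density (g c) (chart_fun c \<phi>))"

context
  fixes A :: "'a::t2_space chart set" and g :: "'a chart \<Rightarrow> complex^2 \<Rightarrow> complex^2^2"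
  assumes X: "compact_complex_surface A" and hg: "hermitian_metric A g"
begin

lemma metric_smooth:
  assumes "c \<in> A"
  shows "smooth_on (cimg c) (g c)" "smooth_on (cimg c) (\<lambda>z. g c z $ i $ j)"
proof -
  show 1: "smooth_on (cimg c) (g c)" using hg assms by (auto simp: hermitian_metric_def)
  then show "smooth_on (cimg c) (\<lambda>z. g c z $ i $ j)" by (intro smooth_on_nth)
qed

lemma metric_posdef: "c \<in> A \<Longrightarrow> z \<in> cimg c \<Longrightarrow> posdef_hermitian (g c z)"
  using hg unfolding hermitian_metric_def by blast

lemma potentials_smooth: "\<phi> \<in> potentials A g \<Longrightarrow> smooth_fun A \<phi>"
  by (simp add: potentials_def)

lemma omega_phi_perturbed:
  assumes "smooth_fun A \<phi>" "c \<in> A" "z \<in> cimg c"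
  shows "omega_phi g \<phi> c z = herm_form (perturbed (g c) (chart_fun c \<phi>) z)"
  unfolding perturbed_def
  by (rule omega_phi_eq[OF open_cimg[OF X assms(2)] smooth_chart_fun[OF X assms(1,2)] assms(3)])

lemma form_torsion_densities:
  assumes "smooth_fun A b" "c \<in> A" "z \<in> cimg c"
  shows "ext_wedge (del (omega g) c z) (delbar (fun_form b) c z) $ UNIV = torsion_density (g c) (chart_fun c b) z"
    and "ext_wedge (delbar (omega g) c z) (del (fun_form b) c z) $ UNIV = torsion_density_bar (g c) (chart_fun c b) z"
  unfolding torsion_density_def torsion_density_bar_def
  by (rule top_density_del_omega[where g = g and b = b, OF open_cimg[OF X assms(2)] metric_smooth(1)[OF assms(2)]
        smooth_chart_fun[OF X assms(1,2)] assms(3)])+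

lemma density_volume:
  assumes "smooth_fun A \<phi>" "c \<in> A" "z \<in> cimg c"
  shows "top_density ((f \<cdot>\<^sub>F (omega_phi g \<phi> \<and>\<^sub>F omega_phi g \<phi>)) c z)
      = 4 * (chart_fun c f z * mixed_det (perturbed (g c) (chart_fun c \<phi>) z) (perturbed (g c) (chart_fun c \<phi>) z))"
  by (simp add: top_density_def form_mult_def form_wedge_def chart_fun_def[of c f]
      omega_phi_perturbed[OF assms] top_herm_wedge_herm)

lemma density_torsion:
  assumes "smooth_fun A b" "c \<in> A" "z \<in> cimg c"
  shows "top_density ((\<i> *\<^sub>F (del (omega g) \<and>\<^sub>F (f \<cdot>\<^sub>F delbar (fun_form b)))) c z)
      = 4 * (\<i> * (chart_fun c f z * torsion_density (g c) (chart_fun c b) z))"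
    and "top_density ((\<i> *\<^sub>F (delbar (omega g) \<and>\<^sub>F (f \<cdot>\<^sub>F del (fun_form b)))) c z)
      = 4 * (\<i> * (chart_fun c f z * torsion_density_bar (g c) (chart_fun c b) z))"
  by (simp_all add: top_density_def form_mult_def form_wedge_def form_scale_def chart_fun_def[of c f]
      ext_wedge_scale_right form_torsion_densities[OF assms])

lemma density_energy:
  assumes "smooth_fun A \<phi>" "c \<in> A" "z \<in> cimg c"
  shows "top_density ((\<phi> \<cdot>\<^sub>F (omega g \<and>\<^sub>F omega g + omega g \<and>\<^sub>F omega_phi g \<phi> + omega_phi g \<phi> \<and>\<^sub>F omega_phi g \<phi>)) c z)
      = 4 * (chart_fun c \<phi> z * volume_average (g c) (chart_fun c \<phi>) z)"
    and "top_density ((\<phi> \<cdot>\<^sub>F ((-\<i>) *\<^sub>F (del (omega g) \<and>\<^sub>F delbar (fun_form \<phi>))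
                      + \<i> *\<^sub>F (delbar (omega g) \<and>\<^sub>F del (fun_form \<phi>)))) c z)
      = 4 * (chart_fun c \<phi> z * (- \<i> * torsion_density (g c) (chart_fun c \<phi>) z
           + \<i> * torsion_density_bar (g c) (chart_fun c \<phi>) z))"
  by (simp_all add: top_density_def form_mult_def form_wedge_def form_scale_def
      form_torsion_densities[OF assms] omega_phi_perturbed[OF assms])
     (simp_all add: omega_def top_herm_wedge_herm volume_average_def chart_fun_def algebra_simps)

lemma smooth_path_family:
  assumes "smooth_path A g \<phi>' \<phi>'' \<gamma>" "c \<in> A"
  shows "smooth_family (cimg c) (\<lambda>t. chart_fun c (\<gamma> t))"
    and "t \<in> {0..1} \<Longrightarrow> z \<in> cimg c \<Longrightarrow> time_deriv (\<lambda>t. chart_fun c (\<gamma> t)) t z = chart_fun c (path_deriv \<gamma> t) z"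
    and "t \<in> {0..1} \<Longrightarrow> smooth_on (cimg c) (\<lambda>z. path_deriv \<gamma> t (cinv c z))"
proof -
  let ?v = "\<lambda>t z. \<gamma> t (cinv c z)"
  have v: "smooth_family (cimg c) ?v"
    using assms by (simp add: smooth_path_def smooth_family_def)
  have op: "open (cimg c)" by (rule open_cimg[OF X assms(2)])
  show "smooth_family (cimg c) (\<lambda>t. chart_fun c (\<gamma> t))"
    using smooth_on_of_real[OF v[unfolded smooth_family_def]]
    by (simp add: smooth_family_def chart_fun_def case_prod_unfold)
  have pd: "time_deriv ?v t z = path_deriv \<gamma> t (cinv c z)" for t z
    by (simp add: time_deriv_def path_deriv_def)
  show "time_deriv (\<lambda>t. chart_fun c (\<gamma> t)) t z = chart_fun c (path_deriv \<gamma> t) z" if "t \<in> {0..1}" "z \<in> cimg c"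
    unfolding time_deriv_def[of "\<lambda>t. chart_fun c (\<gamma> t)"]
  proof (rule vector_derivative_within_closed_interval)
    show "((\<lambda>s. chart_fun c (\<gamma> s) z) has_vector_derivative chart_fun c (path_deriv \<gamma> t) z) (at t within {0..1})"
      unfolding chart_fun_def pd[symmetric]
      by (rule bounded_linear.has_vector_derivative[OF bounded_linear_of_real smooth_family_has_time_deriv[OF v op that]])
  qed (use that in auto)
  show "smooth_on (cimg c) (\<lambda>z. path_deriv \<gamma> t (cinv c z))" if "t \<in> {0..1}"
    using smooth_family_slice[OF smooth_family_time_deriv[OF v op] op that]
    by (rule smooth_on_cong) (rule pd)
qed

lemma smooth_path_potentials:
  "smooth_path A g \<phi>' \<phi>'' \<gamma> \<Longrightarrow> t \<in> {0..1} \<Longrightarrow> \<gamma> t \<in> potentials A g"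
  by (simp add: smooth_path_def)

lemma smooth_path_deriv_smooth:
  "smooth_path A g \<phi>' \<phi>'' \<gamma> \<Longrightarrow> t \<in> {0..1} \<Longrightarrow> smooth_fun A (path_deriv \<gamma> t)"
  unfolding smooth_fun_def using smooth_path_family(3) by blast

lemma covariant11_stokes_matrix:
  assumes "smooth_fun A f"
  shows "covariant11 A (\<lambda>c. stokes_matrix (g c) (chart_fun c f))"
  using covariant11_metric[OF hg] covariant11_hess[OF X assms]
  unfolding covariant11_def stokes_matrix_def hess_def
  by (simp add: sum_2 algebra_simps)

context
  fixes F :: "'a chart set" and \<rho> :: "'a chart \<Rightarrow> 'a \<Rightarrow> real"
  assumes P: "partition_of_unity A F \<rho>"
    and FI: "\<And>\<eta>. form_integral A \<eta> = partition_integral F \<rho> (\<lambda>c z. top_density (\<eta> c z))"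
begin

lemma smooth_on_stokes_divergence:
  assumes "smooth_fun A a" "smooth_fun A b" "smooth_fun A f" "c \<in> F"
  shows smooth_flux: "smooth_on (cimg c) (flux (chart_fun c a) (stokes_matrix (g c) (chart_fun c f)) (chart_fun c b) k)"
      "smooth_on (cimg c) (flux_bar (chart_fun c a) (stokes_matrix (g c) (chart_fun c f)) (chart_fun c b) k)"
    and "continuous_on (cimg c) (stokes_divergence (chart_fun c a) (stokes_matrix (g c) (chart_fun c f)) (chart_fun c b))"
proof -
  have c: "c \<in> A" by (rule partition_chart[OF X P assms(4)])
  have op: "open (cimg c)" by (rule open_cimg[OF X c])
  note sm = smooth_chart_fun[OF X _ c]
  have sH: "smooth_on (cimg c) (\<lambda>z. stokes_matrix (g c) (chart_fun c f) z $ i $ j)" for i j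
    unfolding stokes_matrix_def vec_lambda_beta
    by (intro smooth_on_add smooth_on_mult smooth_on_const metric_smooth(2) c smooth_on_wirtinger sm assms op)
  have fl: "smooth_on (cimg c) (flux (chart_fun c a) (stokes_matrix (g c) (chart_fun c f)) (chart_fun c b) k)"
      "smooth_on (cimg c) (flux_bar (chart_fun c a) (stokes_matrix (g c) (chart_fun c f)) (chart_fun c b) k)" for k
    unfolding flux_def flux_bar_def
    by (split if_split, intro conjI impI smooth_on_mult smooth_on_diff sH sm assms smooth_on_wirtinger op)+
  then show "smooth_on (cimg c) (flux (chart_fun c a) (stokes_matrix (g c) (chart_fun c f)) (chart_fun c b) k)"
      "smooth_on (cimg c) (flux_bar (chart_fun c a) (stokes_matrix (g c) (chart_fun c f)) (chart_fun c b) k)" by auto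
  have "continuous_on (cimg c) (\<lambda>z. stokes_divergence (chart_fun c a) (stokes_matrix (g c) (chart_fun c f)) (chart_fun c b) z)"
    unfolding stokes_divergence_def
    by (intro smooth_on_imp_continuous_on smooth_on_sum smooth_on_add smooth_on_wirtinger fl op)
  then show "continuous_on (cimg c) (stokes_divergence (chart_fun c a) (stokes_matrix (g c) (chart_fun c f)) (chart_fun c b))" .
qed

text \<open>The contraction of the flux with a function is \<open>a\<close> times the gradient pairing, which has the invariance
  that \<open>stokes\<close> asks for.\<close>

lemma integral_stokes_divergence:
  assumes a: "smooth_fun A a" and b: "smooth_fun A b" and f: "smooth_fun A f"
  shows "partition_integral F \<rho> (\<lambda>c. stokes_divergence (chart_fun c a) (stokes_matrix (g c) (chart_fun c f)) (chart_fun c b)) = 0"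
proof -
  have "partition_integral F \<rho> (\<lambda>c z. \<Sum>k\<in>UNIV.
      dw k (flux (chart_fun c a) (stokes_matrix (g c) (chart_fun c f)) (chart_fun c b) k) z
    + dwb k (flux_bar (chart_fun c a) (stokes_matrix (g c) (chart_fun c f)) (chart_fun c b) k) z) = 0"
  proof (rule stokes[OF X P])
    fix c k assume "c \<in> F"
    then show "smooth_on (cimg c) (flux (chart_fun c a) (stokes_matrix (g c) (chart_fun c f)) (chart_fun c b) k)"
      "smooth_on (cimg c) (flux_bar (chart_fun c a) (stokes_matrix (g c) (chart_fun c f)) (chart_fun c b) k)"
      by (rule smooth_flux[OF a b f])+
  next
    fix c c' d z assume c: "c \<in> F" "c' \<in> F" and d: "d \<in> F" and z: "z \<in> overlap c c'"
    note cA = partition_chart[OF X P c(1)] partition_chart[OF X P c(2)]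
    show "(\<Sum>k\<in>UNIV. flux (chart_fun c a) (stokes_matrix (g c) (chart_fun c f)) (chart_fun c b) k z * dw k (chart_fun c (\<rho> d)) z
         + flux_bar (chart_fun c a) (stokes_matrix (g c) (chart_fun c f)) (chart_fun c b) k z * dwb k (chart_fun c (\<rho> d)) z)
      = complex_of_real ((cmod (complex_jacobian (transition c c') z))\<^sup>2) *
        (\<Sum>k\<in>UNIV. flux (chart_fun c' a) (stokes_matrix (g c') (chart_fun c' f)) (chart_fun c' b) k (transition c c' z)
            * dw k (chart_fun c' (\<rho> d)) (transition c c' z)
         + flux_bar (chart_fun c' a) (stokes_matrix (g c') (chart_fun c' f)) (chart_fun c' b) k (transition c c' z)
            * dwb k (chart_fun c' (\<rho> d)) (transition c c' z))"
      unfolding flux_gradient_pairing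
        gradient_pairing_transition[OF X cA z covariant11_stokes_matrix[OF f] partition_smooth[OF X P d] b]
        chart_fun_transition[OF X cA z] by (simp only: mult.left_commute)
  qed
  then show ?thesis unfolding stokes_divergence_def[abs_def] .
qed

text \<open>The energy is a primitive of the one-form that the functional integrates: the two divergences in
  \<open>energy_variation_eq\<close> integrate to zero.\<close>

lemma total_energy_has_derivative:
  assumes path: "smooth_path A g \<phi>' \<phi>'' \<gamma>" and t: "t \<in> {0..1}"
  shows "((\<lambda>t. total_energy F \<rho> g (\<gamma> t)) has_vector_derivative
     partition_integral F \<rho> (\<lambda>c. mabuchi_density (g c) (chart_fun c (\<gamma> t)) (time_deriv (\<lambda>t. chart_fun c (\<gamma> t)) t)))
     (at t within {0..1})"
proof -
  let ?u = "\<lambda>c t. chart_fun c (\<gamma> t)"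
  let ?p = "path_deriv \<gamma> t"
  let ?S = "\<lambda>c a b. stokes_divergence (chart_fun c a) (stokes_matrix (g c) (?u c t)) (chart_fun c b)"
  let ?M = "\<lambda>c. mabuchi_density (g c) (?u c t) (time_deriv (?u c) t)"
  have cA: "c \<in> A" if "c \<in> F" for c by (rule partition_chart[OF X P that])
  have op: "open (cimg c)" if "c \<in> F" for c by (rule open_cimg[OF X cA[OF that]])
  have sg: "smooth_fun A (\<gamma> t)" by (rule potentials_smooth[OF smooth_path_potentials[OF path t]])
  have sp: "smooth_fun A ?p" by (rule smooth_path_deriv_smooth[OF path t])
  have su: "smooth_family (cimg c) (?u c)" if "c \<in> F" for c by (rule smooth_path_family(1)[OF path cA[OF that]])
  have sE: "smooth_family (cimg c) (\<lambda>t. energy_density (g c) (?u c t))" if "c \<in> F" for c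
    by (rule smooth_family_energy_density[OF op[OF that] metric_smooth(2)[OF cA[OF that]] su[OF that]])
  have eq: "time_deriv (\<lambda>t. energy_density (g c) (?u c t)) t z = ?M c z + (2/3 * ?S c (\<gamma> t) ?p z + (-2/3) * ?S c ?p (\<gamma> t) z)"
    if c: "c \<in> F" and z: "z \<in> cimg c" for c z
  proof -
    let ?q = "time_deriv (?u c) t"
    have q: "?q y = chart_fun c ?p y" if "y \<in> cimg c" for y
      by (rule smooth_path_family(2)[OF path cA[OF c] t that])
    have sq: "smooth_on (cimg c) ?q"
      by (rule smooth_family_slice[OF smooth_family_time_deriv[OF su[OF c] op[OF c]] op[OF c] t])
    have w: "wirtinger s k ?q y = wirtinger s k (chart_fun c ?p) y" if "y \<in> cimg c" for s k y
      by (rule wirtinger_cong[OF op[OF c] that q])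
    have f1: "stokes_divergence (?u c t) H ?q z = stokes_divergence (?u c t) H (chart_fun c ?p) z" for H
      unfolding stokes_divergence_def flux_def flux_bar_def sum_2
      by (simp, intro arg_cong2[where f = "(+)"] wirtinger_cong[OF op[OF c] z]) (simp_all add: w)
    have f2: "stokes_divergence ?q H (?u c t) z = stokes_divergence (chart_fun c ?p) H (?u c t) z" for H
      unfolding stokes_divergence_def flux_def flux_bar_def sum_2
      by (simp, intro arg_cong2[where f = "(+)"] wirtinger_cong[OF op[OF c] z]) (simp_all add: q)
    have "time_deriv (\<lambda>t. energy_density (g c) (?u c t)) t z = energy_variation (g c) (?u c t) ?q z"
      by (rule time_deriv_energy_density[OF op[OF c] metric_smooth(2)[OF cA[OF c]] su[OF c] t z])
    also have "\<dots> = ?M c z + 2/3 * (stokes_divergence (?u c t) (stokes_matrix (g c) (?u c t)) ?q z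
        - stokes_divergence ?q (stokes_matrix (g c) (?u c t)) (?u c t) z)"
      by (rule energy_variation_eq[OF op[OF c] z smooth_chart_fun[OF X sg cA[OF c]] sq metric_smooth(2)[OF cA[OF c]]])
    finally show ?thesis unfolding f1 f2 by (simp add: algebra_simps)
  qed
  have cS: "continuous_on (cimg c) (?S c a b)" if "c \<in> F" "smooth_fun A a" "smooth_fun A b" for c a b
    using smooth_on_stokes_divergence(3)[OF that(2,3) sg that(1)] .
  have cE: "continuous_on (cimg c) (time_deriv (\<lambda>t. energy_density (g c) (?u c t)) t)" if "c \<in> F" for c
    by (rule smooth_on_imp_continuous_on[OF smooth_family_slice[OF smooth_family_time_deriv[OF sE[OF that] op[OF that]] op[OF that] t]])
  have cM: "continuous_on (cimg c) (?M c)" if "c \<in> F" for c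
  proof -
    have "continuous_on (cimg c) (\<lambda>z. time_deriv (\<lambda>t. energy_density (g c) (?u c t)) t z - (2/3 * ?S c (\<gamma> t) ?p z + (-2/3) * ?S c ?p (\<gamma> t) z))"
      by (intro continuous_intros cE cS sg sp that)
    then show ?thesis by (rule continuous_on_eq) (simp add: eq that)
  qed
  have "((\<lambda>t. total_energy F \<rho> g (\<gamma> t)) has_vector_derivative
     partition_integral F \<rho> (\<lambda>c. time_deriv (\<lambda>t. energy_density (g c) (?u c t)) t)) (at t within {0..1})"
    unfolding total_energy_def by (rule partition_integral_has_vector_derivative[OF X P sE t])
  moreover have "partition_integral F \<rho> (\<lambda>c. time_deriv (\<lambda>t. energy_density (g c) (?u c t)) t)
     = partition_integral F \<rho> (\<lambda>c z. ?M c z + (2/3 * ?S c (\<gamma> t) ?p z + (-2/3) * ?S c ?p (\<gamma> t) z))"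
    by (rule partition_integral_cong[OF X P eq])
  moreover have "\<dots> = partition_integral F \<rho> ?M
     + (2/3 * partition_integral F \<rho> (\<lambda>c. ?S c (\<gamma> t) ?p) + (-2/3) * partition_integral F \<rho> (\<lambda>c. ?S c ?p (\<gamma> t)))"
    unfolding partition_integral_cmult[OF X P, symmetric]
    by (subst partition_integral_add[OF X P], (intro continuous_intros cM cS sg sp; assumption)+,
        subst partition_integral_add[OF X P], (intro continuous_intros cM cS sg sp; assumption)+, rule refl)
  ultimately show ?thesis
    by (simp add: integral_stokes_divergence[OF sg sp sg] integral_stokes_divergence[OF sp sg sg])
qed

text \<open>The fundamental theorem of calculus for the energy. The functional is defined by three separate integrals
  over time, so each of them has to be integrable on its own; each integrand is continuous in time.\<close>

lemma Mabuchi_path_eq: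
  assumes path: "smooth_path A g \<phi>' \<phi>'' \<gamma>"
  shows "Mabuchi_path A g \<gamma> = (total_energy F \<rho> g \<phi>'' - total_energy F \<rho> g \<phi>') / Vol A g"
proof -
  let ?\<eta>1 = "\<lambda>t. path_deriv \<gamma> t \<cdot>\<^sub>F (omega_phi g (\<gamma> t) \<and>\<^sub>F omega_phi g (\<gamma> t))"
  let ?\<eta>2 = "\<lambda>t. \<i> *\<^sub>F (del (omega g) \<and>\<^sub>F (\<gamma> t \<cdot>\<^sub>F delbar (fun_form (path_deriv \<gamma> t))))"
  let ?\<eta>3 = "\<lambda>t. \<i> *\<^sub>F (delbar (omega g) \<and>\<^sub>F (\<gamma> t \<cdot>\<^sub>F del (fun_form (path_deriv \<gamma> t))))"
  let ?u = "\<lambda>c t. chart_fun c (\<gamma> t)"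
  let ?q = "\<lambda>c. time_deriv (?u c)"
  define d1 where "d1 = (\<lambda>c t z. 4 * (?q c t z * mixed_det (perturbed (g c) (?u c t) z) (perturbed (g c) (?u c t) z)))"
  define d2 where "d2 = (\<lambda>c t z. 4 * (\<i> * (?u c t z * torsion_density (g c) (?q c t) z)))"
  define d3 where "d3 = (\<lambda>c t z. 4 * (\<i> * (?u c t z * torsion_density_bar (g c) (?q c t) z)))"
  let ?I1 = "\<lambda>t. partition_integral F \<rho> (\<lambda>c. d1 c t)" and ?I2 = "\<lambda>t. partition_integral F \<rho> (\<lambda>c. d2 c t)"
    and ?I3 = "\<lambda>t. partition_integral F \<rho> (\<lambda>c. d3 c t)"
  have cA: "c \<in> A" if "c \<in> F" for c by (rule partition_chart[OF X P that])
  have op: "open (cimg c)" if "c \<in> F" for c by (rule open_cimg[OF X cA[OF that]])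
  have su: "smooth_family (cimg c) (?u c)" if "c \<in> F" for c by (rule smooth_path_family(1)[OF path cA[OF that]])
  have sq: "smooth_family (cimg c) (?q c)" if "c \<in> F" for c by (rule smooth_family_time_deriv[OF su[OF that] op[OF that]])
  have q: "?q c t z = chart_fun c (path_deriv \<gamma> t) z" if "c \<in> F" "t \<in> {0..1}" "z \<in> cimg c" for c t z
    by (rule smooth_path_family(2)[OF path cA[OF that(1)] that(2,3)])
  have wq: "wirtinger s k (?q c t) z = wirtinger s k (chart_fun c (path_deriv \<gamma> t)) z"
    if "c \<in> F" "t \<in> {0..1}" "z \<in> cimg c" for c t z s k
    by (rule wirtinger_cong[OF op[OF that(1)] that(3) q[OF that(1,2)]])
  have sd: "smooth_family (cimg c) (d1 c)" "smooth_family (cimg c) (d2 c)" "smooth_family (cimg c) (d3 c)" if c: "c \<in> F" for c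
    unfolding d1_def d2_def d3_def
    by (intro smooth_family_cmult smooth_family_mult smooth_family_mixed_det su[OF c] sq[OF c]
        smooth_family_perturbed[OF op[OF c] metric_smooth(2)[OF cA[OF c]] su[OF c]]
        smooth_family_torsion_density[OF op[OF c] metric_smooth(2)[OF cA[OF c]] su[OF c] sq[OF c]])+
  have cd: "continuous_on (cimg c) (d1 c t)" "continuous_on (cimg c) (d2 c t)" "continuous_on (cimg c) (d3 c t)"
    if c: "c \<in> F" and t: "t \<in> {0..1}" for c t
    by (rule smooth_on_imp_continuous_on, rule smooth_family_slice[OF _ op[OF c] t], rule sd[OF c])+
  have sg: "smooth_fun A (\<gamma> t)" if "t \<in> {0..1}" for t
    by (rule potentials_smooth[OF smooth_path_potentials[OF path that]])
  note sp = smooth_path_deriv_smooth[OF path]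
  have I1: "form_integral A (?\<eta>1 t) = ?I1 t"
    and I2: "form_integral A (?\<eta>2 t) = ?I2 t"
    and I3: "form_integral A (?\<eta>3 t) = ?I3 t"
    if t: "t \<in> {0..1}" for t
    unfolding FI
    by (rule partition_integral_cong[OF X P],
        simp add: density_volume[OF sg[OF t] cA] density_torsion[OF sp[OF t] cA] d1_def d2_def d3_def q[OF _ t]
          torsion_density_def torsion_density_bar_def wq[OF _ t])+
  have int: "?I1 integrable_on {0..1}"
    "?I2 integrable_on {0..1}"
    "?I3 integrable_on {0..1}"
    by (rule integrable_continuous_real, rule partition_integral_continuous[OF X P], erule sd)+
  have M: "partition_integral F \<rho> (\<lambda>c. mabuchi_density (g c) (?u c t) (?q c t))
     = ?I1 t - ?I2 t + ?I3 t"
    if t: "t \<in> {0..1}" for t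
  proof -
    have "partition_integral F \<rho> (\<lambda>c. mabuchi_density (g c) (?u c t) (?q c t))
       = partition_integral F \<rho> (\<lambda>c z. (d1 c t z + (-1) * d2 c t z) + d3 c t z)"
      by (rule partition_integral_cong[OF X P]) (simp add: mabuchi_density_def d1_def d2_def d3_def)
    also have "\<dots> = (?I1 t + (-1) * ?I2 t) + ?I3 t"
      unfolding partition_integral_cmult[OF X P, symmetric]
      by (subst partition_integral_add[OF X P], (intro continuous_intros cd t; assumption)+,
        subst partition_integral_add[OF X P], (intro continuous_intros cd t; assumption)+, rule refl)
    finally show ?thesis by simp
  qed
  have "((\<lambda>t. partition_integral F \<rho> (\<lambda>c. mabuchi_density (g c) (?u c t) (?q c t))) has_integral
      total_energy F \<rho> g (\<gamma> 1) - total_energy F \<rho> g (\<gamma> 0)) {0..1}"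
    by (rule fundamental_theorem_of_calculus) (auto intro: total_energy_has_derivative[OF path])
  from has_integral_eq[OF M this]
  have "((\<lambda>t. ?I1 t - ?I2 t + ?I3 t)
     has_integral total_energy F \<rho> g \<phi>'' - total_energy F \<rho> g \<phi>') {0..1}"
    using path by (simp add: smooth_path_def)
  moreover have "((\<lambda>t. ?I1 t - ?I2 t + ?I3 t)
     has_integral integral {0..1} ?I1 - integral {0..1} ?I2
     + integral {0..1} ?I3) {0..1}"
    by (intro has_integral_add has_integral_diff integrable_integral int)
  ultimately have X: "integral {0..1} ?I1 - integral {0..1} ?I2
     + integral {0..1} ?I3 = total_energy F \<rho> g \<phi>'' - total_energy F \<rho> g \<phi>'"
    by (rule has_integral_unique[symmetric])
  have J: "integral {0..1} (\<lambda>t. form_integral A (?\<eta>1 t)) = integral {0..1} ?I1"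
    "integral {0..1} (\<lambda>t. form_integral A (?\<eta>2 t)) = integral {0..1} ?I2"
    "integral {0..1} (\<lambda>t. form_integral A (?\<eta>3 t)) = integral {0..1} ?I3"
    by (rule integral_cong, erule I1 I2 I3)+
  show ?thesis
    unfolding Mabuchi_path_def J X[symmetric] by (simp add: add_divide_distrib diff_divide_distrib)
qed

lemma total_energy_eq_form_integral:
  assumes "smooth_fun A \<phi>"
  shows "total_energy F \<rho> g \<phi> =
      1/3 * form_integral A (\<phi> \<cdot>\<^sub>F (omega g \<and>\<^sub>F omega g + omega g \<and>\<^sub>F omega_phi g \<phi> + omega_phi g \<phi> \<and>\<^sub>F omega_phi g \<phi>))
    + 1/2 * form_integral A (\<phi> \<cdot>\<^sub>F ((-\<i>) *\<^sub>F (del (omega g) \<and>\<^sub>F delbar (fun_form \<phi>))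
                      + \<i> *\<^sub>F (delbar (omega g) \<and>\<^sub>F del (fun_form \<phi>))))"
proof -
  let ?u = "\<lambda>c. chart_fun c \<phi>"
  let ?d1 = "\<lambda>c z. 4 * (?u c z * volume_average (g c) (?u c) z)"
  let ?d2 = "\<lambda>c z. 4 * (?u c z * (- \<i> * torsion_density (g c) (?u c) z + \<i> * torsion_density_bar (g c) (?u c) z))"
  have cA: "c \<in> A" if "c \<in> F" for c by (rule partition_chart[OF X P that])
  have fam: "smooth_family (cimg c) (\<lambda>t. ?u c)" if "c \<in> F" for c
    by (rule smooth_family_const[OF smooth_chart_fun[OF X assms cA[OF that]] open_cimg[OF X cA[OF that]]])
  have c0: "continuous_on (cimg c) (d (0::real))" if "smooth_family (cimg c) d" "c \<in> F" for c and d :: "real \<Rightarrow> complex^2 \<Rightarrow> complex"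
    by (rule smooth_on_imp_continuous_on[OF smooth_family_slice[OF that(1) open_cimg[OF X cA[OF that(2)]]]]) simp
  have c1: "continuous_on (cimg c) (?d1 c)" "continuous_on (cimg c) (?d2 c)" if c: "c \<in> F" for c
  proof -
    note U = open_cimg[OF X cA[OF c]] and G = metric_smooth(2)[OF cA[OF c]]
    have "smooth_family (cimg c) (\<lambda>t. ?d1 c)"
      unfolding volume_average_def
      by (intro smooth_family_cmult smooth_family_add smooth_family_mult smooth_family_mixed_det fam[OF c]
          smooth_family_metric[OF U G fam[OF c]] smooth_family_perturbed[OF U G fam[OF c]])
    from c0[OF this c] show "continuous_on (cimg c) (?d1 c)" .
    have "smooth_family (cimg c) (\<lambda>t. ?d2 c)"
      by (intro smooth_family_cmult smooth_family_add smooth_family_mult fam[OF c]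
          smooth_family_torsion_density[OF U G fam[OF c] fam[OF c]])
    from c0[OF this c] show "continuous_on (cimg c) (?d2 c)" .
  qed
  have "total_energy F \<rho> g \<phi> = partition_integral F \<rho> (\<lambda>c z. 1/3 * ?d1 c z + 1/2 * ?d2 c z)"
    unfolding total_energy_def by (rule partition_integral_cong[OF X P]) (simp add: energy_density_def algebra_simps)
  also have "\<dots> = 1/3 * partition_integral F \<rho> ?d1 + 1/2 * partition_integral F \<rho> ?d2"
    unfolding partition_integral_cmult[OF X P, symmetric]
    by (rule partition_integral_add[OF X P]) (intro continuous_intros c1; assumption)+
  also have "partition_integral F \<rho> ?d1 = form_integral A (\<phi> \<cdot>\<^sub>F (omega g \<and>\<^sub>F omega g + omega g \<and>\<^sub>F omega_phi g \<phi> + omega_phi g \<phi> \<and>\<^sub>F omega_phi g \<phi>))"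
    unfolding FI by (rule partition_integral_cong[OF X P, symmetric]) (rule density_energy(1)[OF assms cA])
  also have "partition_integral F \<rho> ?d2 = form_integral A (\<phi> \<cdot>\<^sub>F ((-\<i>) *\<^sub>F (del (omega g) \<and>\<^sub>F delbar (fun_form \<phi>))
                      + \<i> *\<^sub>F (delbar (omega g) \<and>\<^sub>F del (fun_form \<phi>))))"
    unfolding FI by (rule partition_integral_cong[OF X P, symmetric]) (rule density_energy(2)[OF assms cA])
  finally show ?thesis .
qed

lemma Vol_eq: "Vol A g = partition_integral F \<rho> (\<lambda>c z. 4 * mixed_det (g c z) (g c z))"
  unfolding Vol_def FI by (simp add: form_wedge_def omega_def top_density_def top_herm_wedge_herm)

lemma Vol_real: "Vol A g \<in> \<real>"
  unfolding Vol_eq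
proof (rule partition_integral_real[OF X P])
  fix c z assume "c \<in> F" "z \<in> cimg c"
  then obtain r where "mixed_det (g c z) (g c z) = complex_of_real r"
    using posdef_mixed_det_pos[OF metric_posdef[OF partition_chart[OF X P]]] by metis
  then show "cnj (4 * mixed_det (g c z) (g c z)) = 4 * mixed_det (g c z) (g c z)" by simp
qed

text \<open>The integrand is positive wherever some weight is; a vanishing integral would make a nonempty open set
  negligible. If the volume were zero, division by it would give zero and the last two formulas would fail.\<close>

lemma Vol_nonzero: "Vol A g \<noteq> 0"
proof
  assume V0: "Vol A g = 0"
  define r where "r = (\<lambda>c z. \<rho> c (cinv c z) * (4 * Re (mixed_det (g c z) (g c z))))"
  have cA: "c \<in> A" if "c \<in> F" for c by (rule partition_chart[OF X P that])
  have op: "open (cimg c)" if "c \<in> F" for c by (rule open_cimg[OF X cA[OF that]])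
  have md: "mixed_det (g c z) (g c z) = of_real (Re (mixed_det (g c z) (g c z)))" "0 < Re (mixed_det (g c z) (g c z))"
    if cF: "c \<in> F" and zc: "z \<in> cimg c" for c z
  proof -
    obtain s where "s > 0" "mixed_det (g c z) (g c z) = complex_of_real s"
      using posdef_mixed_det_pos[OF metric_posdef[OF cA[OF cF] zc]] by metis
    then show "mixed_det (g c z) (g c z) = of_real (Re (mixed_det (g c z) (g c z)))" "0 < Re (mixed_det (g c z) (g c z))"
      by simp_all
  qed
  have r0: "0 \<le> r c z" if "c \<in> F" "z \<in> cimg c" for c z
    unfolding r_def using md(2)[OF that] partition_nonneg[OF X P that(1)] by simp
  have eq: "weight \<rho> c z * (4 * mixed_det (g c z) (g c z)) = of_real (r c z)" if "c \<in> F" "z \<in> cimg c" for c z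
    unfolding weight_def chart_fun_def r_def using md(1)[OF that] by (metis of_real_mult of_real_numeral)
  have cm: "continuous_on (cimg c) (\<lambda>z. 4 * mixed_det (g c z) (g c z))" if "c \<in> F" for c
    unfolding mixed_det_def
    by (intro smooth_on_imp_continuous_on smooth_on_mult smooth_on_add smooth_on_diff smooth_on_const metric_smooth(2) cA that)
  have ri: "set_integrable lborel (cimg c) (\<lambda>z. complex_of_real (r c z))" if "c \<in> F" for c
    using set_integrable_weight[OF X P that cm[OF that]] eq[OF that]
    by (subst set_integrable_cong[OF refl refl eq[OF that, symmetric]])
  have ri': "integrable lborel (\<lambda>z. indicator (cimg c) z * r c z)" if "c \<in> F" for c
    using integrable_Re[OF ri[OF that, unfolded set_integrable_def]] by simp
  have "Vol A g = (\<Sum>c\<in>F. of_real (LINT z|lborel. indicator (cimg c) z * r c z))"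
    unfolding Vol_eq partition_integral_def
  proof (rule sum.cong[OF refl])
    fix c assume c: "c \<in> F"
    have "(LINT z:cimg c|lborel. weight \<rho> c z * (4 * mixed_det (g c z) (g c z))) = (LINT z:cimg c|lborel. complex_of_real (r c z))"
      using op[OF c] eq[OF c] by (intro set_lebesgue_integral_cong) (auto simp: borel_open)
    also have "\<dots> = (LINT z|lborel. complex_of_real (indicator (cimg c) z * r c z))"
      unfolding set_lebesgue_integral_def by (simp add: scaleR_conv_of_real)
    also have "\<dots> = of_real (LINT z|lborel. indicator (cimg c) z * r c z)"
      by (rule integral_complex_of_real)
    finally show "(LINT z:cimg c|lborel. weight \<rho> c z * (4 * mixed_det (g c z) (g c z)))
       = of_real (LINT z|lborel. indicator (cimg c) z * r c z)" .
  qed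
  then have "complex_of_real (\<Sum>c\<in>F. LINT z|lborel. indicator (cimg c) z * r c z) = 0"
    using V0 by simp
  then have s0: "(\<Sum>c\<in>F. LINT z|lborel. indicator (cimg c) z * r c z) = 0" by (simp only: of_real_eq_0_iff)
  have nn: "0 \<le> indicator (cimg c) z * r c z" if "c \<in> F" for c z
    using r0[OF that] by (auto simp: indicator_def)
  obtain x :: 'a where True by simp
  have "(\<Sum>c\<in>F. \<rho> c x) \<noteq> 0" using partition_sum[OF X P] by simp
  then obtain c where c: "c \<in> F" "\<rho> c x \<noteq> 0" by (meson sum.neutral)
  have "x \<in> closure {x. \<rho> c x \<noteq> 0}" using c(2) closure_subset[of "{x. \<rho> c x \<noteq> 0}"] by blast
  then have x: "x \<in> cdom c" using partition_support[OF X P c(1)] by blast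
  have "(LINT z|lborel. indicator (cimg c) z * r c z) = 0"
    using s0 c(1) by (subst (asm) sum_nonneg_eq_0_iff)
      (auto intro!: Bochner_Integration.integral_nonneg nn partition_finite[OF X P])
  then have AE: "AE z in lborel. indicator (cimg c) z * r c z = 0"
    using integral_nonneg_eq_0_iff_AE[OF ri'[OF c(1)]] nn[OF c(1)] by simp
  define S where "S = cimg c \<inter> (\<lambda>z. weight \<rho> c z * (4 * mixed_det (g c z) (g c z))) -` (- {0})"
  have "open S"
    unfolding S_def
    by (intro continuous_open_preimage continuous_on_mult[OF smooth_on_imp_continuous_on[OF smooth_weight[OF X P c(1)]] cm[OF c(1)]] op c) auto
  moreover have "cmap c x \<in> S"
    using c(2) x cmap_in[OF X x] cinv_cmap[OF X cA[OF c(1)] x] md(2)[OF c(1) cmap_in[OF X x]]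
    by (auto simp: S_def weight_def chart_fun_def)
  moreover have "negligible S"
  proof -
    have "AE z in lborel. z \<notin> S"
      using AE
    proof eventually_elim
      case (elim z)
      show ?case
      proof
        assume "z \<in> S"
        then have z: "z \<in> cimg c" "weight \<rho> c z * (4 * mixed_det (g c z) (g c z)) \<noteq> 0"
          unfolding S_def by blast+
        then have "r c z \<noteq> 0" unfolding eq[OF c(1) z(1)] by (simp only: of_real_eq_0_iff not_False_eq_True)
        then show False using elim z(1) by simp
      qed
    qed
    then have "S \<in> null_sets lborel"
      using \<open>open S\<close> by (subst AE_iff_null_sets) (auto simp: borel_open)
    then show ?thesis by (simp add: negligible_iff_null_sets null_sets_completionI)
  qed
  ultimately show False using open_not_negligible by blast
qed

end

end

section \<open>Reality of the energy density\<close>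

text \<open>The coefficients of the metric are Hermitian and \<open>u\<close> is real, so conjugation exchanges \<open>\<partial>\<omega>\<close> with its conjugate
  and transposes the Hessian.\<close>

lemma torsion_density_cnj:
  assumes U: "open U" "z \<in> U" and G: "\<And>i j. smooth_on U (\<lambda>z. G z $ i $ j)" "\<And>i j y. y \<in> U \<Longrightarrow> cnj (G y $ i $ j) = G y $ j $ i"
    and u: "smooth_on U u" "\<And>y. cnj (u y) = u y"
  shows "cnj (torsion_density G u z) = torsion_density_bar G u z"
    and "cnj (hess u z $ i $ j) = hess u z $ j $ i"
proof -
  have Gc: "cnj (wirtinger s k (\<lambda>z. G z $ i $ j) z) = wirtinger (cnj s) k (\<lambda>z. G z $ j $ i) z" for s k i j
  proof -
    have "cnj (wirtinger s k (\<lambda>z. G z $ i $ j) z) = wirtinger (cnj s) k (\<lambda>z. cnj (G z $ i $ j)) z"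
      by (simp add: wirtinger_cnj smooth_on_imp_differentiable[OF G(1) U])
    also have "\<dots> = wirtinger (cnj s) k (\<lambda>z. G z $ j $ i) z"
      by (rule wirtinger_cong[OF U]) (rule G(2))
    finally show ?thesis .
  qed
  have uc: "cnj (wirtinger s k u y) = wirtinger (cnj s) k u y" if "y \<in> U" for s k y
  proof -
    have "wirtinger (cnj s) k (\<lambda>z. cnj (u z)) y = cnj (wirtinger s k u y)"
      by (simp add: wirtinger_cnj smooth_on_imp_differentiable[OF u(1) U(1) that])
    then show ?thesis by (simp add: u(2))
  qed
  show "cnj (torsion_density G u z) = torsion_density_bar G u z"
    by (simp add: torsion_density_def torsion_density_bar_def torsion_pairing_def torsion_pairing_bar_def
        matrix_wirtinger_def Gc uc[OF U(2)])
  have "cnj (dw i (dwb j u) z) = dwb i (\<lambda>y. cnj (dwb j u y)) z"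
    by (simp add: wirtinger_cnj smooth_on_imp_differentiable[OF smooth_on_wirtinger[OF u(1) U(1)] U])
  also have "\<dots> = dwb i (dw j u) z"
    by (rule wirtinger_cong[OF U]) (simp add: uc)
  also have "\<dots> = dw j (dwb i u) z" by (rule wirtinger_commute[OF u(1) U])
  finally show "cnj (hess u z $ i $ j) = hess u z $ j $ i" by (simp add: hess_def)
qed

lemma energy_density_real:
  assumes U: "open U" "z \<in> U" and G: "\<And>i j. smooth_on U (\<lambda>z. G z $ i $ j)" "\<And>i j y. y \<in> U \<Longrightarrow> cnj (G y $ i $ j) = G y $ j $ i"
    and u: "smooth_on U u" "\<And>y. cnj (u y) = u y"
  shows "cnj (energy_density G u z) = energy_density G u z"
proof -
  note t = torsion_density_cnj[OF assms]
  have t': "cnj (torsion_density_bar G u z) = torsion_density G u z" using t(1) by (metis complex_cnj_cnj)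
  have p: "cnj (perturbed G u z $ i $ j) = perturbed G u z $ j $ i" for i j
    by (simp add: perturbed_def G(2)[OF U(2)] t(2))
  have "cnj (volume_average G u z) = volume_average G u z"
    unfolding volume_average_def complex_cnj_add
    by (simp add: mixed_det_def p G(2)[OF U(2)])
  then show ?thesis unfolding energy_density_def by (simp add: u(2) t t')
qed

section \<open>Convexity of the space of potentials and translation by constants\<close>

lemma herm_form_scale: "herm_form (\<chi> i j. r * h $ i $ j + s * k $ i $ j) = r *s herm_form h + s *s herm_form k"
proof -
  have "herm_form (\<chi> i j. r * h $ i $ j) = r *s herm_form h" for r :: complex and h
    by (simp add: herm_form_def vec_eq_iff sum_distrib_left mult_ac)
  moreover have "(\<chi> i j. r * h $ i $ j + s * k $ i $ j) = (\<chi> i j. r * h $ i $ j) + (\<chi> i j. s * k $ i $ j)"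
    by (simp add: vec_eq_iff)
  ultimately show ?thesis by (simp add: herm_form_add)
qed

lemma posdef_hermitian_convex:
  assumes "posdef_hermitian h" "posdef_hermitian k" "0 \<le> t" "t \<le> (1::real)"
  shows "posdef_hermitian (\<chi> i j. of_real (1 - t) * h $ i $ j + of_real t * k $ i $ j)"
  unfolding posdef_hermitian_def
proof (intro conjI allI impI)
  fix i j
  have "h $ j $ i = cnj (h $ i $ j)" "k $ j $ i = cnj (k $ i $ j)"
    using assms(1,2) unfolding posdef_hermitian_def by blast+
  then show "(\<chi> i j. of_real (1 - t) * h $ i $ j + of_real t * k $ i $ j) $ j $ i
    = cnj ((\<chi> i j. of_real (1 - t) * h $ i $ j + of_real t * k $ i $ j) $ i $ j)" by simp
next
  fix v :: "complex^2" assume v: "v \<noteq> 0"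
  let ?Q = "\<lambda>h :: complex^2^2. \<Sum>i\<in>UNIV. \<Sum>j\<in>UNIV. h $ i $ j * v $ i * cnj (v $ j)"
  have pos: "0 < Re (?Q h)" "0 < Re (?Q k)"
    using assms(1,2) v unfolding posdef_hermitian_def by blast+
  have "?Q (\<chi> i j. of_real (1 - t) * h $ i $ j + of_real t * k $ i $ j) = of_real (1 - t) * ?Q h + of_real t * ?Q k"
    by (simp add: sum_2 algebra_simps)
  then have "Re (?Q (\<chi> i j. of_real (1 - t) * h $ i $ j + of_real t * k $ i $ j)) = (1 - t) * Re (?Q h) + t * Re (?Q k)"
    by simp
  also have "\<dots> > 0"
  proof (cases "t = 0")
    case False
    then have "0 < t * Re (?Q k)" using assms(3) pos by simp
    moreover have "0 \<le> (1 - t) * Re (?Q h)" using assms(4) pos by simp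
    ultimately show ?thesis by linarith
  qed (use pos in simp)
  finally show "0 < Re (?Q (\<chi> i j. of_real (1 - t) * h $ i $ j + of_real t * k $ i $ j))" .
qed

lemma hess_lincomb:
  assumes "open U" "z \<in> U" "smooth_on U u" "smooth_on U v"
  shows "hess (\<lambda>z. r * u z + s * v z) z $ i $ j = r * hess u z $ i $ j + s * hess v z $ i $ j"
proof -
  note d = smooth_on_imp_differentiable[OF _ assms(1)]
  have 1: "dwb j (\<lambda>z. r * u z + s * v z) y = r * dwb j u y + s * dwb j v y" if "y \<in> U" for y
    using d[OF assms(3) that] d[OF assms(4) that] by (simp add: wirtinger_add wirtinger_cmult)
  have "dw i (dwb j (\<lambda>z. r * u z + s * v z)) z = dw i (\<lambda>y. r * dwb j u y + s * dwb j v y) z"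
    by (rule wirtinger_cong[OF assms(1,2) 1])
  also have "\<dots> = r * dw i (dwb j u) z + s * dw i (dwb j v) z"
    using d[OF smooth_on_wirtinger[OF assms(3,1)] assms(2)] d[OF smooth_on_wirtinger[OF assms(4,1)] assms(2)]
    by (simp add: wirtinger_add wirtinger_cmult)
  finally show ?thesis by (simp add: hess_def)
qed

context
  fixes A :: "'a::t2_space chart set" and g :: "'a chart \<Rightarrow> complex^2 \<Rightarrow> complex^2^2"
  assumes X: "compact_complex_surface A" and hg: "hermitian_metric A g"
begin

lemma potentials_convex:
  assumes \<phi>: "\<phi> \<in> potentials A g" and \<psi>: "\<psi> \<in> potentials A g" and t: "t \<in> {0..1}"
  shows "(\<lambda>x. (1 - t) * \<phi> x + t * \<psi> x) \<in> potentials A g"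
proof -
  let ?f = "\<lambda>x. (1 - t) * \<phi> x + t * \<psi> x"
  have s: "smooth_fun A \<phi>" "smooth_fun A \<psi>" using \<phi> \<psi> by (auto simp: potentials_def)
  have sf: "smooth_fun A ?f"
    by (intro smooth_fun_add[OF X] smooth_fun_mult[OF X] smooth_fun_const[OF X] s)
  have "ext_positive (omega_phi g ?f c z)" if c: "c \<in> A" and z: "z \<in> cimg c" for c z
  proof -
    obtain h where h: "posdef_hermitian h" "omega_phi g \<phi> c z = herm_form h"
      using \<phi> c z unfolding potentials_def ext_positive_def by blast
    obtain k where k: "posdef_hermitian k" "omega_phi g \<psi> c z = herm_form k"
      using \<psi> c z unfolding potentials_def ext_positive_def by blast
    have u: "chart_fun c ?f = (\<lambda>z. of_real (1 - t) * chart_fun c \<phi> z + of_real t * chart_fun c \<psi> z)"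
      by (rule ext) (simp add: chart_fun_def)
    have "perturbed (g c) (chart_fun c ?f) z = (\<chi> i j. of_real (1 - t) * perturbed (g c) (chart_fun c \<phi>) z $ i $ j
        + of_real t * perturbed (g c) (chart_fun c \<psi>) z $ i $ j)"
      unfolding perturbed_def u
      by (simp only: vec_eq_iff vector_add_component vec_lambda_beta
          hess_lincomb[OF open_cimg[OF X c] z smooth_chart_fun[OF X s(1) c] smooth_chart_fun[OF X s(2) c]])
         (simp add: algebra_simps)
    then have "omega_phi g ?f c z = of_real (1 - t) *s omega_phi g \<phi> c z + of_real t *s omega_phi g \<psi> c z"
      by (simp add: omega_phi_perturbed[OF X hg _ c z] sf s herm_form_scale)
    then have "omega_phi g ?f c z = herm_form (\<chi> i j. of_real (1 - t) * h $ i $ j + of_real t * k $ i $ j)"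
      unfolding h k herm_form_scale .
    then show ?thesis
      unfolding ext_positive_def using posdef_hermitian_convex[OF h(1) k(1)] t by auto
  qed
  then show ?thesis using sf by (auto simp: potentials_def)
qed

lemma straight_path:
  assumes \<phi>: "\<phi> \<in> potentials A g" and \<psi>: "\<psi> \<in> potentials A g"
  shows "smooth_path A g \<phi> \<psi> (\<lambda>t x. (1 - t) * \<phi> x + t * \<psi> x)"
  unfolding smooth_path_def
proof (intro conjI ballI)
  fix c assume c: "c \<in> A"
  have fam: "smooth_on ({0..1::real} \<times> cimg c) (\<lambda>p. f (cinv c (snd p)))" if "smooth_fun A f" for f
    using smooth_family_const[OF _ open_cimg[OF X c], of "\<lambda>z. f (cinv c z)"] that c
    by (auto simp: smooth_family_def smooth_fun_def case_prod_unfold)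
  have f: "smooth_on S (fst :: real \<times> (complex^2) \<Rightarrow> real)" for S
    by (rule smooth_on_linear[OF bounded_linear_fst])
  show "smooth_on ({0..1} \<times> cimg c) (\<lambda>(t, z). (1 - t) * \<phi> (cinv c z) + t * \<psi> (cinv c z))"
    unfolding case_prod_unfold
    by (intro smooth_on_add smooth_on_mult smooth_on_diff smooth_on_const f fam)
       (use \<phi> \<psi> in \<open>auto simp: potentials_def\<close>)
qed (use potentials_convex[OF \<phi> \<psi>] in auto)

lemma zero_potential: "(\<lambda>_. 0) \<in> potentials A g"
proof -
  have "ext_positive (omega_phi g (\<lambda>_. 0) c z)" if c: "c \<in> A" and z: "z \<in> cimg c" for c z
  proof -
    have "chart_fun c (\<lambda>_. 0) = (\<lambda>_. 0)" by (simp add: fun_eq_iff chart_fun_def)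
    moreover have "dwb j (\<lambda>_. 0) = (\<lambda>_. 0)" for j by (simp add: fun_eq_iff)
    ultimately have "perturbed (g c) (chart_fun c (\<lambda>_. 0)) z = g c z"
      by (simp add: perturbed_def hess_def vec_eq_iff)
    then show ?thesis
      using omega_phi_perturbed[OF X hg smooth_fun_const[OF X] c z] metric_posdef[OF X hg c z]
      by (auto simp: ext_positive_def)
  qed
  then show ?thesis using smooth_fun_const[OF X, of 0] by (auto simp: potentials_def)
qed

lemma omega_phi_add_constant:
  assumes \<phi>: "smooth_fun A \<phi>" and c: "c \<in> A" and z: "z \<in> cimg c"
  shows "omega_phi g (\<lambda>x. \<phi> x + C) c z = omega_phi g \<phi> c z"
proof -
  let ?u = "chart_fun c \<phi>"
  have u: "chart_fun c (\<lambda>x. \<phi> x + C) = (\<lambda>z. 1 * ?u z + 1 * of_real C)"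
    by (rule ext) (simp add: chart_fun_def)
  have "dwb j (\<lambda>_. w) = (\<lambda>_. 0)" for j w by (simp add: fun_eq_iff)
  then have "hess (chart_fun c (\<lambda>x. \<phi> x + C)) z = hess ?u z"
    unfolding u using hess_lincomb[OF open_cimg[OF X c] z smooth_chart_fun[OF X \<phi> c] smooth_on_const, of 1 1 "of_real C"]
    by (simp add: vec_eq_iff) (simp add: hess_def)
  then have "perturbed (g c) (chart_fun c (\<lambda>x. \<phi> x + C)) z = perturbed (g c) ?u z"
    by (simp add: perturbed_def)
  then show ?thesis
    using omega_phi_perturbed[OF X hg _ c z] \<phi> smooth_fun_add[OF X \<phi> smooth_fun_const[OF X]] by metis
qed

lemma potentials_add_constant: "\<phi> \<in> potentials A g \<Longrightarrow> (\<lambda>x. \<phi> x + C) \<in> potentials A g"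
  using smooth_fun_add[OF X _ smooth_fun_const[OF X]] by (auto simp: potentials_def omega_phi_add_constant)

text \<open>Along \<open>\<phi> + t C\<close> the form \<open>\<omega>\<^sub>\<phi>\<close> does not change and the velocity \<open>C\<close> has no derivatives, so only the first of
  the three integrals remains.\<close>

lemma Mabuchi_path_constant:
  assumes \<phi>: "\<phi> \<in> potentials A g"
  shows "Mabuchi_path A g (\<lambda>t x. (1 - t) * \<phi> x + t * (\<phi> x + C))
    = of_real C * (form_integral A (omega_phi g \<phi> \<and>\<^sub>F omega_phi g \<phi>) / Vol A g)"
proof -
  obtain F \<rho> where P: "partition_of_unity A F \<rho>"
    and FI: "\<And>\<eta>. form_integral A \<eta> = partition_integral F \<rho> (\<lambda>c z. top_density (\<eta> c z))"
    by (rule form_integral_partition[OF X]) (rule that)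
  let ?\<gamma> = "\<lambda>t x. (1 - t) * \<phi> x + t * (\<phi> x + C)"
  have s: "smooth_fun A \<phi>" using \<phi> by (simp add: potentials_def)
  have g: "?\<gamma> t = (\<lambda>x. \<phi> x + t * C)" for t by (simp add: fun_eq_iff algebra_simps)
  have pd: "path_deriv ?\<gamma> t = (\<lambda>_. C)" if t: "t \<in> {0..1}" for t
  proof
    fix x
    have "((\<lambda>s. \<phi> x + s * C) has_vector_derivative C) (at t within {0..1})"
      by (auto intro!: derivative_eq_intros simp flip: has_real_derivative_iff_has_vector_derivative)
    then show "path_deriv ?\<gamma> t x = C"
      unfolding path_deriv_def g using t by (intro vector_derivative_within_closed_interval) auto
  qed
  have cA: "c \<in> A" if "c \<in> F" for c by (rule partition_chart[OF X P that])
  have 1: "form_integral A (path_deriv ?\<gamma> t \<cdot>\<^sub>F (omega_phi g (?\<gamma> t) \<and>\<^sub>F omega_phi g (?\<gamma> t)))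
     = of_real C * form_integral A (omega_phi g \<phi> \<and>\<^sub>F omega_phi g \<phi>)" if t: "t \<in> {0..1}" for t
    unfolding FI pd[OF t] partition_integral_cmult[OF X P, symmetric] unfolding g
    by (rule partition_integral_cong[OF X P])
       (simp add: form_mult_def form_wedge_def top_density_def omega_phi_add_constant[OF s cA])
  have w0: "wirtinger k j (\<lambda>_. w) = (\<lambda>_. 0)" for k j w by (simp add: fun_eq_iff)
  have cc: "chart_fun c (\<lambda>_. C) = (\<lambda>_. of_real C)" for c by (simp add: fun_eq_iff chart_fun_def)
  have z: "partition_integral F \<rho> d = 0" if "\<And>c z. c \<in> F \<Longrightarrow> z \<in> cimg c \<Longrightarrow> d c z = 0" for d
    using partition_integral_cong[OF X P, of d "\<lambda>c z. 0"] that by (simp add: partition_integral_def)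
  have 2: "form_integral A (\<i> *\<^sub>F (del (omega g) \<and>\<^sub>F (?\<gamma> t \<cdot>\<^sub>F delbar (fun_form (path_deriv ?\<gamma> t))))) = 0"
    "form_integral A (\<i> *\<^sub>F (delbar (omega g) \<and>\<^sub>F (?\<gamma> t \<cdot>\<^sub>F del (fun_form (path_deriv ?\<gamma> t))))) = 0"
    if t: "t \<in> {0..1}" for t
    unfolding FI pd[OF t]
    by (rule z, simp add: density_torsion[OF X hg smooth_fun_const[OF X] cA] cc w0
        torsion_density_def torsion_density_bar_def torsion_pairing_def torsion_pairing_bar_def)+
  have J: "integral {0..1} (\<lambda>t. form_integral A (path_deriv ?\<gamma> t \<cdot>\<^sub>F (omega_phi g (?\<gamma> t) \<and>\<^sub>F omega_phi g (?\<gamma> t))))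
      = integral {0..1::real} (\<lambda>t. of_real C * form_integral A (omega_phi g \<phi> \<and>\<^sub>F omega_phi g \<phi>))"
    "integral {0..1} (\<lambda>t. form_integral A (\<i> *\<^sub>F (del (omega g) \<and>\<^sub>F (?\<gamma> t \<cdot>\<^sub>F delbar (fun_form (path_deriv ?\<gamma> t))))))
      = integral {0..1::real} (\<lambda>t. 0)"
    "integral {0..1} (\<lambda>t. form_integral A (\<i> *\<^sub>F (delbar (omega g) \<and>\<^sub>F (?\<gamma> t \<cdot>\<^sub>F del (fun_form (path_deriv ?\<gamma> t))))))
      = integral {0..1::real} (\<lambda>t. 0)"
    by (rule integral_cong, erule 1 2)+
  show ?thesis unfolding Mabuchi_path_def J by simp
qed

end

section \<open>Independence of the path, cocycle condition and explicit formulas\<close>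

theorem theorem1p2:
  fixes A :: "'a::t2_space chart set"
    and g :: "'a chart \<Rightarrow> complex^2 \<Rightarrow> complex^2^2"
  assumes "compact_complex_surface A"
    and "hermitian_metric A g"
  shows "(\<forall>\<phi>'\<in>potentials A g. \<forall>\<phi>''\<in>potentials A g.
            (\<exists>\<gamma>. smooth_path A g \<phi>' \<phi>'' \<gamma>) \<and>
            (\<forall>\<gamma>\<^sub>1 \<gamma>\<^sub>2. smooth_path A g \<phi>' \<phi>'' \<gamma>\<^sub>1 \<longrightarrow> smooth_path A g \<phi>' \<phi>'' \<gamma>\<^sub>2 \<longrightarrow>
               Mabuchi_path A g \<gamma>\<^sub>1 = Mabuchi_path A g \<gamma>\<^sub>2))
       \<and> (\<forall>\<phi>'\<in>potentials A g. \<forall>\<phi>''\<in>potentials A g. Mabuchi A g \<phi>' \<phi>'' \<in> \<real>)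
       \<and> one_cocycle (potentials A g) (Mabuchi A g)
       \<and> (\<forall>\<phi>\<in>potentials A g.
            Mabuchi A g (\<lambda>_. 0) \<phi> =
              1 / (3 * Vol A g) * form_integral A
                (\<phi> \<cdot>\<^sub>F (omega g \<and>\<^sub>F omega g + omega g \<and>\<^sub>F omega_phi g \<phi> + omega_phi g \<phi> \<and>\<^sub>F omega_phi g \<phi>))
            + 1 / (2 * Vol A g) * form_integral A
                (\<phi> \<cdot>\<^sub>F ((-\<i>) *\<^sub>F (del (omega g) \<and>\<^sub>F delbar (fun_form \<phi>))
                      + \<i> *\<^sub>F (delbar (omega g) \<and>\<^sub>F del (fun_form \<phi>)))))
       \<and> (\<forall>\<phi>\<in>potentials A g. \<forall>C::real.
            Mabuchi A g \<phi> (\<lambda>x. \<phi> x + C) = of_real C * (1 - Err A g \<phi> / Vol A g))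
       \<and> (\<forall>\<phi>\<^sub>1\<in>potentials A g. \<forall>\<phi>\<^sub>2\<in>potentials A g. \<forall>C::real.
            Mabuchi A g \<phi>\<^sub>1 (\<lambda>x. \<phi>\<^sub>2 x + C) =
              Mabuchi A g \<phi>\<^sub>1 \<phi>\<^sub>2 + of_real C * (1 - Err A g \<phi>\<^sub>2 / Vol A g))"
proof -
  note X = assms(1) and hg = assms(2)
  obtain F \<rho> where P: "partition_of_unity A F \<rho>"
    and FI: "\<And>\<eta>. form_integral A \<eta> = partition_integral F \<rho> (\<lambda>c z. top_density (\<eta> c z))"
    by (rule form_integral_partition[OF X]) (rule that)
  let ?E = "total_energy F \<rho> g" and ?P = "potentials A g" and ?M = "Mabuchi A g" and ?V = "Vol A g"
  note path_eq = Mabuchi_path_eq[OF X hg P FI]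
  note path_ex = straight_path[OF X hg]
  note V0 = Vol_nonzero[OF X hg P FI]
  have M: "?M \<phi>' \<phi>'' = (?E \<phi>'' - ?E \<phi>') / ?V" if "\<phi>' \<in> ?P" "\<phi>'' \<in> ?P" for \<phi>' \<phi>''
    unfolding Mabuchi_def
  proof (rule the_equality)
    show "\<exists>\<gamma>. smooth_path A g \<phi>' \<phi>'' \<gamma> \<and> (?E \<phi>'' - ?E \<phi>') / ?V = Mabuchi_path A g \<gamma>"
      by (rule exI, rule conjI[OF path_ex[OF that] path_eq[OF path_ex[OF that], symmetric]])
    show "v = (?E \<phi>'' - ?E \<phi>') / ?V" if "\<exists>\<gamma>. smooth_path A g \<phi>' \<phi>'' \<gamma> \<and> v = Mabuchi_path A g \<gamma>" for v
      using that path_eq by blast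
  qed
  have real: "?E \<phi> \<in> \<real>" if "\<phi> \<in> ?P" for \<phi>
    unfolding total_energy_def
  proof (rule partition_integral_real[OF X P])
    fix c z assume c: "c \<in> F" and z: "z \<in> cimg c"
    note cA = partition_chart[OF X P c]
    show "cnj (energy_density (g c) (chart_fun c \<phi>) z) = energy_density (g c) (chart_fun c \<phi>) z"
    proof (rule energy_density_real[OF open_cimg[OF X cA] z metric_smooth(2)[OF X hg cA]])
      show "cnj (g c y $ i $ j) = g c y $ j $ i" if "y \<in> cimg c" for y i j
      proof -
        have "g c y $ j $ i = cnj (g c y $ i $ j)"
          using metric_posdef[OF X hg cA that] unfolding posdef_hermitian_def by blast
        then show ?thesis by (rule sym)
      qed
      show "smooth_on (cimg c) (chart_fun c \<phi>)"
        by (rule smooth_chart_fun[OF X potentials_smooth[OF X hg \<open>\<phi> \<in> ?P\<close>] cA])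
    qed (simp add: chart_fun_def)
  qed
  have E0: "?E (\<lambda>_. 0) = 0"
    unfolding total_energy_def partition_integral_def energy_density_def chart_fun_def by simp
  have const: "?M \<phi> (\<lambda>x. \<phi> x + C) = of_real C * (1 - Err A g \<phi> / ?V)" if \<phi>: "\<phi> \<in> ?P" for \<phi> and C :: real
  proof -
    note p = path_ex[OF \<phi> potentials_add_constant[OF X hg \<phi>, of C]]
    have "?M \<phi> (\<lambda>x. \<phi> x + C) = of_real C * (form_integral A (omega_phi g \<phi> \<and>\<^sub>F omega_phi g \<phi>) / ?V)"
      unfolding M[OF \<phi> potentials_add_constant[OF X hg \<phi>]] path_eq[OF p, symmetric]
      by (rule Mabuchi_path_constant[OF X hg \<phi>])
    moreover have "1 - Err A g \<phi> / ?V = form_integral A (omega_phi g \<phi> \<and>\<^sub>F omega_phi g \<phi>) / ?V"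
      using V0 unfolding Err_def Vol_def[symmetric] by (simp add: field_simps)
    ultimately show ?thesis by simp
  qed
  show ?thesis
  proof (intro conjI ballI allI impI)
    fix \<phi>' \<phi>'' assume p: "\<phi>' \<in> ?P" "\<phi>'' \<in> ?P"
    show "\<exists>\<gamma>. smooth_path A g \<phi>' \<phi>'' \<gamma>" using path_ex[OF p] by blast
    show "Mabuchi_path A g \<gamma>\<^sub>1 = Mabuchi_path A g \<gamma>\<^sub>2" if "smooth_path A g \<phi>' \<phi>'' \<gamma>\<^sub>1" "smooth_path A g \<phi>' \<phi>'' \<gamma>\<^sub>2" for \<gamma>\<^sub>1 \<gamma>\<^sub>2
      using path_eq that by simp
    show "?M \<phi>' \<phi>'' \<in> \<real>"
      unfolding M[OF p] by (intro Reals_divide Reals_diff real p Vol_real[OF X hg P FI])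
  next
    show "one_cocycle ?P ?M"
      unfolding one_cocycle_def using zero_potential[OF X hg] by (auto simp: M diff_divide_distrib)
  next
    fix \<phi> assume \<phi>: "\<phi> \<in> ?P"
    show "?M (\<lambda>_. 0) \<phi> =
              1 / (3 * ?V) * form_integral A
                (\<phi> \<cdot>\<^sub>F (omega g \<and>\<^sub>F omega g + omega g \<and>\<^sub>F omega_phi g \<phi> + omega_phi g \<phi> \<and>\<^sub>F omega_phi g \<phi>))
            + 1 / (2 * ?V) * form_integral A
                (\<phi> \<cdot>\<^sub>F ((-\<i>) *\<^sub>F (del (omega g) \<and>\<^sub>F delbar (fun_form \<phi>))
                      + \<i> *\<^sub>F (delbar (omega g) \<and>\<^sub>F del (fun_form \<phi>))))"
      unfolding M[OF zero_potential[OF X hg] \<phi>] E0 total_energy_eq_form_integral[OF X hg P FI potentials_smooth[OF X hg \<phi>]]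
      by (simp add: add_divide_distrib)
    show "?M \<phi> (\<lambda>x. \<phi> x + C) = of_real C * (1 - Err A g \<phi> / ?V)" for C :: real
      by (rule const[OF \<phi>])
  next
    fix \<phi>\<^sub>1 \<phi>\<^sub>2 and C :: real assume p: "\<phi>\<^sub>1 \<in> ?P" "\<phi>\<^sub>2 \<in> ?P"
    have "?M \<phi>\<^sub>1 (\<lambda>x. \<phi>\<^sub>2 x + C) = ?M \<phi>\<^sub>1 \<phi>\<^sub>2 + ?M \<phi>\<^sub>2 (\<lambda>x. \<phi>\<^sub>2 x + C)"
      using p potentials_add_constant[OF X hg p(2)] by (simp add: M diff_divide_distrib)
    then show "?M \<phi>\<^sub>1 (\<lambda>x. \<phi>\<^sub>2 x + C) = ?M \<phi>\<^sub>1 \<phi>\<^sub>2 + of_real C * (1 - Err A g \<phi>\<^sub>2 / ?V)"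
      by (simp add: const[OF p(2)])
  qed
qed

end
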